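(* Let $n\ge 2$ and $\boldsymbol d=(d_1,\dots,d_n)\in\mathbb Z_{\ge 2}^n$ with $d_n-1>\sum_{i=1}^{n-1}(d_i-1)$. Then the Nash resultant variety $\mathcal R(\boldsymbol d)\subseteq\mathbb P(V^{\oplus n})$ is irreducible, of codimension $c:=d_n-1-\sum_{i=1}^{n-1}(d_i-1)$, and of degree $$\deg\mathcal R(\boldsymbol d)=\frac{(d_n-1)!}{(d_1-1)!\cdots(d_{n-1}-1)!\,c!}.$$
   Context: For $i\in[n]$ let $V_i=\mathbb C^{d_i}$ with coordinates $\pi^{(i)}=(\pi^{(i)}_1,\dots,\pi^{(i)}_{d_i})$, $V=V_1\otimes\cdots\otimes V_n$, $I=\prod_i[d_i]$, $\mathbb P^{\boldsymbol d}=\prod_i\mathbb P^{d_i-1}$. A game is $X=(X^{(1)},\dots,X^{(n)})\in V^{\oplus n}$ with $X^{(i)}=(x^{(i)}_{\boldsymbol j})_{\boldsymbol j\in I}$. For $i\in[n]$, $k\in[d_i]$, let $f^{(i)}_k=\sum x^{(i)}_{(j_1,\dots,j_{i-1},k,j_{i+1},\dots,j_n)}\prod_{l\ne i}\pi^{(l)}_{j_l}$, summed over all $(j_l)_{l\ne i}$. The Nash equilibrium scheme $\mathcal Z_X\subseteq\mathbb P^{\boldsymbol d}$ is defined by the multihomogeneous ideal generated by all $f^{(i)}_1-f^{(i)}_k$, $i\in[n]$, $k\in\{2,\dots,d_i\}$. The Nash resultant variety is $\mathcal R(\boldsymbol d)=\{[X]\in\mathbb P(V^{\oplus n}) : \mathcal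 Z_X\ne\emptyset\}$. *)

theory Defs
  imports Complex_Main "HOL-Library.FuncSet"
begin

definition ambient :: "'k set \<Rightarrow> ('k \<Rightarrow> complex) set" where
  "ambient K = {x. \<forall>k. k \<notin> K \<longrightarrow> x k = 0}"

inductive_set polyfun :: "'k set \<Rightarrow> (('k \<Rightarrow> complex) \<Rightarrow> complex) set" for K where
  const: "(\<lambda>x. c) \<in> polyfun K"
| var: "k \<in> K \<Longrightarrow> (\<lambda>x. x k) \<in> polyfun K"
| add: "p \<in> polyfun K \<Longrightarrow> q \<in> polyfun K \<Longrightarrow> (\<lambda>x. p x + q x) \<in> polyfun K"
| mult: "p \<in> polyfun K \<Longrightarrow> q \<in> polyfun K \<Longrightarrow> (\<lambda>x. p x * q x) \<in> polyfun K"

definition zariski_closed :: "'k set \<Rightarrow> ('k \<Rightarrow> complex) set \<Rightarrow> bool" where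
  "zariski_closed K Z \<longleftrightarrow>
     (\<exists>P. P \<subseteq> polyfun K \<and> Z = {x \<in> ambient K. \<forall>p\<in>P. p x = 0})"

definition zariski_irreducible :: "'k set \<Rightarrow> ('k \<Rightarrow> complex) set \<Rightarrow> bool" where
  "zariski_irreducible K Z \<longleftrightarrow> zariski_closed K Z \<and> Z \<noteq> {} \<and>
     (\<forall>Z1 Z2. zariski_closed K Z1 \<and> zariski_closed K Z2 \<and> Z = Z1 \<union> Z2 \<longrightarrow> Z1 = Z \<or> Z2 = Z)"

definition krull_dim :: "'k set \<Rightarrow> ('k \<Rightarrow> complex) set \<Rightarrow> nat" where
  "krull_dim K Z = Sup {l. \<exists>C :: nat \<Rightarrow> ('k \<Rightarrow> complex) set.
       (\<forall>i\<le>l. zariski_irreducible K (C i)) \<and> (\<forall>i<l. C i \<subset> C (Suc i)) \<and> C l \<subseteq> Z}"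

definition zariski_codim :: "'k set \<Rightarrow> ('k \<Rightarrow> complex) set \<Rightarrow> nat" where
  "zariski_codim K Z = card K - krull_dim K Z"

text \<open>Affine subspace {x. A x = b} of C^K cut out by m affine-linear equations;
  the parameters (A,b) form a point p of C^({..<m} x (Some`K \<union> {None})),
  with A r k = p (r, Some k) and b r = p (r, None).\<close>
definition affine_section :: "'k set \<Rightarrow> nat \<Rightarrow> (nat \<times> 'k option \<Rightarrow> complex) \<Rightarrow> ('k \<Rightarrow> complex) set" where
  "affine_section K m p = {x \<in> ambient K. \<forall>r<m. (\<Sum>k\<in>K. p (r, Some k) * x k) = p (r, None)}"

definition param_index :: "'k set \<Rightarrow> nat \<Rightarrow> (nat \<times> 'k option) set" where
  "param_index K m = {..<m} \<times> (Some ` K \<union> {None})"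

text \<open>Degree: a generic affine-linear section of complementary dimension meets Z in exactly
  delta points (generic = outside the zero set of a nonzero polynomial in the parameters).
  For a cone Z (affine cone over a projective variety), this is the degree of the projective variety.\<close>
definition has_degree :: "'k set \<Rightarrow> ('k \<Rightarrow> complex) set \<Rightarrow> nat \<Rightarrow> bool" where
  "has_degree K Z \<delta> \<longleftrightarrow>
     (let m = krull_dim K Z; PK = param_index K m in
      \<exists>Q \<in> polyfun PK. (\<exists>p \<in> ambient PK. Q p \<noteq> 0) \<and>
        (\<forall>p \<in> ambient PK. Q p \<noteq> 0 \<longrightarrow>
            finite (Z \<inter> affine_section K m p) \<and> card (Z \<inter> affine_section K m p) = \<delta>))"

section \<open>Games and the Nash resultant (0-based indices: players i < n, strategies k < d i)\<close>

definition profiles :: "nat \<Rightarrow> (nat \<Rightarrow> nat) \<Rightarrow> (nat \<Rightarrow> nat) set" where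
  "profiles n d = PiE {..<n} (\<lambda>l. {..<d l})"

text \<open>Coordinates of V^{\<oplus>n}: pairs (i, j) with player i and profile j; x^{(i)}_j = X (i, j).\<close>
definition game_index :: "nat \<Rightarrow> (nat \<Rightarrow> nat) \<Rightarrow> (nat \<times> (nat \<Rightarrow> nat)) set" where
  "game_index n d = {..<n} \<times> profiles n d"

definition nash_f :: "nat \<Rightarrow> (nat \<Rightarrow> nat) \<Rightarrow> (nat \<times> (nat \<Rightarrow> nat) \<Rightarrow> complex)
    \<Rightarrow> nat \<Rightarrow> nat \<Rightarrow> (nat \<Rightarrow> nat \<Rightarrow> complex) \<Rightarrow> complex" where
  "nash_f n d X i k \<pi> =
     (\<Sum>j\<in>{j \<in> profiles n d. j i = k}. X (i, j) * (\<Prod>l\<in>{..<n} - {i}. \<pi> l (j l)))"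

text \<open>Closed points of the Nash equilibrium scheme: points of \<Prod> P^{d_i - 1}
  (each \<pi> i is a nonzero vector of C^{d_i}) where all generators vanish.\<close>
definition nash_points :: "nat \<Rightarrow> (nat \<Rightarrow> nat) \<Rightarrow> (nat \<times> (nat \<Rightarrow> nat) \<Rightarrow> complex)
    \<Rightarrow> (nat \<Rightarrow> nat \<Rightarrow> complex) set" where
  "nash_points n d X = {\<pi>. (\<forall>i<n. \<exists>k<d i. \<pi> i k \<noteq> 0) \<and>
      (\<forall>i<n. \<forall>k<d i. nash_f n d X i 0 \<pi> = nash_f n d X i k \<pi>)}"

text \<open>Affine cone in V^{\<oplus>n} over the Nash resultant variety R(d) in P(V^{\<oplus>n}).\<close>
definition nash_resultant_cone :: "nat \<Rightarrow> (nat \<Rightarrow> nat) \<Rightarrow> (nat \<times> (nat \<Rightarrow> nat) \<Rightarrow> complex) set" where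
  "nash_resultant_cone n d = {X \<in> ambient (game_index n d). nash_points n d X \<noteq> {}}"

end

theory Submission
  imports Defs "HOL-Analysis.Analysis" "Jordan_Normal_Form.Determinant"
    "HOL-Combinatorics.Multiset_Permutations"
    "HOL-Computational_Algebra.Computational_Algebra" "HOL-Computational_Algebra.Field_as_Ring"
begin

text \<open>
  The equations of the first \<open>n - 1\<close> players are linear in the strategy of the last player, and there are
  fewer of them than its coordinates, so they never obstruct. The cone thus consists of the games for which
  \<open>M = d\<^sub>n - 1\<close> multilinear forms have a common zero on a product of projective spaces of total
  dimension \<open>s < M\<close>. It is closed by elimination theory. It is irreducible and of dimension at most
  \<open>card K - M + s\<close> because solving the equations for \<open>M\<close> coordinates over the affine chart parametrises a
  dense part of it. Shrinking the projective spaces one dimension at a time gives a chain of that length.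

  A linear section of the cone becomes a square multihomogeneous system. The number of its zeros does not
  change as long as all zeros are simple and stay in the affine chart, because a nonzero polynomial vanishes
  on the bad parameters and the complement of finitely many points of a complex line is connected. At one
  section built from the moment curve, the zeros are the factorisations of
  \<open>(x - 1) \<cdots> (x - M)\<close> into monic factors of degrees \<open>d\<^sub>1 - 1, \<dots>, d\<^bsub>n-1\<^esub> - 1, c\<close>.
  Generically distinct zeros belong to distinct games, by a dimension count.
\<close>

section \<open>Polynomial functions\<close>

text \<open>The degree counts games, while the square system counts pairs of a game and strategies.
  A homogenising coordinate makes game space projective of dimension \<open>card K\<close>, and then
  \<open>card K - c\<close> linear conditions and \<open>M\<close> forms match the dimension
  \<open>card K + s\<close> of the product, because \<open>M - c = s\<close>. The forms become
  values of a product of polynomials when the payoff difference of the last player at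
  \<open>J\<close> is \<open>k\<close> to the weight of \<open>J\<close> times the value at
  \<open>k\<close> of one further polynomial; its \<open>c\<close> lower coefficients are stored in
  payoffs of the first player, which the forms do not see. Strategies are read as coefficients in
  reverse order, so that leading coefficients are the coordinates normalised by the chart:
  \<open>M\<close> distinct roots for factors whose degrees add up to \<open>M\<close> force full
  degrees, so no zero leaves the chart, and the factors share no root, so all zeros are simple. The
  degree formula is the number of ways to distribute the roots. Elimination must yield a polynomial
  that is nonzero at this very section, so tangent vectors at multiple zeros are eliminated like one
  more projective factor.\<close>

lemma polyfun_sum:
  assumes "\<And>i. i \<in> I \<Longrightarrow> f i \<in> polyfun K"
  shows "(\<lambda>x. \<Sum>i\<in>I. f i x) \<in> polyfun K"
  using assms by (induction I rule: infinite_finite_induct) (auto intro: polyfun.intros)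

lemma polyfun_prod:
  assumes "\<And>i. i \<in> I \<Longrightarrow> f i \<in> polyfun K"
  shows "(\<lambda>x. \<Prod>i\<in>I. f i x) \<in> polyfun K"
  using assms by (induction I rule: infinite_finite_induct) (auto intro: polyfun.intros)

lemma polyfun_power: "f \<in> polyfun K \<Longrightarrow> (\<lambda>x. f x ^ n) \<in> polyfun K"
  by (induction n) (auto intro: polyfun.intros)

lemma polyfun_uminus: "f \<in> polyfun K \<Longrightarrow> (\<lambda>x. - f x) \<in> polyfun K"
  using polyfun.mult[OF polyfun.const[of "-1"]] by simp

lemma polyfun_diff: "f \<in> polyfun K \<Longrightarrow> g \<in> polyfun K \<Longrightarrow> (\<lambda>x. f x - g x) \<in> polyfun K"
  using polyfun.add[OF _ polyfun_uminus] by simp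

lemma polyfun_if: "f \<in> polyfun K \<Longrightarrow> g \<in> polyfun K \<Longrightarrow> (\<lambda>x. if P then f x else g x) \<in> polyfun K"
  by (cases P) simp_all

lemmas polyfun_intros = polyfun.intros polyfun_sum polyfun_prod polyfun_power polyfun_uminus
  polyfun_diff polyfun_if

lemma polyfun_subst:
  assumes "q \<in> polyfun K" "\<And>k. k \<in> K \<Longrightarrow> (\<lambda>y. \<phi> y k) \<in> polyfun L"
  shows "(\<lambda>y. q (\<phi> y)) \<in> polyfun L"
  using assms by (induction rule: polyfun.induct) (auto intro: polyfun.intros)

lemma polyfun_mono: "q \<in> polyfun K \<Longrightarrow> K \<subseteq> L \<Longrightarrow> q \<in> polyfun L"
  using polyfun_subst[of q K "\<lambda>y. y" L] by (auto intro: polyfun.intros)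

lemma polyfun_cong:
  assumes "q \<in> polyfun K" "\<And>k. k \<in> K \<Longrightarrow> x k = y k"
  shows "q x = q y"
  using assms by (induction rule: polyfun.induct) auto

lemma polyfun_tendsto:
  assumes "q \<in> polyfun K" "\<And>k. k \<in> K \<Longrightarrow> ((\<lambda>n. f n k) \<longlongrightarrow> x k) F"
  shows "((\<lambda>n. q (f n)) \<longlongrightarrow> q x) F"
  using assms by (induction rule: polyfun.induct) (auto intro!: tendsto_intros)

lemma polyfun_near:
  assumes "q \<in> polyfun K" "e > 0"
  shows "\<exists>\<eta>>0. \<forall>y. (\<forall>k\<in>K. cmod (y k - x k) < \<eta>) \<longrightarrow> cmod (q y - q x) < e"
proof (rule ccontr)
  assume neg: "\<not> ?thesis"
  have "\<exists>y. (\<forall>k\<in>K. cmod (y k - x k) < inverse (real (Suc n))) \<and> \<not> cmod (q y - q x) < e" for n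
  proof -
    have "inverse (real (Suc n)) > 0" by simp
    with neg show ?thesis by blast
  qed
  then obtain f where f: "\<And>n k. k \<in> K \<Longrightarrow> cmod (f n k - x k) < inverse (real (Suc n))"
    and f2: "\<And>n. \<not> cmod (q (f n) - q x) < e" by metis
  have "(\<lambda>n. f n k) \<longlonglongrightarrow> x k" if "k \<in> K" for k
  proof (rule Lim_transform_bound[where g = "\<lambda>n. inverse (real (Suc n))", THEN LIM_zero_cancel])
    show "\<forall>\<^sub>F n in sequentially. norm (f n k - x k) \<le> norm (inverse (real (Suc n)))"
      using f[OF that] by (intro always_eventually allI) (simp add: less_imp_le)
  qed (rule LIMSEQ_inverse_real_of_nat)
  then have "(\<lambda>n. q (f n)) \<longlonglongrightarrow> q x"
    by (intro polyfun_tendsto[OF assms(1)])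
  then have "\<forall>\<^sub>F n in sequentially. dist (q (f n)) (q x) < e"
    using assms(2) by (rule tendstoD)
  then obtain n where "dist (q (f n)) (q x) < e"
    using eventually_sequentially by force
  with f2 show False by (simp add: dist_norm)
qed

text \<open>An element of C[L][t], seen as a function of the variables in \<open>L\<close>. The
  degree bound is uniform in \<open>x\<close> because formal degrees of Sylvester determinants and
  ranges of coefficient sums must not depend on the point.\<close>

definition polyfam :: "'k set \<Rightarrow> (('k \<Rightarrow> complex) \<Rightarrow> complex poly) \<Rightarrow> bool" where
  "polyfam L F \<longleftrightarrow> (\<forall>i. (\<lambda>x. coeff (F x) i) \<in> polyfun L) \<and> (\<exists>N. \<forall>x. degree (F x) \<le> N)"

lemma polyfam_const: "f \<in> polyfun L \<Longrightarrow> polyfam L (\<lambda>x. [:f x:])"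
  unfolding polyfam_def
proof (intro conjI allI exI)
  fix i assume "f \<in> polyfun L" then show "(\<lambda>x. coeff [:f x:] i) \<in> polyfun L"
    by (cases i) (auto intro: polyfun.intros)
qed auto

lemma polyfam_X: "f \<in> polyfun L \<Longrightarrow> polyfam L (\<lambda>x. [:0, f x:])"
  unfolding polyfam_def
proof (intro conjI allI exI)
  fix i assume "f \<in> polyfun L" then show "(\<lambda>x. coeff [:0, f x:] i) \<in> polyfun L"
    by (cases i; cases "i - 1") (auto intro: polyfun.intros)
  show "degree [:0, f x:] \<le> 1" for x by simp
qed

lemma polyfam_add: "polyfam L F \<Longrightarrow> polyfam L G \<Longrightarrow> polyfam L (\<lambda>x. F x + G x)"
  unfolding polyfam_def
proof (elim conjE exE, intro conjI allI exI)
  fix N M x assume "\<forall>x. degree (F x) \<le> N" "\<forall>x. degree (G x) \<le> M"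
  then show "degree (F x + G x) \<le> max N M"
    by (meson degree_add_le_max max.mono order_trans)
qed (auto intro: polyfun.intros)

lemma polyfam_mult: "polyfam L F \<Longrightarrow> polyfam L G \<Longrightarrow> polyfam L (\<lambda>x. F x * G x)"
  unfolding polyfam_def
proof (elim conjE exE, intro conjI allI exI)
  fix N M x assume "\<forall>x. degree (F x) \<le> N" "\<forall>x. degree (G x) \<le> M"
  then show "degree (F x * G x) \<le> N + M"
    by (meson degree_mult_le add_mono order_trans)
qed (auto simp: coeff_mult intro!: polyfun_intros)

text \<open>One induction serves three substitutions: isolating a single variable, scaling a block
  of variables, and restricting to a line.\<close>

lemma polyfun_pencil:
  assumes "q \<in> polyfun K"
    and "\<And>k. k \<in> K \<Longrightarrow> \<exists>F. polyfam L F \<and> (\<forall>x t. \<phi> x t k = poly (F x) t)"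
  shows "\<exists>F. polyfam L F \<and> (\<forall>x t. q (\<phi> x t) = poly (F x) t)"
  using assms
proof (induction rule: polyfun.induct)
  case (const c)
  show ?case
    by (rule exI[of _ "\<lambda>x. [:c:]"]) (auto intro: polyfam_const polyfun.intros)
next
  case (add p q)
  then obtain F G where "polyfam L F" "\<forall>x t. p (\<phi> x t) = poly (F x) t"
    "polyfam L G" "\<forall>x t. q (\<phi> x t) = poly (G x) t" by auto
  then show ?case by (intro exI[of _ "\<lambda>x. F x + G x"]) (auto intro: polyfam_add)
next
  case (mult p q)
  then obtain F G where "polyfam L F" "\<forall>x t. p (\<phi> x t) = poly (F x) t"
    "polyfam L G" "\<forall>x t. q (\<phi> x t) = poly (G x) t" by auto
  then show ?case by (intro exI[of _ "\<lambda>x. F x * G x"]) (auto intro: polyfam_mult)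
qed auto

lemma polyfun_expand:
  assumes "q \<in> polyfun K"
  shows "\<exists>F. polyfam (K - {k}) F \<and> (\<forall>x t. q (x(k := t)) = poly (F x) t)"
proof (rule polyfun_pencil[OF assms])
  fix j assume "j \<in> K"
  then show "\<exists>F. polyfam (K - {k}) F \<and> (\<forall>x t. (x(k := t)) j = poly (F x) t)"
  proof (cases "j = k")
    case True
    then show ?thesis
      by (intro exI[of _ "\<lambda>x. [:0, 1:]"]) (auto intro: polyfam_X polyfun.intros)
  next
    case False
    with \<open>j \<in> K\<close> show ?thesis
      by (intro exI[of _ "\<lambda>x. [:x j:]"]) (auto intro!: polyfam_const polyfun.intros)
  qed
qed

text \<open>The action of scalars on one block of coordinates. The scalar 0 occurs too: it
  specialises the block to zero.\<close>

definition scale :: "'k set \<Rightarrow> complex \<Rightarrow> ('k \<Rightarrow> complex) \<Rightarrow> 'k \<Rightarrow> complex" where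
  "scale J l x = (\<lambda>k. if k \<in> J then l * x k else x k)"

lemma polyfun_scale_expand:
  assumes "q \<in> polyfun K"
  shows "\<exists>F. polyfam K F \<and> (\<forall>x t. q (scale J t x) = poly (F x) t)"
proof (rule polyfun_pencil[OF assms])
  fix j assume "j \<in> K"
  then show "\<exists>F. polyfam K F \<and> (\<forall>x t. scale J t x j = poly (F x) t)"
    by (cases "j \<in> J"; intro exI[of _ "\<lambda>x. if j \<in> J then [:0, x j:] else [:x j:]"])
      (auto simp: scale_def intro!: polyfam_X polyfam_const polyfun.intros)
qed

lemma polyfun_line:
  assumes "q \<in> polyfun K"
  shows "\<exists>f. \<forall>t. q (\<lambda>k. u k + t * v k) = poly f t"
proof -
  have "\<exists>F. polyfam K F \<and> (\<forall>x t. q (\<lambda>k. u k + t * v k) = poly (F (x::'a \<Rightarrow> complex)) t)"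
  proof (rule polyfun_pencil[OF assms])
    fix j assume "j \<in> K"
    have "polyfam K (\<lambda>x. [:u j:] + [:0, v j:])"
      by (intro polyfam_add polyfam_const polyfam_X polyfun.intros)
    then show "\<exists>F. polyfam K F \<and> (\<forall>(x::'a \<Rightarrow> complex) t. u j + t * v j = poly (F x) t)"
      by (intro exI[of _ "\<lambda>x. [:u j:] + [:0, v j:]"]) auto
  qed
  then show ?thesis by blast
qed

text \<open>Polynomial functions form an integral domain: on the line through \<open>u\<close> and
  \<open>v\<close> both functions become nonzero univariate polynomials, which have a common
  non-root.\<close>

lemma polyfun_common_nonzero:
  assumes "p \<in> polyfun K" "q \<in> polyfun K" "p u \<noteq> 0" "q v \<noteq> 0" "u \<in> ambient L" "v \<in> ambient L"
  shows "\<exists>w \<in> ambient L. p w \<noteq> 0 \<and> q w \<noteq> 0"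
proof -
  let ?w = "\<lambda>t k. u k + t * (v k - u k)"
  obtain f where f: "\<And>t. p (?w t) = poly f t" using polyfun_line[OF assms(1), of u "\<lambda>k. v k - u k"] by blast
  obtain g where g: "\<And>t. q (?w t) = poly g t" using polyfun_line[OF assms(2), of u "\<lambda>k. v k - u k"] by blast
  have "f \<noteq> 0" using f[of 0] assms(3) by auto
  moreover have "g \<noteq> 0" using g[of 1] assms(4) by auto
  ultimately have "f * g \<noteq> 0" by simp
  then have "finite {t. poly (f * g) t = 0}" by (rule poly_roots_finite)
  then obtain t where "poly (f * g) t \<noteq> 0"
    using infinite_UNIV_char_0 by (metis (mono_tags, lifting) UNIV_eq_I mem_Collect_eq)
  then have "p (?w t) \<noteq> 0" "q (?w t) \<noteq> 0" by (auto simp: f g)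
  moreover have "?w t \<in> ambient L" using assms by (auto simp: ambient_def)
  ultimately show ?thesis by blast
qed

lemma polyfun_prod_nonzero:
  assumes "finite I" "\<And>i. i \<in> I \<Longrightarrow> f i \<in> polyfun K" "\<And>i. i \<in> I \<Longrightarrow> \<exists>p \<in> ambient L. f i p \<noteq> 0"
  shows "\<exists>p \<in> ambient L. (\<Prod>i\<in>I. f i p) \<noteq> 0"
  using assms
proof (induction I)
  case empty
  have "(\<lambda>_. 0) \<in> ambient L" by (simp add: ambient_def)
  then show ?case by auto
next
  case (insert i I)
  obtain u v where u: "u \<in> ambient L" "f i u \<noteq> 0" and v: "v \<in> ambient L" "(\<Prod>i\<in>I. f i v) \<noteq> 0"
    using insert by (metis insertCI)
  have P: "(\<lambda>x. \<Prod>i\<in>I. f i x) \<in> polyfun K"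
    using insert by (intro polyfun_prod) auto
  have fi: "f i \<in> polyfun K" using insert by auto
  obtain w where "w \<in> ambient L" "f i w \<noteq> 0" "(\<Prod>i\<in>I. f i w) \<noteq> 0"
    using polyfun_common_nonzero[OF fi P u(2) v(2) u(1) v(1)] by blast
  then show ?case using insert by auto
qed

text \<open>The functions \<open>D k\<close> are divided differences; on the diagonal they are the partial derivatives.\<close>
lemma polyfun_Hadamard:
  assumes "q \<in> polyfun K" "finite K"
  shows "\<exists>D. (\<forall>k. (\<lambda>z. D k (z \<circ> Inl) (z \<circ> Inr)) \<in> polyfun (Inl ` K \<union> Inr ` K)) \<and>
    (\<forall>x y. q x - q y = (\<Sum>k\<in>K. (x k - y k) * D k x y))"
  using assms
proof (induction rule: polyfun.induct)
  case (const c)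
  show ?case by (rule exI[of _ "\<lambda>_ _ _. 0"]) (auto intro: polyfun_intros)
next
  case (var k)
  show ?case
    using var by (intro exI[of _ "\<lambda>j _ _. if j = k then 1 else 0"])
     (auto intro: polyfun_intros simp: if_distrib[of "\<lambda>t. _ * t"] cong: if_cong)
next
  case (add p q)
  obtain D where D: "\<forall>k. (\<lambda>z. D k (z \<circ> Inl) (z \<circ> Inr)) \<in> polyfun (Inl ` K \<union> Inr ` K)"
    "\<forall>x y. p x - p y = (\<Sum>k\<in>K. (x k - y k) * D k x y)" using add by blast
  obtain E where E: "\<forall>k. (\<lambda>z. E k (z \<circ> Inl) (z \<circ> Inr)) \<in> polyfun (Inl ` K \<union> Inr ` K)"
    "\<forall>x y. q x - q y = (\<Sum>k\<in>K. (x k - y k) * E k x y)" using add by blast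
  have "p x + q x - (p y + q y) = (\<Sum>k\<in>K. (x k - y k) * (D k x y + E k x y))" for x y
  proof -
    have "p x + q x - (p y + q y) = (p x - p y) + (q x - q y)" by simp
    then show ?thesis unfolding D(2)[rule_format] E(2)[rule_format]
      by (simp add: distrib_left flip: sum.distrib)
  qed
  then show ?case
    using polyfun.add[OF D(1)[rule_format] E(1)[rule_format]]
    by (intro exI[of _ "\<lambda>k x y. D k x y + E k x y"] conjI allI)
next
  case (mult p q)
  obtain D where D: "\<forall>k. (\<lambda>z. D k (z \<circ> Inl) (z \<circ> Inr)) \<in> polyfun (Inl ` K \<union> Inr ` K)"
    "\<forall>x y. p x - p y = (\<Sum>k\<in>K. (x k - y k) * D k x y)" using mult by blast
  obtain E where E: "\<forall>k. (\<lambda>z. E k (z \<circ> Inl) (z \<circ> Inr)) \<in> polyfun (Inl ` K \<union> Inr ` K)"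
    "\<forall>x y. q x - q y = (\<Sum>k\<in>K. (x k - y k) * E k x y)" using mult by blast
  have pI: "(\<lambda>z. p (z \<circ> Inl)) \<in> polyfun (Inl ` K \<union> Inr ` K)"
    by (rule polyfun_subst[OF mult.hyps(1)]) (auto intro: polyfun.var)
  have qI: "(\<lambda>z. q (z \<circ> Inr)) \<in> polyfun (Inl ` K \<union> Inr ` K)"
    by (rule polyfun_subst[OF mult.hyps(2)]) (auto intro: polyfun.var)
  have "p x * q x - p y * q y = (\<Sum>k\<in>K. (x k - y k) * (p x * E k x y + q y * D k x y))" for x y
  proof -
    have "p x * q x - p y * q y = p x * (q x - q y) + q y * (p x - p y)" by (simp add: algebra_simps)
    also have "\<dots> = (\<Sum>k\<in>K. (x k - y k) * (p x * E k x y + q y * D k x y))"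
      unfolding D(2)[rule_format] E(2)[rule_format]
      by (simp add: sum_distrib_left distrib_left mult.left_commute flip: sum.distrib)
    finally show ?thesis .
  qed
  then show ?case
    using polyfun.add[OF polyfun.mult[OF pI E(1)[rule_format]] polyfun.mult[OF qI D(1)[rule_format]]]
    by (intro exI[of _ "\<lambda>k x y. p x * E k x y + q y * D k x y"] conjI allI)
qed

text \<open>The difference quotient equals a combination of the divided differences between
  \<open>x + s v\<close> and \<open>x\<close> exactly, so continuity of polynomial functions gives
  the limit on the diagonal.\<close>

lemma polyfun_directional_derivative:
  assumes "q \<in> polyfun K" "finite K"
    and "\<And>k. (\<lambda>z. D k (z \<circ> Inl) (z \<circ> Inr)) \<in> polyfun (Inl ` K \<union> Inr ` K)"
    and "\<And>x y. q x - q y = (\<Sum>k\<in>K. (x k - y k) * D k x y)"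
  shows "((\<lambda>s. q (\<lambda>k. x k + s * v k)) has_field_derivative (\<Sum>k\<in>K. v k * D k x x)) (at 0)"
  unfolding has_field_derivative_iff
proof (rule Lim_transform_eventually)
  let ?xs = "\<lambda>s k. x k + s * v k"
  have "((\<lambda>s. D k (?xs s) x) \<longlongrightarrow> D k x x) (at 0)" if "k \<in> K" for k
  proof -
    have "((\<lambda>s. (\<lambda>z. D k (z \<circ> Inl) (z \<circ> Inr)) (case_sum (?xs s) x)) \<longlongrightarrow>
        (\<lambda>z. D k (z \<circ> Inl) (z \<circ> Inr)) (case_sum x x)) (at 0)"
    proof (rule polyfun_tendsto[OF assms(3)[of k]])
      fix j assume "j \<in> Inl ` K \<union> Inr ` K"
      then show "((\<lambda>s. case_sum (?xs s) x j) \<longlongrightarrow> case_sum x x j) (at 0)"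
        by (auto intro!: tendsto_eq_intros)
    qed
    then show ?thesis by (simp add: comp_def)
  qed
  then show "((\<lambda>s. \<Sum>k\<in>K. v k * D k (?xs s) x) \<longlongrightarrow> (\<Sum>k\<in>K. v k * D k x x)) (at 0)"
    by (intro tendsto_sum tendsto_mult_left)
  have "(\<Sum>k\<in>K. v k * D k (?xs s) x) = (q (?xs s) - q (?xs 0)) / (s - 0)" if "s \<noteq> 0" for s
    using that unfolding assms(4) by (simp add: sum_divide_distrib)
  then show "\<forall>\<^sub>F s in at 0. (\<Sum>k\<in>K. v k * D k (?xs s) x) = (q (?xs s) - q (?xs 0)) / (s - 0)"
    unfolding eventually_at_filter by (intro always_eventually) blast
qed

section \<open>Zariski closed sets through separating polynomials, and irreducibility\<close>

lemma zariski_closedI: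
  assumes "Z \<subseteq> ambient K"
    and "\<And>x. x \<in> ambient K \<Longrightarrow> x \<notin> Z \<Longrightarrow> \<exists>h \<in> polyfun K. (\<forall>z\<in>Z. h z = 0) \<and> h x \<noteq> 0"
  shows "zariski_closed K Z"
  unfolding zariski_closed_def
  by (rule exI[of _ "{h \<in> polyfun K. \<forall>z\<in>Z. h z = 0}"]) (use assms in blast)

lemma zariski_closedD:
  assumes "zariski_closed K Z"
  shows "Z \<subseteq> ambient K"
    and "x \<in> ambient K \<Longrightarrow> x \<notin> Z \<Longrightarrow> \<exists>h \<in> polyfun K. (\<forall>z\<in>Z. h z = 0) \<and> h x \<noteq> 0"
  using assms unfolding zariski_closed_def by blast+

lemma zariski_closed_inter_zero:
  assumes "zariski_closed K Z" "f \<in> polyfun K"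
  shows "zariski_closed K {z \<in> Z. f z = 0}"
proof (rule zariski_closedI)
  fix x assume "x \<in> ambient K" "x \<notin> {z \<in> Z. f z = 0}"
  then show "\<exists>h\<in>polyfun K. (\<forall>z\<in>{z \<in> Z. f z = 0}. h z = 0) \<and> h x \<noteq> 0"
    using zariski_closedD(2)[OF assms(1)] assms(2) by blast
qed (use zariski_closedD(1)[OF assms(1)] in auto)

lemma zariski_closed_zeros:
  assumes "P \<subseteq> polyfun K"
  shows "zariski_closed K {x \<in> ambient K. \<forall>p\<in>P. p x = 0}"
  using assms unfolding zariski_closed_def by blast

text \<open>The coordinate ring of an irreducible set has no zero divisors: the zero sets of the two
  factors cover \<open>Z\<close>.\<close>

lemma zariski_irreducible_prod:
  assumes "zariski_irreducible K Z" "p \<in> polyfun K" "q \<in> polyfun K" "\<And>z. z \<in> Z \<Longrightarrow> p z * q z = 0"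
  shows "(\<forall>z\<in>Z. p z = 0) \<or> (\<forall>z\<in>Z. q z = 0)"
proof -
  have "zariski_closed K Z" using assms by (simp add: zariski_irreducible_def)
  then have "zariski_closed K {z \<in> Z. p z = 0}" "zariski_closed K {z \<in> Z. q z = 0}"
    using assms zariski_closed_inter_zero by blast+
  moreover have "Z = {z \<in> Z. p z = 0} \<union> {z \<in> Z. q z = 0}" using assms(4) by auto
  ultimately have "{z \<in> Z. p z = 0} = Z \<or> {z \<in> Z. q z = 0} = Z"
    using assms(1) unfolding zariski_irreducible_def by blast
  then show ?thesis by blast
qed

text \<open>Irreducibility is inherited from affine space: equations separating points from two
  proper closed pieces pull back to nonzero functions, and these have a common point of
  nonvanishing. Density of the image is stated as a property of polynomials, so no closure operator
  is required.\<close>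

lemma zariski_irreducible_image:
  assumes "zariski_closed K Z"
    and \<phi>: "\<And>k. k \<in> K \<Longrightarrow> (\<lambda>y. \<phi> y k) \<in> polyfun Y" "\<And>y. y \<in> ambient Y \<Longrightarrow> \<phi> y \<in> Z"
    and dense: "\<And>p z. p \<in> polyfun K \<Longrightarrow> (\<And>y. y \<in> ambient Y \<Longrightarrow> p (\<phi> y) = 0) \<Longrightarrow> z \<in> Z \<Longrightarrow> p z = 0"
  shows "zariski_irreducible K Z"
  unfolding zariski_irreducible_def
proof (intro conjI allI impI)
  have "(\<lambda>_. 0) \<in> ambient Y" by (simp add: ambient_def)
  then show "Z \<noteq> {}" using \<phi>(2) by blast
  fix Z1 Z2 assume *: "zariski_closed K Z1 \<and> zariski_closed K Z2 \<and> Z = Z1 \<union> Z2"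
  show "Z1 = Z \<or> Z2 = Z"
  proof (rule ccontr)
    assume "\<not> ?thesis"
    then obtain x1 x2 where x: "x1 \<in> Z" "x1 \<notin> Z1" "x2 \<in> Z" "x2 \<notin> Z2" using * by blast
    have "Z \<subseteq> ambient K" using assms(1) zariski_closedD by blast
    then have xK: "x1 \<in> ambient K" "x2 \<in> ambient K" using x by auto
    obtain p1 where p1: "p1 \<in> polyfun K" "\<forall>z\<in>Z1. p1 z = 0" "p1 x1 \<noteq> 0"
      using x * xK zariski_closedD(2)[of K Z1 x1] by auto
    obtain p2 where p2: "p2 \<in> polyfun K" "\<forall>z\<in>Z2. p2 z = 0" "p2 x2 \<noteq> 0"
      using x * xK zariski_closedD(2)[of K Z2 x2] by auto
    note p = p1 p2
    obtain y1 where y1: "y1 \<in> ambient Y" "p1 (\<phi> y1) \<noteq> 0" using dense[OF p(1) _ x(1)] p(3) by blast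
    obtain y2 where y2: "y2 \<in> ambient Y" "p2 (\<phi> y2) \<noteq> 0" using dense[OF p(4) _ x(3)] p(6) by blast
    have "(\<lambda>y. p1 (\<phi> y)) \<in> polyfun Y" "(\<lambda>y. p2 (\<phi> y)) \<in> polyfun Y"
      using p \<phi> polyfun_subst by blast+
    from polyfun_common_nonzero[OF this y1(2) y2(2) y1(1) y2(1)]
    obtain w where "w \<in> ambient Y" "p1 (\<phi> w) \<noteq> 0" "p2 (\<phi> w) \<noteq> 0" by blast
    then show False using p * \<phi>(2)[of w] by blast
  qed
qed (use assms in auto)

text \<open>Gaussian elimination over arbitrary finite index sets. This is the only source of linear
  dependence in the proof: it yields inverses, algebraic relations between polynomials, and the
  strategy of the last player.\<close>

lemma homogeneous_system:
  fixes a :: "'e \<Rightarrow> 'u \<Rightarrow> complex"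
  assumes "finite E" "finite U" "card E < card U"
  shows "\<exists>c. (\<exists>u\<in>U. c u \<noteq> 0) \<and> (\<forall>u. u \<notin> U \<longrightarrow> c u = 0) \<and> (\<forall>e\<in>E. (\<Sum>u\<in>U. a e u * c u) = 0)"
  using assms
proof (induction E arbitrary: U a)
  case empty
  then obtain u where "u \<in> U" by fastforce
  then show ?case by (intro exI[of _ "\<lambda>v. if v = u then 1 else 0"]) auto
next
  case (insert e E)
  show ?case
  proof (cases "\<forall>u\<in>U. a e u = 0")
    case True
    have "card E < card U" using insert by simp
    from insert.IH[OF insert.prems(1) this, of a] True show ?thesis by auto
  next
    case False
    then obtain v where v: "v \<in> U" "a e v \<noteq> 0" by blast
    \<comment> \<open>The multiple of row \<open>e\<close> that clears column \<open>v\<close> is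
      subtracted from every other row.\<close>
    define a' where "a' e' u = a e' u - a e' v * a e u / a e v" for e' u
    have "card E < card (U - {v})" using insert v by auto
    from insert.IH[OF _ this, of a'] insert.prems obtain c where
      c: "\<exists>u\<in>U - {v}. c u \<noteq> 0" "\<forall>u. u \<notin> U - {v} \<longrightarrow> c u = 0"
      "\<forall>e'\<in>E. (\<Sum>u\<in>U - {v}. a' e' u * c u) = 0" by blast
    define S where "S = (\<Sum>u\<in>U - {v}. a e u * c u)"
    define b where "b = c(v := - S / a e v)"
    have sum: "(\<Sum>u\<in>U. a e' u * b u) = a e' v * (- S / a e v) + (\<Sum>u\<in>U - {v}. a e' u * c u)" for e'
      using insert.prems v by (subst sum.remove[of _ v]) (auto simp: b_def intro!: sum.cong)
    have "(\<Sum>u\<in>U. a e' u * b u) = 0" if "e' \<in> E" for e'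
    proof -
      have "0 = (\<Sum>u\<in>U - {v}. a' e' u * c u)" using c(3) that by simp
      also have "\<dots> = (\<Sum>u\<in>U - {v}. a e' u * c u) - a e' v / a e v * S"
        by (simp add: a'_def S_def sum_distrib_left sum_subtractf algebra_simps)
      finally show ?thesis unfolding sum by simp
    qed
    moreover have "(\<Sum>u\<in>U. a e u * b u) = 0"
      unfolding sum using v by (simp add: S_def)
    moreover have "\<exists>u\<in>U. b u \<noteq> 0" using c(1) by (auto simp: b_def)
    moreover have "\<forall>u. u \<notin> U \<longrightarrow> b u = 0" using c(2) v by (auto simp: b_def)
    ultimately show ?thesis by (intro exI[of _ b]) auto
  qed
qed

text \<open>Each rank argument is an application of \<open>homogeneous_system\<close> with one
  equation fewer or one unknown more. The second conclusion, injectivity of \<open>b\<close>, is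
  what later makes every fixed point of the Newton map a zero.\<close>

lemma left_inverse_matrix:
  fixes a :: "'e \<Rightarrow> 'u \<Rightarrow> complex"
  assumes fin: "finite E" "finite U" and card: "card E = card U"
    and inj: "\<And>c. \<forall>e\<in>E. (\<Sum>u\<in>U. a e u * c u) = 0 \<Longrightarrow> \<forall>u\<in>U. c u = 0"
  shows "\<exists>b. (\<forall>j\<in>U. \<forall>u\<in>U. (\<Sum>e\<in>E. b j e * a e u) = (if j = u then 1 else 0)) \<and>
     (\<forall>v. (\<forall>j\<in>U. (\<Sum>e\<in>E. b j e * v e) = 0) \<longrightarrow> (\<forall>e\<in>E. v e = 0))"
proof -
  \<comment> \<open>Without equation \<open>e0\<close> there are more unknowns than equations. A
    solution then satisfies equation \<open>e0\<close> as well, because of the relation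
    \<open>b\<close>, which contradicts injectivity.\<close>
  have left_kernel: "\<forall>e\<in>E. b e = 0" if b: "\<forall>u\<in>U. (\<Sum>e\<in>E. b e * a e u) = 0" for b
  proof (rule ccontr)
    assume "\<not> ?thesis"
    then obtain e0 where e0: "e0 \<in> E" "b e0 \<noteq> 0" by blast
    have "card (E - {e0}) < card U" using fin card e0 by (metis card_Diff1_less)
    from homogeneous_system[OF _ fin(2) this, of a] fin obtain c where
      c: "\<exists>u\<in>U. c u \<noteq> 0" "\<forall>e\<in>E - {e0}. (\<Sum>u\<in>U. a e u * c u) = 0" by blast
    have "0 = (\<Sum>u\<in>U. (\<Sum>e\<in>E. b e * a e u) * c u)" using b by simp
    also have "\<dots> = (\<Sum>e\<in>E. b e * (\<Sum>u\<in>U. a e u * c u))"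
      by (simp add: sum_distrib_left sum_distrib_right mult.assoc) (rule sum.swap)
    also have "\<dots> = b e0 * (\<Sum>u\<in>U. a e0 u * c u)"
      using fin e0 c(2) by (subst sum.remove[of _ e0]) auto
    finally have "(\<Sum>u\<in>U. a e0 u * c u) = 0" using e0 by simp
    then have "\<forall>e\<in>E. (\<Sum>u\<in>U. a e u * c u) = 0" using c(2) by blast
    then show False using inj c(1) by blast
  qed
  have "\<exists>b. \<forall>u\<in>U. (\<Sum>e\<in>E. b e * a e u) = (if j = u then 1 else 0)" if j: "j \<in> U" for j
  proof -
    \<comment> \<open>The extra unknown \<open>None\<close> multiplies the unit vector at
      \<open>j\<close>. It cannot vanish, since the rows are independent, and dividing by it gives
      row \<open>j\<close> of the inverse.\<close>
    let ?V = "insert None (Some ` E)"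
    let ?a = "\<lambda>u e. case e of None \<Rightarrow> - (if j = u then 1 else 0) | Some e \<Rightarrow> a e u"
    have "card U < card ?V" using fin card by (simp add: card_image)
    from homogeneous_system[OF fin(2) _ this, of ?a] fin obtain c where
      c: "\<exists>e\<in>?V. c e \<noteq> 0" "\<forall>u\<in>U. (\<Sum>e\<in>?V. ?a u e * c e) = 0" by blast
    have eq: "(\<Sum>e\<in>E. a e u * c (Some e)) = (if j = u then c None else 0)" if "u \<in> U" for u
      using c(2) that fin by (auto simp: sum.reindex split: if_splits)
    have "c None \<noteq> 0"
    proof
      assume "c None = 0"
      then have "\<forall>u\<in>U. (\<Sum>e\<in>E. c (Some e) * a e u) = 0" using eq by (auto simp: mult.commute)
      from left_kernel[OF this] c(1) \<open>c None = 0\<close> show False by auto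
    qed
    then have "\<forall>u\<in>U. (\<Sum>e\<in>E. c (Some e) / c None * a e u) = (if j = u then 1 else 0)"
      using eq by (auto simp: mult.commute simp flip: sum_divide_distrib)
    then show ?thesis by (intro exI[of _ "\<lambda>e. c (Some e) / c None"])
  qed
  then obtain b where b: "\<And>j u. j \<in> U \<Longrightarrow> u \<in> U \<Longrightarrow> (\<Sum>e\<in>E. b j e * a e u) = (if j = u then 1 else 0)"
    by metis
  moreover have "\<forall>e\<in>E. v e = 0" if v: "\<forall>j\<in>U. (\<Sum>e\<in>E. b j e * v e) = 0" for v
  proof (rule ccontr)
    assume "\<not> ?thesis"
    then obtain e0 where e0: "e0 \<in> E" "v e0 \<noteq> 0" by blast
    \<comment> \<open>Now the extra unknown multiplies \<open>v\<close>. Applying \<open>b\<close>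
      to the relation kills the other unknowns, so \<open>v\<close> itself must vanish.\<close>
    let ?V = "insert None (Some ` U)"
    let ?a = "\<lambda>e u. case u of None \<Rightarrow> v e | Some u \<Rightarrow> a e u"
    have "card E < card ?V" using fin card by (simp add: card_image)
    from homogeneous_system[OF fin(1) _ this, of ?a] fin obtain c where
      c: "\<exists>e\<in>?V. c e \<noteq> 0" "\<forall>e\<in>E. (\<Sum>u\<in>?V. ?a e u * c u) = 0" by blast
    have eq: "v e * c None + (\<Sum>u\<in>U. a e u * c (Some u)) = 0" if "e \<in> E" for e
      using c(2) that fin by (auto simp: sum.reindex)
    have cS: "c (Some j) = 0" if j: "j \<in> U" for j
    proof -
      have "0 = (\<Sum>e\<in>E. b j e * (v e * c None + (\<Sum>u\<in>U. a e u * c (Some u))))" using eq by simp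
      also have "\<dots> = (\<Sum>e\<in>E. b j e * v e) * c None + (\<Sum>e\<in>E. \<Sum>u\<in>U. b j e * a e u * c (Some u))"
        by (simp add: algebra_simps sum.distrib sum_distrib_left)
      also have "(\<Sum>e\<in>E. \<Sum>u\<in>U. b j e * a e u * c (Some u)) = (\<Sum>u\<in>U. (\<Sum>e\<in>E. b j e * a e u) * c (Some u))"
        by (subst sum.swap) (simp add: sum_distrib_right)
      also have "\<dots> = (\<Sum>u\<in>U. if j = u then c (Some u) else 0)"
        using b j by (intro sum.cong) auto
      finally show ?thesis using v j fin by simp
    qed
    then have "c None \<noteq> 0" using c(1) by auto
    then show False using eq[OF e0(1)] cS e0 by simp
  qed
  ultimately show ?thesis by blast
qed

section \<open>Algebraic dependence and chains of irreducible sets\<close>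

lemma poly_sum_upto:
  fixes p :: "complex poly"
  assumes "degree p \<le> N"
  shows "poly p x = (\<Sum>i\<le>N. coeff p i * x ^ i)"
  unfolding poly_altdef using assms
  by (intro sum.mono_neutral_left) (auto simp: coeff_eq_0)

definition monomial_fun :: "'k set \<Rightarrow> ('k \<Rightarrow> nat) \<Rightarrow> ('k \<Rightarrow> complex) \<Rightarrow> complex" where
  "monomial_fun K b x = (\<Prod>k\<in>K. x k ^ b k)"

lemma mono_add: "monomial_fun K (\<lambda>k. b k + c k) x = monomial_fun K b x * monomial_fun K c x"
  by (simp add: monomial_fun_def power_add prod.distrib)

lemma mono_restrict: "monomial_fun K (restrict b K) = monomial_fun K b"
  by (auto simp: monomial_fun_def intro!: ext prod.cong)

lemma polyfun_mono_fun: "monomial_fun K b \<in> polyfun K"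
  unfolding monomial_fun_def by (intro polyfun_intros)

text \<open>The exponent of each variable is bounded separately, so the exponents form a box of
  \<open>(N + 1) ^ card K\<close> points and the bounds still add under multiplication.\<close>

definition expdeg :: "'k set \<Rightarrow> nat \<Rightarrow> (('k \<Rightarrow> complex) \<Rightarrow> complex) \<Rightarrow> bool" where
  "expdeg K N q \<longleftrightarrow> (\<exists>a. \<forall>x. q x = (\<Sum>b\<in>PiE K (\<lambda>_. {..N}). a b * monomial_fun K b x))"

lemma expdeg_cmult: "expdeg K N q \<Longrightarrow> expdeg K N (\<lambda>x. c * q x)"
  unfolding expdeg_def
proof (elim exE)
  fix a assume "\<forall>x. q x = (\<Sum>b\<in>PiE K (\<lambda>_. {..N}). a b * monomial_fun K b x)"
  then show "\<exists>a. \<forall>x. c * q x = (\<Sum>b\<in>PiE K (\<lambda>_. {..N}). a b * monomial_fun K b x)"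
    by (intro exI[of _ "\<lambda>b. c * a b"]) (simp add: sum_distrib_left mult.assoc)
qed

lemma expdeg_add: "expdeg K N p \<Longrightarrow> expdeg K N q \<Longrightarrow> expdeg K N (\<lambda>x. p x + q x)"
  unfolding expdeg_def
proof (elim exE)
  fix a c assume "\<forall>x. p x = (\<Sum>b\<in>PiE K (\<lambda>_. {..N}). a b * monomial_fun K b x)"
    "\<forall>x. q x = (\<Sum>b\<in>PiE K (\<lambda>_. {..N}). c b * monomial_fun K b x)"
  then show "\<exists>a. \<forall>x. p x + q x = (\<Sum>b\<in>PiE K (\<lambda>_. {..N}). a b * monomial_fun K b x)"
    by (intro exI[of _ "\<lambda>b. a b + c b"]) (simp add: sum.distrib distrib_right)
qed

lemma expdeg_zero: "expdeg K N (\<lambda>x. 0)"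
  unfolding expdeg_def by (intro exI[of _ "\<lambda>_. 0"]) simp

lemma expdeg_sum:
  "(\<And>i. i \<in> I \<Longrightarrow> expdeg K N (f i)) \<Longrightarrow> expdeg K N (\<lambda>x. \<Sum>i\<in>I. f i x)"
  by (induction I rule: infinite_finite_induct) (auto intro: expdeg_zero expdeg_add)

lemma expdeg_mono_fun:
  assumes "finite K" "\<And>k. k \<in> K \<Longrightarrow> b k \<le> N"
  shows "expdeg K N (monomial_fun K b)"
proof -
  have b: "restrict b K \<in> PiE K (\<lambda>_. {..N})" using assms by auto
  have "monomial_fun K b x = (\<Sum>c\<in>PiE K (\<lambda>_. {..N}). (if c = restrict b K then 1 else 0) * monomial_fun K c x)" for x
  proof -
    have "(\<Sum>c\<in>PiE K (\<lambda>_. {..N}). (if c = restrict b K then 1 else 0) * monomial_fun K c x) =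
      (\<Sum>c\<in>PiE K (\<lambda>_. {..N}). if c = restrict b K then monomial_fun K c x else 0)"
      by (intro sum.cong) auto
    also have "\<dots> = monomial_fun K b x"
      using assms b by (subst sum.delta) (auto simp: finite_PiE mono_restrict)
    finally show ?thesis by simp
  qed
  then show ?thesis unfolding expdeg_def
    by (intro exI[of _ "\<lambda>c. if c = restrict b K then 1 else 0"] allI)
qed

lemma expdeg_mult:
  assumes "finite K" "expdeg K N p" "expdeg K M q"
  shows "expdeg K (N + M) (\<lambda>x. p x * q x)"
proof -
  obtain a where a: "\<And>x. p x = (\<Sum>b\<in>PiE K (\<lambda>_. {..N}). a b * monomial_fun K b x)"
    using assms(2) unfolding expdeg_def by blast
  obtain c where c: "\<And>x. q x = (\<Sum>b\<in>PiE K (\<lambda>_. {..M}). c b * monomial_fun K b x)"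
    using assms(3) unfolding expdeg_def by blast
  have eq: "p x * q x = (\<Sum>b\<in>PiE K (\<lambda>_. {..N}). \<Sum>b'\<in>PiE K (\<lambda>_. {..M}).
      (a b * c b') * monomial_fun K (\<lambda>k. b k + b' k) x)" for x
    unfolding a c sum_product by (intro sum.cong refl) (simp add: mono_add)
  show ?thesis unfolding eq
    using assms(1) by (intro expdeg_sum expdeg_cmult expdeg_mono_fun)
      (auto intro!: add_mono dest: PiE_mem)
qed

lemma expdeg_const: "finite K \<Longrightarrow> expdeg K N (\<lambda>x. c)"
  using expdeg_cmult[OF expdeg_mono_fun[of K "\<lambda>_. 0" N], of c] by (simp add: monomial_fun_def)

lemma expdeg_le:
  assumes "finite K" "expdeg K N p" "N \<le> M" shows "expdeg K M p"
  using expdeg_mult[OF assms(1,2) expdeg_const[of K "M - N" 1]] assms by simp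

lemma expdeg_power: "finite K \<Longrightarrow> expdeg K N p \<Longrightarrow> expdeg K (n * N) (\<lambda>x. p x ^ n)"
  by (induction n) (auto intro: expdeg_const expdeg_mult)

lemma expdeg_prod:
  assumes "finite K" "\<And>i. i \<in> I \<Longrightarrow> expdeg K N (f i)"
  shows "expdeg K (card I * N) (\<lambda>x. \<Prod>i\<in>I. f i x)"
  using assms(2)
  by (induction I rule: infinite_finite_induct)
    (auto intro!: expdeg_const expdeg_mult[OF assms(1)] assms(1))

lemma polyfun_expdeg:
  assumes "q \<in> polyfun K" "finite K"
  shows "\<exists>N. expdeg K N q"
  using assms
proof (induction rule: polyfun.induct)
  case (const c)
  then show ?case using expdeg_const by blast
next
  case (var k)
  have "monomial_fun K (\<lambda>j. if j = k then 1 else 0) = (\<lambda>x. x k)"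
    using var by (auto simp: monomial_fun_def if_distrib[of "power _"] cong: if_cong)
  moreover have "expdeg K 1 (monomial_fun K (\<lambda>j. if j = k then 1 else 0))"
    using var by (intro expdeg_mono_fun) auto
  ultimately show ?case by auto
next
  case (add p q)
  then obtain N M where "expdeg K N p" "expdeg K M q" by blast
  then have "expdeg K (max N M) p" "expdeg K (max N M) q"
    using expdeg_le add.prems by (metis max.cobounded1, metis max.cobounded2)
  then show ?case using expdeg_add by blast
next
  case (mult p q)
  then show ?case using expdeg_mult by blast
qed

lemma sum_PiE_insert:
  fixes f :: "('k \<Rightarrow> nat) \<Rightarrow> complex"
  assumes "k \<notin> K"
  shows "(\<Sum>b\<in>PiE (insert k K) (\<lambda>_. S). f b) = (\<Sum>j\<in>S. \<Sum>b\<in>PiE K (\<lambda>_. S). f (b(k := j)))"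
proof -
  have "inj_on (\<lambda>(y, g). g(k := y)) (S \<times> PiE K (\<lambda>_. S))"
    using inj_combinator[OF assms, of "\<lambda>_. S"] by simp
  then show ?thesis
    unfolding PiE_insert_eq by (subst sum.reindex) (auto simp: sum.cartesian_product intro!: sum.cong)
qed

text \<open>Polynomials over an infinite field are determined by their values: the variable
  \<open>k\<close> is split off, the induction hypothesis makes one coefficient nonzero, and a
  non-root is chosen for \<open>k\<close>.\<close>

lemma mono_sum_nonzero:
  assumes "finite K" "b0 \<in> PiE K (\<lambda>_. {..N})" "c b0 \<noteq> 0"
  shows "\<exists>x \<in> ambient K. (\<Sum>b\<in>PiE K (\<lambda>_. {..N}). c b * monomial_fun K b x) \<noteq> 0"
  using assms
proof (induction K arbitrary: b0 c)
  case empty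
  then show ?case by (auto simp: monomial_fun_def ambient_def)
next
  case (insert k K)
  define b1 where "b1 = b0(k := undefined)"
  have b1: "b1 \<in> PiE K (\<lambda>_. {..N})" "b1(k := b0 k) = b0" "b0 k \<le> N"
    using insert.prems insert.hyps by (auto simp: b1_def PiE_iff extensional_def)
  then have "c (b1(k := b0 k)) \<noteq> 0" using insert.prems by simp
  from insert.IH[of b1 "\<lambda>b. c (b(k := b0 k))", OF b1(1) this] obtain x where
    x: "x \<in> ambient K" "(\<Sum>b\<in>PiE K (\<lambda>_. {..N}). c (b(k := b0 k)) * monomial_fun K b x) \<noteq> 0" by blast
  define f where "f = (\<Sum>j\<le>N. monom (\<Sum>b\<in>PiE K (\<lambda>_. {..N}). c (b(k := j)) * monomial_fun K b x) j)"
  have "coeff f (b0 k) = (\<Sum>b\<in>PiE K (\<lambda>_. {..N}). c (b(k := b0 k)) * monomial_fun K b x)"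
    using b1(3) by (simp add: f_def coeff_sum)
  then have "f \<noteq> 0" using x by auto
  then have "finite {t. poly f t = 0}" by (rule poly_roots_finite)
  then obtain t where t: "poly f t \<noteq> 0"
    using infinite_UNIV_char_0 by (metis (mono_tags, lifting) UNIV_eq_I mem_Collect_eq)
  have m: "monomial_fun (insert k K) (b(k := j)) (x(k := t)) = t ^ j * monomial_fun K b x" for b j
  proof -
    have "monomial_fun (insert k K) (b(k := j)) (x(k := t)) = t ^ j * (\<Prod>i\<in>K. (x(k := t)) i ^ (b(k := j)) i)"
      using insert.hyps by (simp add: monomial_fun_def)
    also have "(\<Prod>i\<in>K. (x(k := t)) i ^ (b(k := j)) i) = monomial_fun K b x"
      unfolding monomial_fun_def using insert.hyps by (intro prod.cong) auto
    finally show ?thesis .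
  qed
  have "(\<Sum>b\<in>PiE (insert k K) (\<lambda>_. {..N}). c b * monomial_fun (insert k K) b (x(k := t))) = poly f t"
    using insert.hyps
    by (simp add: sum_PiE_insert m f_def poly_sum poly_monom sum_distrib_left sum_distrib_right mult_ac)
  moreover have "x(k := t) \<in> ambient (insert k K)" using x(1) by (auto simp: ambient_def)
  ultimately show ?case using t by metis
qed

text \<open>Algebraic dependence by counting: there are more monomials in the \<open>g i\<close> (homogenised by the
  common denominator \<open>w\<close>) than monomials of the corresponding degree in the \<open>card Y\<close> variables.\<close>
lemma algebraic_dependence:
  assumes fin: "finite Y" "finite L" and card: "card Y < card L"
    and w: "w \<in> polyfun Y" and g: "\<And>i. i \<in> L \<Longrightarrow> g i \<in> polyfun Y"
  shows "\<exists>P \<in> polyfun L. (\<exists>p \<in> ambient L. P p \<noteq> 0) \<and>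
    (\<forall>y p. w y \<noteq> 0 \<longrightarrow> (\<forall>i\<in>L. w y * p i = g i y) \<longrightarrow> P p = 0)"
proof -
  obtain N where N: "expdeg Y N w" "\<And>i. i \<in> L \<Longrightarrow> expdeg Y N (g i)"
  proof -
    have "\<exists>N. expdeg Y N (g i)" if "i \<in> L" for i using polyfun_expdeg[OF g[OF that] fin(1)] .
    then obtain h where h: "\<And>i. i \<in> L \<Longrightarrow> expdeg Y (h i) (g i)" by metis
    obtain n0 where n0: "expdeg Y n0 w" using polyfun_expdeg[OF w fin(1)] by blast
    let ?N = "n0 + (\<Sum>i\<in>L. h i)"
    have "expdeg Y ?N w" using n0 fin expdeg_le by (metis le_add1)
    moreover have "expdeg Y ?N (g i)" if "i \<in> L" for i
    proof -
      have "h i \<le> ?N" using that fin by (simp add: member_le_sum trans_le_add2)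
      then show ?thesis using h[OF that] fin expdeg_le by blast
    qed
    ultimately show ?thesis using that by blast
  qed
  \<comment> \<open>The box for \<open>Y\<close> has at most
    \<open>((t + 1) * (C + 1)) ^ card Y\<close> points. Taking \<open>t = (C + 1) ^ card Y\<close>
    turns this into \<open>(t + 1) ^ card Y * t\<close>, just below the
    \<open>(t + 1) ^ (card Y + 1)\<close> monomials that are available when \<open>L\<close> has one
    more element than \<open>Y\<close>.\<close>
  define C where "C = card L * (N + N)"
  define t where "t = (C + 1) ^ card Y"
  define m where "m = t * C"
  \<comment> \<open>If \<open>w y * p i = g i y\<close>, each factor is
    \<open>w y ^ t * p i ^ a i\<close>; the power of \<open>w\<close> is the same for all
    \<open>a\<close>. A linear relation among the \<open>h a\<close> is therefore one among
    monomials in \<open>p\<close>.\<close>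
  define h where "h a y = (\<Prod>i\<in>L. g i y ^ a i * w y ^ (t - a i))" for a y
  have h: "expdeg Y m (h a)" if a: "a \<in> PiE L (\<lambda>_. {..t})" for a
  proof -
    have "expdeg Y (t * N + t * N) (\<lambda>y. g i y ^ a i * w y ^ (t - a i))" if "i \<in> L" for i
    proof (intro expdeg_mult fin)
      have "a i \<le> t" using a that by (auto dest: PiE_mem)
      then show "expdeg Y (t * N) (\<lambda>y. g i y ^ a i)" "expdeg Y (t * N) (\<lambda>y. w y ^ (t - a i))"
        using expdeg_power[OF fin(1) N(2)[OF that], of "a i"] expdeg_power[OF fin(1) N(1), of "t - a i"]
        by (auto intro: expdeg_le[OF fin(1)] mult_le_mono1)
    qed
    then have "expdeg Y (card L * (t * N + t * N)) (h a)"
      unfolding h_def by (intro expdeg_prod fin)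
    then show ?thesis by (simp add: m_def C_def algebra_simps)
  qed
  then have "\<exists>A. \<forall>y. h a y = (\<Sum>b\<in>PiE Y (\<lambda>_. {..m}). A b * monomial_fun Y b y)"
    if "a \<in> PiE L (\<lambda>_. {..t})" for a using that unfolding expdeg_def by blast
  then obtain A where A: "\<And>a y. a \<in> PiE L (\<lambda>_. {..t}) \<Longrightarrow>
      h a y = (\<Sum>b\<in>PiE Y (\<lambda>_. {..m}). A a b * monomial_fun Y b y)" by metis
  have "card (PiE Y (\<lambda>_. {..m})) = (t * C + 1) ^ card Y"
    using fin by (simp add: card_PiE m_def)
  also have "\<dots> \<le> ((t + 1) * (C + 1)) ^ card Y" by (intro power_mono) auto
  also have "\<dots> = (t + 1) ^ card Y * t" by (simp only: power_mult_distrib flip: t_def)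
  also have "\<dots> < (t + 1) ^ card Y * (t + 1)" by simp
  also have "\<dots> = (t + 1) ^ Suc (card Y)" by simp
  also have "\<dots> \<le> (t + 1) ^ card L" using card by (intro power_increasing) auto
  also have "\<dots> = card (PiE L (\<lambda>_. {..t}))" using fin by (simp add: card_PiE)
  finally have "card (PiE Y (\<lambda>_. {..m})) < card (PiE L (\<lambda>_. {..t}))" .
  from homogeneous_system[OF _ _ this, of "\<lambda>b a. A a b"] fin obtain c where
    c: "\<exists>a\<in>PiE L (\<lambda>_. {..t}). c a \<noteq> 0"
      "\<forall>b\<in>PiE Y (\<lambda>_. {..m}). (\<Sum>a\<in>PiE L (\<lambda>_. {..t}). A a b * c a) = 0"
    by (auto simp: finite_PiE)
  define P where "P p = (\<Sum>a\<in>PiE L (\<lambda>_. {..t}). c a * monomial_fun L a p)" for p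
  have "P p = 0" if "w y \<noteq> 0" and p: "\<forall>i\<in>L. w y * p i = g i y" for y p
  proof -
    have hm: "h a y = w y ^ (t * card L) * monomial_fun L a p" if a: "a \<in> PiE L (\<lambda>_. {..t})" for a
    proof -
      have "h a y = (\<Prod>i\<in>L. w y ^ t * p i ^ a i)"
        unfolding h_def
      proof (intro prod.cong refl)
        fix i assume i: "i \<in> L"
        then have "a i \<le> t" using a by (auto dest: PiE_mem)
        then have wt: "w y ^ t = w y ^ a i * w y ^ (t - a i)" by (simp flip: power_add)
        have "g i y ^ a i = w y ^ a i * p i ^ a i"
          unfolding p[rule_format, OF i, symmetric] by (rule power_mult_distrib)
        then show "g i y ^ a i * w y ^ (t - a i) = w y ^ t * p i ^ a i"
          unfolding wt by (simp only: mult_ac)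
      qed
      then show ?thesis by (simp add: prod.distrib monomial_fun_def power_mult)
    qed
    have "w y ^ (t * card L) * P p = (\<Sum>a\<in>PiE L (\<lambda>_. {..t}). c a * h a y)"
      unfolding P_def sum_distrib_left by (intro sum.cong refl) (simp add: hm)
    also have "\<dots> = (\<Sum>a\<in>PiE L (\<lambda>_. {..t}). \<Sum>b\<in>PiE Y (\<lambda>_. {..m}). c a * (A a b * monomial_fun Y b y))"
      by (intro sum.cong refl) (simp add: A sum_distrib_left)
    also have "\<dots> = (\<Sum>b\<in>PiE Y (\<lambda>_. {..m}). (\<Sum>a\<in>PiE L (\<lambda>_. {..t}). A a b * c a) * monomial_fun Y b y)"
      by (subst sum.swap) (simp add: sum_distrib_left sum_distrib_right mult_ac)
    also have "\<dots> = 0" using c(2) by simp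
    finally show ?thesis using that by simp
  qed
  moreover have "P \<in> polyfun L"
    unfolding P_def by (intro polyfun_intros polyfun_mono_fun)
  moreover have "\<exists>p \<in> ambient L. P p \<noteq> 0"
    unfolding P_def using c(1) by (auto intro: mono_sum_nonzero[OF fin(2)])
  ultimately show ?thesis by (intro bexI[of _ P] conjI) auto
qed

text \<open>Along a strict chain of irreducible sets, functions vanishing on one member but not on the next
  extend an algebraically independent family.\<close>
lemma chain_algebraically_independent:
  assumes "\<forall>i\<le>l. zariski_irreducible K (C i)" "\<forall>i<l. C i \<subset> C (Suc i)"
  shows "\<exists>g. (\<forall>i<l. g i \<in> polyfun K) \<and>
    (\<forall>P\<in>polyfun {..<l}. (\<forall>x\<in>C l. P (\<lambda>i. g i x) = 0) \<longrightarrow> (\<forall>y. P y = 0))"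
  using assms
proof (induction l)
  case 0
  have "zariski_irreducible K (C 0)" using 0 by simp
  then have "C 0 \<noteq> {}" by (simp add: zariski_irreducible_def)
  then obtain x where x: "x \<in> C 0" by (meson ex_in_conv)
  have "P y = 0" if P: "P \<in> polyfun {..<0}" "\<forall>x\<in>C 0. P (\<lambda>i. undefined) = 0"
    for P :: "(nat \<Rightarrow> complex) \<Rightarrow> complex" and y
  proof -
    have "P (\<lambda>i. undefined) = 0" using P(2) x by blast
    moreover have "P y = P (\<lambda>i. undefined)" using P(1) by (rule polyfun_cong) auto
    ultimately show ?thesis by simp
  qed
  then show ?case by (intro exI[of _ "\<lambda>_ _. undefined"] conjI ballI impI allI) (simp, blast)
next
  case (Suc l)
  have "\<forall>i\<le>l. zariski_irreducible K (C i)" "\<forall>i<l. C i \<subset> C (Suc i)"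
    using Suc.prems by auto
  from Suc.IH[OF this] obtain g where g: "\<And>i. i < l \<Longrightarrow> g i \<in> polyfun K"
    "\<And>P y. P \<in> polyfun {..<l} \<Longrightarrow> (\<forall>x\<in>C l. P (\<lambda>i. g i x) = 0) \<Longrightarrow> P y = 0"
    by metis
  have sub: "C l \<subset> C (Suc l)" and irr: "zariski_irreducible K (C l)" "zariski_irreducible K (C (Suc l))"
    using Suc.prems by auto
  have cl: "zariski_closed K (C l)" "zariski_closed K (C (Suc l))"
    using irr by (auto simp: zariski_irreducible_def)
  obtain x1 where x1: "x1 \<in> C (Suc l)" "x1 \<notin> C l" using sub by blast
  then have "x1 \<in> ambient K" using zariski_closedD(1)[OF cl(2)] by blast
  from zariski_closedD(2)[OF cl(1) this x1(2)] obtain f where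
    f: "f \<in> polyfun K" "\<forall>z\<in>C l. f z = 0" "f x1 \<noteq> 0" by blast
  define h where "h = g(l := f)"
  have hK: "h i \<in> polyfun K" if "i < Suc l" for i
    using that g(1) f(1) by (auto simp: h_def less_Suc_eq)
  have "P y = 0" if P: "P \<in> polyfun {..<Suc l}" and van: "\<forall>x\<in>C (Suc l). P (\<lambda>i. h i x) = 0" for P y
  proof -
    obtain F where F: "polyfam ({..<Suc l} - {l}) F" "\<And>x t. P (x(l := t)) = poly (F x) t"
      using polyfun_expand[OF P, of l] by blast
    have ll: "{..<Suc l} - {l} = {..<l}" by auto
    have cF: "(\<lambda>x. coeff (F x) i) \<in> polyfun {..<l}" for i
      using F(1) by (simp add: polyfam_def ll)
    obtain N where N: "\<And>x. degree (F x) \<le> N" using F(1) unfolding polyfam_def by blast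
    have cg: "(\<lambda>x. coeff (F (\<lambda>i. g i x)) j) \<in> polyfun K" for j
      using cF g(1) by (intro polyfun_subst[OF cF]) auto
    have Px: "(\<Sum>i\<le>N. coeff (F (\<lambda>i. g i x)) i * f x ^ i) = 0" if "x \<in> C (Suc l)" for x
    proof -
      have "(\<lambda>i. h i x) = (\<lambda>i. g i x)(l := f x)" by (auto simp: h_def)
      then have "poly (F (\<lambda>i. g i x)) (f x) = 0" using van that F(2) by metis
      moreover have "poly (F (\<lambda>i. g i x)) (f x) = (\<Sum>i\<le>N. coeff (F (\<lambda>i. g i x)) i * f x ^ i)"
        using N by (rule poly_sum_upto)
      ultimately show ?thesis by simp
    qed
    \<comment> \<open>Once the lower coefficients vanish, a factor \<open>f x ^ i\<close> can be
      cancelled on the irreducible set \<open>C (Suc l)\<close>, where \<open>f\<close> is not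
      identically zero. On \<open>C l\<close>, where \<open>f\<close> is zero, only coefficient
      \<open>i\<close> remains, and independence of the first \<open>l\<close> functions makes it
      the zero function.\<close>
    have zero: "\<forall>x. coeff (F x) i = 0" if "i \<le> N" for i
      using that
    proof (induction i rule: less_induct)
      case (less i)
      let ?r = "\<lambda>x. \<Sum>j\<in>{i..N}. coeff (F (\<lambda>i. g i x)) j * f x ^ (j - i)"
      have "f x ^ i * ?r x = 0" if x: "x \<in> C (Suc l)" for x
      proof -
        have "f x ^ i * ?r x = (\<Sum>j\<in>{i..N}. coeff (F (\<lambda>i. g i x)) j * f x ^ j)"
          unfolding sum_distrib_left
          by (intro sum.cong refl) (auto simp: mult_ac simp flip: power_add)
        also have "\<dots> = (\<Sum>j\<le>N. coeff (F (\<lambda>i. g i x)) j * f x ^ j)"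
          using less by (intro sum.mono_neutral_left) auto
        finally show ?thesis using Px[OF x] by simp
      qed
      moreover have "?r \<in> polyfun K" "(\<lambda>x. f x ^ i) \<in> polyfun K"
        using cg f(1) by (auto intro!: polyfun_intros)
      ultimately have "(\<forall>x\<in>C (Suc l). f x ^ i = 0) \<or> (\<forall>x\<in>C (Suc l). ?r x = 0)"
        by (intro zariski_irreducible_prod[OF irr(2)]) auto
      then have "\<forall>x\<in>C (Suc l). ?r x = 0" using f(3) x1(1) by auto
      then have r0: "?r x = 0" if "x \<in> C l" for x using sub that by blast
      have "coeff (F (\<lambda>i. g i x)) i = 0" if x: "x \<in> C l" for x
      proof -
        have "?r x = (\<Sum>j\<in>{i}. coeff (F (\<lambda>i. g i x)) j * f x ^ (j - i))"
          using less.prems f(2) x by (intro sum.mono_neutral_right) auto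
        then show ?thesis using r0[OF x] by simp
      qed
      then show ?case using g(2)[OF cF[of i]] by blast
    qed
    have "P y = poly (F y) (y l)" using F(2)[of y "y l"] by simp
    also have "\<dots> = (\<Sum>i\<le>N. coeff (F y) i * y l ^ i)" using N by (rule poly_sum_upto)
    also have "\<dots> = 0" using zero by simp
    finally show ?thesis .
  qed
  then show ?case using hK by blast
qed

text \<open>Independent functions taken from a chain longer than \<open>card Y\<close> would,
  composed with \<open>\<phi>\<close>, be too many polynomials in \<open>card Y\<close> variables.
  They satisfy a relation (with denominator 1), and density carries it back to
  \<open>C l\<close>.\<close>

lemma chain_length_le:
  assumes chain: "\<forall>i\<le>l. zariski_irreducible K (C i)" "\<forall>i<l. C i \<subset> C (Suc i)" "C l \<subseteq> Z"
    and Y: "finite Y"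
    and \<phi>: "\<And>k. k \<in> K \<Longrightarrow> (\<lambda>y. \<phi> y k) \<in> polyfun Y"
    and dense: "\<And>p z. p \<in> polyfun K \<Longrightarrow> (\<And>y. y \<in> ambient Y \<Longrightarrow> p (\<phi> y) = 0) \<Longrightarrow> z \<in> Z \<Longrightarrow> p z = 0"
  shows "l \<le> card Y"
proof (rule ccontr)
  assume less: "\<not> l \<le> card Y"
  obtain g where g: "\<And>i. i < l \<Longrightarrow> g i \<in> polyfun K"
    "\<And>P y. P \<in> polyfun {..<l} \<Longrightarrow> (\<forall>x\<in>C l. P (\<lambda>i. g i x) = 0) \<Longrightarrow> P y = 0"
    using chain_algebraically_independent[OF chain(1,2)] by metis
  have card: "card Y < card {..<l}" using less by simp
  have g\<phi>: "(\<lambda>y. g i (\<phi> y)) \<in> polyfun Y" if "i \<in> {..<l}" for i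
    by (rule polyfun_subst[OF g(1) \<phi>]) (use that in auto)
  have "\<exists>P \<in> polyfun {..<l}. (\<exists>p \<in> ambient {..<l}. P p \<noteq> 0) \<and>
    (\<forall>y p. (1::complex) \<noteq> 0 \<longrightarrow> (\<forall>i\<in>{..<l}. 1 * p i = g i (\<phi> y)) \<longrightarrow> P p = 0)"
    by (rule algebraic_dependence[OF Y finite_lessThan card polyfun.const g\<phi>])
  then obtain P where P: "P \<in> polyfun {..<l}" "\<exists>p \<in> ambient {..<l}. P p \<noteq> 0"
    and P0: "\<forall>y p. (\<forall>i\<in>{..<l}. p i = g i (\<phi> y)) \<longrightarrow> P p = 0" by auto
  have "P (\<lambda>i. g i x) = 0" if "x \<in> C l" for x
  proof (rule dense[where p = "\<lambda>x. P (\<lambda>i. g i x)"])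
    show "(\<lambda>x. P (\<lambda>i. g i x)) \<in> polyfun K" using P(1) g(1) by (intro polyfun_subst[OF P(1)]) auto
    show "P (\<lambda>i. g i (\<phi> y)) = 0" for y
      by (rule P0[rule_format]) simp
    show "x \<in> Z" using that chain by auto
  qed
  then show False using g(2)[OF P(1)] P(2) by blast
qed

text \<open>Chains with a named top member grow by one set at a time, which suits both the induction
  on coordinate subspaces and the induction on the sizes of strategy supports.\<close>

inductive irr_chain :: "'k set \<Rightarrow> nat \<Rightarrow> ('k \<Rightarrow> complex) set \<Rightarrow> bool" for K where
  irr_chain_0: "zariski_irreducible K Z \<Longrightarrow> irr_chain K 0 Z"
| irr_chain_Suc: "irr_chain K l Z \<Longrightarrow> Z \<subset> Z' \<Longrightarrow> zariski_irreducible K Z' \<Longrightarrow> irr_chain K (Suc l) Z'"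

lemma irr_chain_imp_chain:
  assumes "irr_chain K l Z"
  shows "\<exists>C :: nat \<Rightarrow> ('k \<Rightarrow> complex) set.
     (\<forall>i\<le>l. zariski_irreducible K (C i)) \<and> (\<forall>i<l. C i \<subset> C (Suc i)) \<and> C l = Z"
  using assms
proof (induction rule: irr_chain.induct)
  case (irr_chain_0 Z)
  then show ?case by (intro exI[of _ "\<lambda>_. Z"]) auto
next
  case (irr_chain_Suc l Z Z')
  then obtain C where C: "\<forall>i\<le>l. zariski_irreducible K (C i)" "\<forall>i<l. C i \<subset> C (Suc i)" "C l = Z"
    by blast
  have "zariski_irreducible K ((C(Suc l := Z')) i)" if "i \<le> Suc l" for i
    using that C irr_chain_Suc by (cases "i = Suc l") auto
  moreover have "(C(Suc l := Z')) i \<subset> (C(Suc l := Z')) (Suc i)" if "i < Suc l" for i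
    using that C irr_chain_Suc by (cases "i = l") auto
  ultimately show ?case by (intro exI[of _ "C(Suc l := Z')"]) auto
qed

text \<open>The supremum is attained: the given chain has length \<open>card Y\<close>, and the
  dense polynomial image of \<open>card Y\<close> parameters admits no longer one.\<close>

lemma krull_dim_eq:
  assumes "irr_chain K (card Y) Z" and Y: "finite Y"
    and \<phi>: "\<And>k. k \<in> K \<Longrightarrow> (\<lambda>y. \<phi> y k) \<in> polyfun Y"
    and dense: "\<And>p z. p \<in> polyfun K \<Longrightarrow> (\<And>y. y \<in> ambient Y \<Longrightarrow> p (\<phi> y) = 0) \<Longrightarrow> z \<in> Z \<Longrightarrow> p z = 0"
  shows "krull_dim K Z = card Y"
  unfolding krull_dim_def
proof (rule cSup_eq_maximum)
  show "card Y \<in> {l. \<exists>C :: nat \<Rightarrow> ('a \<Rightarrow> complex) set.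
       (\<forall>i\<le>l. zariski_irreducible K (C i)) \<and> (\<forall>i<l. C i \<subset> C (Suc i)) \<and> C l \<subseteq> Z}"
    using irr_chain_imp_chain[OF assms(1)] by blast
  fix l assume "l \<in> {l. \<exists>C :: nat \<Rightarrow> ('a \<Rightarrow> complex) set.
       (\<forall>i\<le>l. zariski_irreducible K (C i)) \<and> (\<forall>i<l. C i \<subset> C (Suc i)) \<and> C l \<subseteq> Z}"
  then obtain C where "\<forall>i\<le>l. zariski_irreducible K (C i)" "\<forall>i<l. C i \<subset> C (Suc i)" "C l \<subseteq> Z"
    by blast
  then show "l \<le> card Y" by (rule chain_length_le[OF _ _ _ Y, where \<phi> = \<phi>]) (use \<phi> dense in auto)
qed

section \<open>Elimination theory\<close>

text \<open>The formal degrees are \<open>D\<close> for \<open>g\<close>, which has to be exact where it matters, and \<open>N\<close> for \<open>f\<close>,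
  which is only an upper bound.\<close>
definition sylvester_det :: "nat \<Rightarrow> nat \<Rightarrow> complex poly \<Rightarrow> complex poly \<Rightarrow> complex" where
  "sylvester_det D N g f = Determinant.det (mat (N + D) (N + D)
     (\<lambda>(i, j). coeff (if i < N then monom 1 i * g else monom 1 (i - N) * f) j))"

lemma polyfun_sylvester_det:
  assumes "polyfam L G" "polyfam L F"
  shows "(\<lambda>x. sylvester_det D N (G x) (F x)) \<in> polyfun L"
proof -
  have "(\<lambda>x. coeff (monom 1 i * G x) j) \<in> polyfun L" "(\<lambda>x. coeff (monom 1 i * F x) j) \<in> polyfun L" for i j
    using assms unfolding coeff_monom_mult polyfam_def by (auto intro!: polyfun_intros)
  then have c: "(\<lambda>x. coeff (if i < N then monom 1 i * G x else monom 1 (i - N) * F x) j) \<in> polyfun L" for i j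
    by (cases "i < N") auto
  have "sylvester_det D N (G x) (F x) = (\<Sum>p | p permutes {0..<N + D}. signof p *
      (\<Prod>i = 0..<N + D. coeff (if i < N then monom 1 i * G x else monom 1 (i - N) * F x) (p i)))" for x
    unfolding sylvester_det_def
    by (subst Determinant.det_def) (auto intro!: sum.cong prod.cong arg_cong[of _ _ "(*) _"] dest: permutes_in_image)
  then show ?thesis using c by (simp add: polyfun_intros)
qed

text \<open>The vector of powers of a common root lies in the kernel, since row \<open>i\<close>
  evaluates a multiple of \<open>g\<close> or \<open>f\<close> at \<open>w\<close>. With
  \<open>D > 0\<close> the matrix is nonempty and this vector is nonzero.\<close>

lemma sylvester_det_zero:
  assumes "D > 0" "degree g \<le> D" "degree f \<le> N" "poly g w = 0" "poly f w = 0"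
  shows "sylvester_det D N g f = 0"
proof -
  define n where "n = N + D"
  define S where "S = mat n n (\<lambda>(i, j). coeff (if i < N then monom 1 i * g else monom 1 (i - N) * f) j)"
  have S: "S \<in> carrier_mat n n" by (simp add: S_def)
  define v where "v = vec n (\<lambda>j. w ^ j)"
  have v: "v \<in> carrier_vec n" by (simp add: v_def)
  have n: "n > 0" using assms by (simp add: n_def)
  have "v $ 0 \<noteq> 0\<^sub>v n $ 0" using n by (simp add: v_def)
  then have "v \<noteq> 0\<^sub>v n" by metis
  moreover have "S *\<^sub>v v = 0\<^sub>v n"
  proof (rule eq_vecI)
    fix i assume i: "i < dim_vec (0\<^sub>v n)"
    define h where "h = (if i < N then monom 1 i * g else monom 1 (i - N) * f)"
    have "degree h \<le> n - 1"
    proof (cases "i < N")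
      case True
      have "degree h \<le> i + degree g" using True degree_mult_le[of "monom 1 i" g] by (simp add: h_def degree_monom_eq)
      then show ?thesis using True assms by (simp add: n_def)
    next
      case False
      have "degree h \<le> (i - N) + degree f" using False degree_mult_le[of "monom 1 (i - N)" f] by (simp add: h_def degree_monom_eq)
      then show ?thesis using False assms i by (simp add: n_def)
    qed
    have "(S *\<^sub>v v) $ i = (\<Sum>j<n. coeff h j * w ^ j)"
      using i by (simp add: S_def v_def scalar_prod_def h_def atLeast0LessThan)
    also have "{..<n} = {..n - 1}" using n by auto
    also have "(\<Sum>j\<le>n - 1. coeff h j * w ^ j) = poly h w"
      using \<open>degree h \<le> n - 1\<close> by (simp add: poly_sum_upto)
    also have "poly h w = 0" using assms by (simp add: h_def)
    finally show "(S *\<^sub>v v) $ i = 0\<^sub>v n $ i" using i by simp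
  qed (simp add: S_def)
  ultimately have "Determinant.det S = 0"
    using det_0_iff_vec_prod_zero_field[OF S] v by blast
  then show ?thesis by (simp add: sylvester_det_def S_def n_def)
qed

text \<open>A vector in the kernel of the transpose is a relation \<open>A * g + B * f = 0\<close>
  with \<open>B\<close> of degree below \<open>D\<close>. Without common root \<open>g\<close> is
  coprime to \<open>f\<close>, so it divides \<open>B\<close>, and its exact degree \<open>D\<close>
  forces \<open>B = 0\<close>.\<close>

lemma sylvester_det_nonzero:
  assumes "degree g = D" "D > 0" "degree f \<le> N" "\<And>w. poly g w = 0 \<Longrightarrow> poly f w \<noteq> 0"
  shows "sylvester_det D N g f \<noteq> 0"
proof
  define n where "n = N + D"
  define S where "S = mat n n (\<lambda>(i, j). coeff (if i < N then monom 1 i * g else monom 1 (i - N) * f) j)"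
  have S: "S \<in> carrier_mat n n" by (simp add: S_def)
  assume "sylvester_det D N g f = 0"
  then have "Determinant.det S = 0" by (simp add: sylvester_det_def S_def n_def)
  then have "Determinant.det (transpose_mat S) = 0" using Determinant.det_transpose[OF S] by simp
  then obtain v where v: "v \<in> carrier_vec n" "v \<noteq> 0\<^sub>v n" "transpose_mat S *\<^sub>v v = 0\<^sub>v n"
    using det_0_iff_vec_prod_zero_field[of "transpose_mat S" n] S by auto
  define A where "A = (\<Sum>i<N. monom (v $ i) i)"
  define B where "B = (\<Sum>i<D. monom (v $ (N + i)) i)"
  have cA: "coeff A i = (if i < N then v $ i else 0)" for i
    by (auto simp: A_def coeff_sum)
  have cB: "coeff B i = (if i < D then v $ (N + i) else 0)" for i
    by (auto simp: B_def coeff_sum)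
  have "coeff (A * g + B * f) j = 0" for j
  proof (cases "j < n")
    case True
    have "0 = (transpose_mat S *\<^sub>v v) $ j" using v True by simp
    also have "\<dots> = (\<Sum>i<n. coeff (if i < N then monom 1 i * g else monom 1 (i - N) * f) j * v $ i)"
      using True v(1) by (simp add: S_def scalar_prod_def atLeast0LessThan)
    also have "{..<n} = {..<N} \<union> {N..<N + D}" by (auto simp: n_def)
    also have "(\<Sum>i\<in>{..<N} \<union> {N..<N + D}. coeff (if i < N then monom 1 i * g else monom 1 (i - N) * f) j * v $ i)
       = (\<Sum>i<N. coeff (monom 1 i * g) j * v $ i) + (\<Sum>i=N..<N+D. coeff (monom 1 (i - N) * f) j * v $ i)"
      by (subst sum.union_disjoint) auto
    also have "(\<Sum>i=N..<N+D. coeff (monom 1 (i - N) * f) j * v $ i) = (\<Sum>i<D. coeff (monom 1 i * f) j * v $ (N + i))"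
      by (rule sum.reindex_bij_witness[of _ "\<lambda>i. N + i" "\<lambda>i. i - N"]) auto
    also have "(\<Sum>i<D. coeff (monom 1 i * f) j * v $ (N + i)) = coeff (B * f) j"
      by (auto simp: B_def sum_distrib_right coeff_sum coeff_monom_mult intro!: sum.cong)
    also have "(\<Sum>i<N. coeff (monom 1 i * g) j * v $ i) = coeff (A * g) j"
      by (auto simp: A_def sum_distrib_right coeff_sum coeff_monom_mult intro!: sum.cong)
    finally show ?thesis by simp
  next
    case False
    have "coeff (A * g) j = 0"
      unfolding coeff_mult
    proof (intro sum.neutral ballI)
      fix i assume "i \<in> {..j}"
      then show "coeff A i * coeff g (j - i) = 0"
        using False assms by (cases "i < N") (auto simp: cA n_def intro!: coeff_eq_0)
    qed
    moreover have "coeff (B * f) j = 0"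
      unfolding coeff_mult
    proof (intro sum.neutral ballI)
      fix i assume "i \<in> {..j}"
      then show "coeff B i * coeff f (j - i) = 0"
        using False assms by (cases "i < D") (auto simp: cB n_def intro!: coeff_eq_0)
    qed
    ultimately show ?thesis by simp
  qed
  then have eq: "A * g + B * f = 0" by (intro poly_eqI) simp
  have g0: "g \<noteq> 0" using assms by auto
  have cop: "coprime g f"
  proof (rule coprimeI)
    fix c assume c: "c dvd g" "c dvd f"
    show "is_unit c"
    proof (rule ccontr)
      assume nu: "\<not> is_unit c"
      have "c \<noteq> 0" using c g0 by auto
      then have "degree c \<noteq> 0" using nu by (simp add: is_unit_iff_degree)
      then have "\<not> constant (poly c)" by (simp add: constant_degree)
      then obtain w where "poly c w = 0" using fundamental_theorem_of_algebra by blast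
      then have "poly g w = 0" "poly f w = 0" using c by (auto elim!: dvdE)
      then show False using assms(4) by blast
    qed
  qed
  have "B * f = g * (- A)" using eq by (simp add: add_eq_0_iff mult.commute)
  then have "g dvd B * f" by (rule dvdI)
  then have "g dvd B" by (rule iffD1[OF coprime_dvd_mult_left_iff[OF cop]])
  have B0: "B = 0"
  proof (rule ccontr)
    assume "B \<noteq> 0"
    then have "D \<le> degree B" using \<open>g dvd B\<close> assms(1) dvd_imp_degree_le by blast
    then have "coeff B (degree B) = 0" by (simp add: cB)
    then show False using \<open>B \<noteq> 0\<close> by simp
  qed
  then have A0: "A = 0" using eq g0 by simp
  have "v = 0\<^sub>v n"
  proof (rule eq_vecI)
    fix i assume "i < dim_vec (0\<^sub>v n)"
    then have i: "i < n" by simp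
    show "v $ i = 0\<^sub>v n $ i"
    proof (cases "i < N")
      case True then show ?thesis using cA[of i] A0 i by simp
    next
      case False
      then have "i - N < D" "N + (i - N) = i" using i by (auto simp: n_def)
      then show ?thesis using cB[of "i - N"] B0 i by simp
    qed
  qed (use v in simp)
  then show False using v by simp
qed

text \<open>An equation that works for \<open>S\<close> and one that works for \<open>s\<close> are
  combined as \<open>g + t * f\<close>; at each point at most one value of \<open>t\<close> is
  bad.\<close>

lemma zariski_closed_common_nonvanishing:
  assumes "finite S" "\<And>s. s \<in> S \<Longrightarrow> \<exists>f \<in> polyfun L. (\<forall>z\<in>Z. f z = 0) \<and> f s \<noteq> 0"
  shows "\<exists>f \<in> polyfun L. (\<forall>z\<in>Z. f z = 0) \<and> (\<forall>s\<in>S. f s \<noteq> 0)"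
  using assms
proof (induction S)
  case empty
  show ?case by (intro bexI[of _ "\<lambda>_. 0"]) (auto intro: polyfun.const)
next
  case (insert s S)
  then obtain f where f: "f \<in> polyfun L" "\<forall>z\<in>Z. f z = 0" "\<forall>s\<in>S. f s \<noteq> 0" by auto
  obtain g where g: "g \<in> polyfun L" "\<forall>z\<in>Z. g z = 0" "g s \<noteq> 0" using insert.prems by blast
  have "finite ((\<lambda>u. - g u / f u) ` insert s S)" using insert by simp
  then obtain t where t: "t \<notin> (\<lambda>u. - g u / f u) ` insert s S"
    using ex_new_if_finite[OF infinite_UNIV_char_0] by metis
  have nz: "g u + t * f u \<noteq> 0" if "u \<in> insert s S" for u
  proof
    assume *: "g u + t * f u = 0"
    show False
    proof (cases "f u = 0")
      case True
      then show False using * that f g by auto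
    next
      case False
      then have "t = - g u / f u" using * by (simp add: field_simps eq_neg_iff_add_eq_0 add.commute)
      then show False using t that by blast
    qed
  qed
  show ?case
    using f g nz by (intro bexI[of _ "\<lambda>x. g x + t * f x"]) (auto intro!: polyfun_intros)
qed

section \<open>Closed images under projection from projective spaces\<close>

lemma scale_ambient: "x \<in> ambient L \<Longrightarrow> scale J l x \<in> ambient L"
  by (auto simp: scale_def ambient_def)

text \<open>Points whose \<open>J\<close>-part vanishes are left out because they represent no point
  of the projective space with coordinates \<open>J\<close>. The image is stored with zeros in the
  positions \<open>J\<close>.\<close>

definition project :: "'k set \<Rightarrow> 'k set \<Rightarrow> ('k \<Rightarrow> complex) set \<Rightarrow> ('k \<Rightarrow> complex) set" where
  "project L J Z = {x \<in> ambient (L - J). \<exists>z\<in>Z. (\<forall>k. k \<notin> J \<longrightarrow> z k = x k) \<and> (\<exists>k\<in>J. z k \<noteq> 0)}"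

text \<open>A conical closed set misses the axis of \<open>k\<close> over \<open>x0\<close> only if some equation of it is, over a
  neighbourhood of \<open>x0\<close>, monic in the variable \<open>k\<close>.\<close>
lemma monic_equation:
  assumes Z: "zariski_closed L Z" and con: "\<And>z l. z \<in> Z \<Longrightarrow> l \<noteq> 0 \<Longrightarrow> scale (insert k J) l z \<in> Z"
    and k: "k \<in> L" "k \<notin> J" and x0: "x0 \<in> ambient (L - insert k J)" "x0(k := 1) \<notin> Z"
  shows "\<exists>a G D. a \<in> polyfun (L - insert k J) \<and> a x0 \<noteq> 0 \<and> polyfam (L - {k}) G \<and>
    (\<forall>x. degree (G x) \<le> D \<and> coeff (G x) D = a x) \<and>
    (\<forall>x. (\<forall>j\<in>J. x j = 0) \<longrightarrow> G x = monom (a x) D) \<and>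
    (\<forall>z\<in>Z. poly (G z) (z k) = 0)"
proof -
  have "x0(k := 1) \<in> ambient L" using x0 k by (auto simp: ambient_def)
  then obtain f where f: "f \<in> polyfun L" "\<forall>z\<in>Z. f z = 0" "f (x0(k := 1)) \<noteq> 0"
    using zariski_closedD(2)[OF Z _ x0(2)] by blast
  obtain F where F: "polyfam (L - {k}) F" "\<And>x t. f (x(k := t)) = poly (F x) t"
    using polyfun_expand[OF f(1)] by blast
  \<comment> \<open>Coefficient \<open>j\<close> of \<open>H i x\<close> is the part of degree
    \<open>j\<close> in the variables \<open>J\<close> of the coefficient of the \<open>i\<close>-th
    power of the variable \<open>k\<close>.\<close>
  then have "\<exists>H. polyfam (L - {k}) H \<and> (\<forall>x t. coeff (F (scale J t x)) i = poly (H x) t)" for i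
    using polyfun_scale_expand[of "\<lambda>x. coeff (F x) i"] unfolding polyfam_def by blast
  then obtain H where H: "\<And>i. polyfam (L - {k}) (H i)"
    "\<And>i x t. coeff (F (scale J t x)) i = poly (H i x) t" by metis
  obtain N where N: "\<And>x. degree (F x) \<le> N" using F(1) unfolding polyfam_def by blast
  have "\<exists>M. \<forall>x. degree (H i x) \<le> M" for i using H(1) unfolding polyfam_def by blast
  then obtain M where M: "\<And>i x. degree (H i x) \<le> M i" by metis
  have cH: "(\<lambda>x. coeff (H i x) j) \<in> polyfun (L - {k})" for i j
    using H(1) unfolding polyfam_def by blast
  define G where "G D x = (\<Sum>i\<le>D. monom (coeff (H i x) (D - i)) i)" for D x
  have cG: "coeff (G D x) i = (if i \<le> D then coeff (H i x) (D - i) else 0)" for D x i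
    by (simp add: G_def coeff_sum)
  have G: "polyfam (L - {k}) (G D)" for D
    unfolding polyfam_def
  proof (intro conjI allI exI)
    show "(\<lambda>x. coeff (G D x) i) \<in> polyfun (L - {k})" for i
      using cH by (simp add: cG polyfun_intros)
    show "degree (G D x) \<le> D" for x by (rule degree_le) (simp add: cG)
  qed
  define E where "E = N + (\<Sum>i\<le>N. M i)"
  have H0: "H i x = 0" if "i > N" for i x
  proof -
    have "poly (H i x) t = 0" for t using H(2)[symmetric, of i x t] that N[of "scale J t x"]
      by (simp add: coeff_eq_0)
    then show ?thesis using poly_all_0_iff_0 by blast
  qed
  text \<open>\<open>poly (G D x) (x k)\<close> is the component of \<open>f\<close> of degree \<open>D\<close> in the variables \<open>insert k J\<close>.\<close>
  have decomp: "f (scale (insert k J) t x) = (\<Sum>D\<le>E. poly (G D x) (x k) * t ^ D)" for t x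
  proof -
    have MN: "M i + i \<le> E" if "i \<le> N" for i
    proof -
      have "M i \<le> (\<Sum>i\<le>N. M i)" using that by (intro member_le_sum) auto
      then show ?thesis using that by (simp add: E_def)
    qed
    have "scale (insert k J) t x = (scale J t x)(k := t * x k)"
      using k by (auto simp: scale_def)
    then have "f (scale (insert k J) t x) = poly (F (scale J t x)) (t * x k)" using F(2) by metis
    also have "\<dots> = (\<Sum>i\<le>N. poly (H i x) t * (t * x k) ^ i)"
      unfolding poly_sum_upto[OF N] H(2) ..
    also have "\<dots> = (\<Sum>i\<le>E. poly (H i x) t * (t * x k) ^ i)"
      by (intro sum.mono_neutral_left) (auto simp: H0 E_def)
    also have "\<dots> = (\<Sum>i\<le>E. \<Sum>D\<in>{i..E}. coeff (H i x) (D - i) * x k ^ i * t ^ D)"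
    proof (intro sum.cong refl)
      fix i assume i: "i \<in> {..E}"
      have "poly (H i x) t = (\<Sum>j\<le>E - i. coeff (H i x) j * t ^ j)"
      proof (rule poly_sum_upto, cases "i \<le> N")
        case True
        then show "degree (H i x) \<le> E - i" using M[of i x] MN[of i] by simp
      qed (simp add: H0)
      also have "\<dots> = (\<Sum>D\<in>{i..E}. coeff (H i x) (D - i) * t ^ (D - i))"
        using i by (intro sum.reindex_bij_witness[of _ "\<lambda>D. D - i" "\<lambda>j. j + i"]) auto
      finally have Hit: "poly (H i x) t = (\<Sum>D\<in>{i..E}. coeff (H i x) (D - i) * t ^ (D - i))" .
      show "poly (H i x) t * (t * x k) ^ i = (\<Sum>D\<in>{i..E}. coeff (H i x) (D - i) * x k ^ i * t ^ D)"
        unfolding Hit sum_distrib_right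
      proof (intro sum.cong refl)
        fix D assume "D \<in> {i..E}"
        then have "t ^ D = t ^ (D - i) * t ^ i" by (simp flip: power_add)
        then show "coeff (H i x) (D - i) * t ^ (D - i) * (t * x k) ^ i = coeff (H i x) (D - i) * x k ^ i * t ^ D"
          by (simp only: power_mult_distrib mult_ac)
      qed
    qed
    also have "\<dots> = (\<Sum>D\<le>E. \<Sum>i\<le>D. coeff (H i x) (D - i) * x k ^ i * t ^ D)"
      by (simp add: sum.Sigma) (intro sum.reindex_bij_witness[of _ "\<lambda>(a, b). (b, a)" "\<lambda>(a, b). (b, a)"], auto)
    also have "\<dots> = (\<Sum>D\<le>E. poly (G D x) (x k) * t ^ D)"
      by (simp add: G_def poly_sum poly_monom sum_distrib_right)
    finally show ?thesis .
  qed
  \<comment> \<open>The orbit of \<open>z\<close> under nonzero scalars stays in \<open>Z\<close>,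
    so \<open>f\<close> along it is a polynomial in \<open>t\<close> with infinitely many roots, and
    every homogeneous component vanishes at \<open>z\<close>.\<close>
  have van: "poly (G D z) (z k) = 0" if "z \<in> Z" "D \<le> E" for z D
  proof -
    define p where "p = (\<Sum>D\<le>E. monom (poly (G D z) (z k)) D)"
    have "poly p t = 0" if "t \<noteq> 0" for t
      using decomp[of t z] con[OF \<open>z \<in> Z\<close> that] f(2) by (simp add: p_def poly_sum poly_monom)
    then have "UNIV - {0} \<subseteq> {t. poly p t = 0}" by auto
    then have "infinite {t. poly p t = 0}"
      using infinite_UNIV_char_0 by (metis finite_Diff2 finite.emptyI finite.insertI finite_subset)
    then have "p = 0" using poly_roots_finite by blast
    then have "coeff p D = 0" by simp
    then show ?thesis using that by (simp add: p_def coeff_sum)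
  qed
  have "scale (insert k J) 1 (x0(k := 1)) = x0(k := 1)" by (auto simp: scale_def)
  then have "(\<Sum>D\<le>E. poly (G D (x0(k := 1))) 1) \<noteq> 0"
    using decomp[of 1 "x0(k := 1)"] f(3) by simp
  then obtain D where D: "D \<le> E" "poly (G D (x0(k := 1))) 1 \<noteq> 0"
    by (meson sum.neutral atMost_iff)
  define a where "a x = coeff (G D x) D" for x
  \<comment> \<open>In a component of degree \<open>D\<close>, the coefficient of the
    \<open>D\<close>-th power of the variable \<open>k\<close> has degree 0 in \<open>J\<close>. It
    may thus be read off after setting \<open>J\<close> to zero, which shows that it does not
    involve \<open>J\<close>.\<close>
  have aH: "a x = coeff (F (scale J 0 x)) D" for x
    using H(2)[of 0 x D] by (simp add: a_def cG poly_0_coeff_0)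
  have aL: "a \<in> polyfun (L - insert k J)"
    unfolding aH
  proof (rule polyfun_subst[where q = "\<lambda>x. coeff (F x) D" and \<phi> = "scale J 0"])
    show "(\<lambda>x. coeff (F x) D) \<in> polyfun (L - {k})" using F(1) unfolding polyfam_def by blast
    fix j assume "j \<in> L - {k}"
    then show "(\<lambda>x. scale J 0 x j) \<in> polyfun (L - insert k J)"
      by (cases "j \<in> J") (auto simp: scale_def intro: polyfun.intros)
  qed
  have Gmon: "G D x = monom (a x) D" if x: "\<forall>j\<in>J. x j = 0" for x
  proof (rule poly_eqI)
    fix i
    have "scale J t x = x" for t using x by (auto simp: scale_def)
    then have "poly (H i x) t = poly [:coeff (F x) i:] t" for t using H(2)[of t x i] by simp
    then have Hi: "H i x = [:coeff (F x) i:]" by (simp add: poly_eq_poly_eq_iff[symmetric] fun_eq_iff)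
    show "coeff (G D x) i = coeff (monom (a x) D) i"
    proof (cases "i < D")
      case True
      then obtain e where "D - i = Suc e" by (metis Suc_diff_Suc)
      then show ?thesis using True by (simp add: cG Hi)
    next
      case False
      then show ?thesis by (auto simp: cG a_def)
    qed
  qed
  have "G D (x0(k := 1)) = monom (a (x0(k := 1))) D"
    using x0(1) k by (intro Gmon) (auto simp: ambient_def)
  moreover have "a (x0(k := 1)) = a x0" by (rule polyfun_cong[OF aL]) auto
  ultimately have "a x0 \<noteq> 0" using D(2) by (simp add: poly_monom)
  moreover have "degree (G D x) \<le> D" for x by (rule degree_le) (simp add: cG)
  ultimately show ?thesis
    using aL G[of D] Gmon van[OF _ D(1)]
    by (intro exI[of _ a] exI[of _ "G D"] exI[of _ D]) (auto simp: a_def)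
qed

text \<open>The main theorem of elimination theory for one projective space, by induction on the number of
  variables: a variable \<open>k\<close> is eliminated by resultants with an equation that is monic in \<open>k\<close> near \<open>x0\<close>.\<close>
theorem zariski_closed_project:
  assumes "finite J" "J \<subseteq> L" "zariski_closed L Z"
    and "\<And>z l. z \<in> Z \<Longrightarrow> l \<noteq> 0 \<Longrightarrow> scale J l z \<in> Z"
  shows "zariski_closed (L - J) (project L J Z)"
  using assms
proof (induction J arbitrary: L Z)
  case empty
  have "project L {} Z = {x \<in> ambient L. \<forall>p\<in>{\<lambda>_. 1::complex}. p x = 0}" by (auto simp: project_def)
  then show ?case using zariski_closed_zeros[of "{\<lambda>_. 1}" L] by (simp add: polyfun.const)
next
  case (insert k J)
  have kL: "k \<in> L" and kJ: "k \<notin> J" and JL: "J \<subseteq> L - {k}" using insert by auto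
  have ZL: "Z \<subseteq> ambient L" using zariski_closedD(1)[OF insert.prems(2)] .
  have LkJ: "L - {k} - J = L - insert k J" by auto
  show ?case
  proof (rule zariski_closedI)
    fix x0 assume x0: "x0 \<in> ambient (L - insert k J)" "x0 \<notin> project L (insert k J) Z"
    have "x0(k := 1) \<notin> Z"
    proof
      assume "x0(k := 1) \<in> Z"
      then have "x0 \<in> project L (insert k J) Z"
        unfolding project_def using x0(1) by (auto intro!: bexI[of _ "x0(k := 1)"])
      then show False using x0 by blast
    qed
    from monic_equation[OF insert.prems(2,3) kL kJ x0(1) this] obtain a G D where
      a: "a \<in> polyfun (L - insert k J)" "a x0 \<noteq> 0" and G: "polyfam (L - {k}) G"
      "\<And>x. degree (G x) \<le> D" "\<And>x. coeff (G x) D = a x"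
      "\<And>x. \<forall>j\<in>J. x j = 0 \<Longrightarrow> G x = monom (a x) D" "\<And>z. z \<in> Z \<Longrightarrow> poly (G z) (z k) = 0"
      by blast
    have Gupd: "G (y(k := w)) = G y" for y w
      by (rule poly_eqI, rule polyfun_cong[where K = "L - {k}"]) (use G(1) in \<open>auto simp: polyfam_def\<close>)
    have aJ: "a y = a x" if "\<forall>j\<in>L - insert k J. y j = x j" for x y
      by (rule polyfun_cong[OF a(1)]) (use that in auto)
    have ak: "a \<in> polyfun (L - {k})" using a(1) by (rule polyfun_mono) auto
    \<comment> \<open>Where \<open>a\<close> vanishes, \<open>G\<close> loses its degree and values
      of the variable \<open>k\<close> may run off to infinity. Adding this locus keeps the
      projection closed, and the factor \<open>a\<close> in the equations accounts for it.\<close>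
    define Z' where "Z' = {y \<in> ambient (L - {k}). a y = 0 \<or> (\<exists>w. y(k := w) \<in> Z)}"
    have "zariski_closed (L - {k}) Z'"
    proof (rule zariski_closedI)
      fix y0 assume y0: "y0 \<in> ambient (L - {k})" "y0 \<notin> Z'"
      then have ay0: "a y0 \<noteq> 0" and nw: "\<And>w. y0(k := w) \<notin> Z" by (auto simp: Z'_def)
      have dG: "degree (G y0) = D" using G(2,3) ay0 le_degree[of "G y0" D] by (simp add: le_antisym)
      then have G0: "G y0 \<noteq> 0" using G(3)[of y0] ay0 by auto
      \<comment> \<open>The monic equation leaves finitely many candidates over \<open>y0\<close>.
        One equation \<open>f\<close> of \<open>Z\<close> avoids them all, so the resultant of
        \<open>G\<close> and \<open>F\<close> is nonzero at \<open>y0\<close>.\<close>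
      define R where "R = (\<lambda>w. y0(k := w)) ` {w. poly (G y0) w = 0}"
      have "finite R" using poly_roots_finite[OF G0] by (simp add: R_def)
      moreover have "\<exists>f \<in> polyfun L. (\<forall>z\<in>Z. f z = 0) \<and> f r \<noteq> 0" if "r \<in> R" for r
      proof (rule zariski_closedD(2)[OF insert.prems(2)])
        show "r \<in> ambient L" "r \<notin> Z" using that y0 kL nw by (auto simp: R_def ambient_def)
      qed
      ultimately have "\<exists>f \<in> polyfun L. (\<forall>z\<in>Z. f z = 0) \<and> (\<forall>s\<in>R. f s \<noteq> 0)"
        by (rule zariski_closed_common_nonvanishing)
      then obtain f where f: "f \<in> polyfun L" "\<forall>z\<in>Z. f z = 0" "\<forall>r\<in>R. f r \<noteq> 0" by blast
      obtain F where F: "polyfam (L - {k}) F" "\<And>x t. f (x(k := t)) = poly (F x) t"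
        using polyfun_expand[OF f(1)] by blast
      obtain N where N: "\<And>x. degree (F x) \<le> N" using F(1) unfolding polyfam_def by blast
      show "\<exists>h\<in>polyfun (L - {k}). (\<forall>z\<in>Z'. h z = 0) \<and> h y0 \<noteq> 0"
      proof (cases "D = 0")
        case True
        \<comment> \<open>In degree 0 the monic equation of \<open>Z\<close> is \<open>a = 0\<close>
          itself, which already separates \<open>y0\<close>.\<close>
        have "a y = 0" if y: "y \<in> Z'" for y
        proof (cases "a y = 0")
          case False
          then obtain w where "y(k := w) \<in> Z" using y by (auto simp: Z'_def)
          then have "poly (G y) w = 0" using G(5)[of "y(k := w)"] by (simp add: Gupd)
          moreover have "G y = [:a y:]" using True G(2,3)[of y] by (metis degree_eq_zeroE coeff_pCons_0 le_zero_eq)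
          ultimately show ?thesis by simp
        qed
        then show ?thesis using ak ay0 by blast
      next
        case False
        let ?h = "\<lambda>y. a y * sylvester_det D N (G y) (F y)"
        have "?h \<in> polyfun (L - {k})" using ak F(1) G(1) by (intro polyfun_intros polyfun_sylvester_det)
        moreover have "?h y = 0" if y: "y \<in> Z'" for y
        proof (cases "a y = 0")
          case False
          then obtain w where w: "y(k := w) \<in> Z" using y by (auto simp: Z'_def)
          then have "poly (G y) w = 0" using G(5)[of "y(k := w)"] by (simp add: Gupd)
          moreover have "poly (F y) w = 0" using w f(2) F(2) by metis
          ultimately show ?thesis using \<open>D \<noteq> 0\<close> G(2) N by (simp add: sylvester_det_zero)
        qed simp
        moreover have "sylvester_det D N (G y0) (F y0) \<noteq> 0"
        proof (rule sylvester_det_nonzero)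
          fix w assume "poly (G y0) w = 0"
          then have "f (y0(k := w)) \<noteq> 0" using f(3) by (auto simp: R_def)
          then show "poly (F y0) w \<noteq> 0" using F(2) by simp
        qed (use dG False N in auto)
        ultimately show ?thesis using ay0 by (intro bexI[of _ ?h]) auto
      qed
    qed (auto simp: Z'_def)
    note Z'_closed = this
    have Z'_scale: "scale J l z \<in> Z'" if z: "z \<in> Z'" "l \<noteq> 0" for z l
    proof -
      have "a (scale J l z) = a z" by (rule aJ) (auto simp: scale_def)
      moreover have "\<exists>w. (scale J l z)(k := w) \<in> Z" if w: "z(k := w) \<in> Z" for w
      proof -
        have "scale (insert k J) l (z(k := w)) = (scale J l z)(k := l * w)"
          using kJ by (auto simp: scale_def)
        then show ?thesis using insert.prems(3)[OF w z(2)] by metis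
      qed
      ultimately show ?thesis using z by (auto simp: Z'_def scale_ambient)
    qed
    have "zariski_closed (L - {k} - J) (project (L - {k}) J Z')"
      by (rule insert.IH[OF JL Z'_closed Z'_scale])
    then have "zariski_closed (L - insert k J) (project (L - {k}) J Z')" by (simp only: LkJ)
    moreover have "x0 \<notin> project (L - {k}) J Z'"
    proof
      assume "x0 \<in> project (L - {k}) J Z'"
      then obtain z where z: "z \<in> Z'" "\<forall>j. j \<notin> J \<longrightarrow> z j = x0 j" "\<exists>j\<in>J. z j \<noteq> 0"
        by (auto simp: project_def)
      have "a z = a x0" using z by (intro aJ) auto
      then obtain w where "z(k := w) \<in> Z" using a(2) z(1) by (auto simp: Z'_def)
      then have "x0 \<in> project L (insert k J) Z"
        unfolding project_def using z x0(1) kJ by (auto intro!: bexI[of _ "z(k := w)"])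
      then show False using x0 by blast
    qed
    ultimately obtain h where h: "h \<in> polyfun (L - insert k J)"
      "\<forall>z\<in>project (L - {k}) J Z'. h z = 0" "h x0 \<noteq> 0"
      using zariski_closedD(2) x0(1) by metis
    have "a x * h x = 0" if x: "x \<in> project L (insert k J) Z" for x
    proof (rule ccontr)
      assume *: "a x * h x \<noteq> 0"
      obtain z where z: "z \<in> Z" "\<forall>j. j \<notin> insert k J \<longrightarrow> z j = x j" "\<exists>j\<in>insert k J. z j \<noteq> 0"
        and xa: "x \<in> ambient (L - insert k J)"
        using x by (auto simp: project_def)
      have az: "a z = a x" using z by (intro aJ) auto
      show False
      proof (cases "\<exists>j\<in>J. z j \<noteq> 0")
        case True
        have zz: "(z(k := 0))(k := z k) = z" by simp
        have "z(k := 0) \<in> Z'"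
          unfolding Z'_def using z(1) ZL zz by (auto simp: ambient_def intro!: exI[of _ "z k"])
        moreover have "x k = 0" using xa by (auto simp: ambient_def)
        ultimately have "x \<in> project (L - {k}) J Z'"
          unfolding project_def LkJ using xa z(2) True kJ
          by (auto intro!: bexI[of _ "z(k := 0)"])
        then show False using h(2) * by simp
      next
        case False
        \<comment> \<open>The \<open>J\<close>-part is zero, so \<open>z\<close> lies on the axis of
          \<open>k\<close>, where the monic equation reduces to
          \<open>a z * z k ^ D = 0\<close>.\<close>
        then have "z k \<noteq> 0" using z(3) by auto
        moreover have "poly (monom (a z) D) (z k) = 0" using G(4)[of z] G(5)[OF z(1)] False by auto
        ultimately show False using * az by (simp add: poly_monom)
      qed
    qed
    moreover have "(\<lambda>x. a x * h x) \<in> polyfun (L - insert k J)" using a h by (intro polyfun_intros)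
    ultimately show "\<exists>h\<in>polyfun (L - insert k J). (\<forall>z\<in>project L (insert k J) Z. h z = 0) \<and> h x0 \<noteq> 0"
      using a(2) h(3) by (intro bexI[of _ "\<lambda>x. a x * h x"]) auto
  qed (auto simp: project_def)
qed

text \<open>The factors are projected away one after the other. Blocks are disjoint, so the image
  under the first projection is still invariant under scaling the remaining blocks.\<close>

theorem zariski_closed_multiproject:
  assumes "finite B" "\<And>b. b \<in> B \<Longrightarrow> finite (J b) \<and> J b \<subseteq> L"
    and "\<And>b c. b \<in> B \<Longrightarrow> c \<in> B \<Longrightarrow> b \<noteq> c \<Longrightarrow> J b \<inter> J c = {}"
    and "zariski_closed L Z"
    and "\<And>b z l. b \<in> B \<Longrightarrow> z \<in> Z \<Longrightarrow> l \<noteq> 0 \<Longrightarrow> scale (J b) l z \<in> Z"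
  shows "zariski_closed (L - (\<Union>b\<in>B. J b)) {x \<in> ambient (L - (\<Union>b\<in>B. J b)).
    \<exists>z\<in>Z. (\<forall>k. k \<notin> (\<Union>b\<in>B. J b) \<longrightarrow> z k = x k) \<and> (\<forall>b\<in>B. \<exists>k\<in>J b. z k \<noteq> 0)}"
  using assms
proof (induction B arbitrary: L Z)
  case empty
  have "{x \<in> ambient L. \<exists>z\<in>Z. \<forall>k. z k = x k} = Z"
    using zariski_closedD(1)[OF empty(3)] by (auto simp flip: fun_eq_iff)
  then show ?case using empty by simp
next
  case (insert b B)
  have dis: "J b \<inter> J c = {}" if "c \<in> B" for c using insert that by (metis insertCI)
  have cl: "zariski_closed (L - J b) (project L (J b) Z)"
    using insert.prems by (intro zariski_closed_project) auto
  have con: "scale (J c) l x \<in> project L (J b) Z" if c: "c \<in> B" and x: "x \<in> project L (J b) Z" and l: "l \<noteq> 0" for c x l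
  proof -
    obtain z where z: "z \<in> Z" "\<forall>k. k \<notin> J b \<longrightarrow> z k = x k" "\<exists>k\<in>J b. z k \<noteq> 0" "x \<in> ambient (L - J b)"
      using x by (auto simp: project_def)
    have "scale (J c) l z \<in> Z" using insert.prems(4) c z l by auto
    moreover have "\<forall>k. k \<notin> J b \<longrightarrow> scale (J c) l z k = scale (J c) l x k"
      using z(2) by (auto simp: scale_def)
    moreover have "\<exists>k\<in>J b. scale (J c) l z k \<noteq> 0" using z(3) l by (auto simp: scale_def)
    ultimately show ?thesis using z(4) scale_ambient by (auto simp: project_def)
  qed
  have fin: "finite (J c) \<and> J c \<subseteq> L - J b" if "c \<in> B" for c
    using insert.prems(1) that dis[OF that] by auto
  have disB: "J c \<inter> J c' = {}" if "c \<in> B" "c' \<in> B" "c \<noteq> c'" for c c'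
    using insert.prems(2) that by blast
  note IH = insert.IH[OF fin disB cl con]
  have L: "L - J b - (\<Union>b\<in>B. J b) = L - (\<Union>b\<in>insert b B. J b)" by auto
  have eq: "{x \<in> ambient (L - J b - (\<Union>b\<in>B. J b)). \<exists>z\<in>project L (J b) Z.
      (\<forall>k. k \<notin> (\<Union>b\<in>B. J b) \<longrightarrow> z k = x k) \<and> (\<forall>b\<in>B. \<exists>k\<in>J b. z k \<noteq> 0)} =
    {x \<in> ambient (L - (\<Union>b\<in>insert b B. J b)). \<exists>z\<in>Z.
      (\<forall>k. k \<notin> (\<Union>b\<in>insert b B. J b) \<longrightarrow> z k = x k) \<and> (\<forall>b\<in>insert b B. \<exists>k\<in>J b. z k \<noteq> 0)}" (is "?A = ?B")
  proof (intro equalityI subsetI)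
    fix x assume "x \<in> ?A"
    then obtain z y where xa: "x \<in> ambient (L - J b - (\<Union>b\<in>B. J b))" and
      z: "z \<in> ambient (L - J b)" "y \<in> Z" "\<forall>k. k \<notin> J b \<longrightarrow> y k = z k" "\<exists>k\<in>J b. y k \<noteq> 0"
      "\<forall>k. k \<notin> (\<Union>b\<in>B. J b) \<longrightarrow> z k = x k" "\<forall>b\<in>B. \<exists>k\<in>J b. z k \<noteq> 0"
      by (auto simp: project_def)
    have "\<exists>k\<in>J c. y k \<noteq> 0" if c: "c \<in> B" for c
      using z(6) c dis[OF c] z(3) by (metis disjoint_iff)
    then show "x \<in> ?B" using xa z L by (auto intro!: bexI[of _ y])
  next
    fix x assume "x \<in> ?B"
    then obtain y where xa: "x \<in> ambient (L - (\<Union>b\<in>insert b B. J b))" and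
      y: "y \<in> Z" "\<forall>k. k \<notin> (\<Union>b\<in>insert b B. J b) \<longrightarrow> y k = x k" "\<forall>b\<in>insert b B. \<exists>k\<in>J b. y k \<noteq> 0"
      by auto
    define z where "z k = (if k \<in> J b then 0 else y k)" for k
    have "y \<in> ambient L" using y(1) zariski_closedD(1)[OF insert.prems(3)] by blast
    then have "z \<in> project L (J b) Z"
      using y by (auto simp: project_def z_def ambient_def intro!: bexI[of _ y])
    moreover have "z k = x k" if "k \<notin> (\<Union>b\<in>B. J b)" for k
      using that y(2) xa by (auto simp: z_def ambient_def)
    moreover have "\<exists>k\<in>J c. z k \<noteq> 0" if c: "c \<in> B" for c

    proof -
      obtain k where "k \<in> J c" "y k \<noteq> 0" using y(3) c by blast
      then show ?thesis using dis[OF c] by (intro bexI[of _ k]) (auto simp: z_def)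
    qed
    ultimately show "x \<in> ?A" using xa L by auto
  qed
  show ?case using IH unfolding eq unfolding L .
qed

section \<open>Zeros of square systems in a one-parameter family\<close>

lemma finite_common_positive:
  fixes Q :: "'i \<Rightarrow> real \<Rightarrow> bool"
  assumes "finite I" "\<And>i. i \<in> I \<Longrightarrow> \<exists>\<eta>>0. Q i \<eta>"
    and "\<And>i \<eta> \<eta>'. Q i \<eta> \<Longrightarrow> 0 < \<eta>' \<Longrightarrow> \<eta>' \<le> \<eta> \<Longrightarrow> Q i \<eta>'"
  shows "\<exists>\<eta>>0. \<forall>i\<in>I. Q i \<eta>"
  using assms(1,2)
proof (induction I)
  case empty
  show ?case by (intro exI[of _ 1]) auto
next
  case (insert i I)
  obtain \<eta> where "\<eta> > 0" "\<forall>i\<in>I. Q i \<eta>" using insert by auto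
  moreover obtain \<delta> where "\<delta> > 0" "Q i \<delta>" using insert by auto
  ultimately have "min \<eta> \<delta> > 0" "\<forall>j\<in>insert i I. Q j (min \<eta> \<delta>)"
    using assms(3)[of _ \<eta> "min \<eta> \<delta>"] assms(3)[of i \<delta> "min \<eta> \<delta>"] by auto
  then show ?case by blast
qed

lemma bounded_pointwise_convergent_subseq:
  fixes x :: "nat \<Rightarrow> 'k \<Rightarrow> complex"
  assumes "finite I" "\<And>n k. k \<in> I \<Longrightarrow> cmod (x n k) \<le> C"
  shows "\<exists>r l. strict_mono (r :: nat \<Rightarrow> nat) \<and> (\<forall>k\<in>I. (\<lambda>n. x (r n) k) \<longlonglongrightarrow> l k)"
  using assms
proof (induction I)
  case empty
  show ?case by (intro exI[of _ id]) (auto simp: strict_mono_def)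
next
  case (insert j I)
  then obtain r l where r: "strict_mono (r :: nat \<Rightarrow> nat)" "\<forall>k\<in>I. (\<lambda>n. x (r n) k) \<longlonglongrightarrow> l k" by auto
  have "bounded (range (\<lambda>n. x (r n) j))"
    using insert.prems unfolding bounded_iff by auto
  then obtain s m where s: "strict_mono (s :: nat \<Rightarrow> nat)" "((\<lambda>n. x (r n) j) \<circ> s) \<longlonglongrightarrow> m"
    using bounded_imp_convergent_subsequence by blast
  have "(\<lambda>n. x ((r \<circ> s) n) k) \<longlonglongrightarrow> (l(j := m)) k" if k: "k \<in> insert j I" for k
  proof (cases "k = j")
    case True
    then show ?thesis using s by (simp add: comp_def)
  next
    case False
    then have "(\<lambda>n. x (r n) k) \<longlonglongrightarrow> l k" using r k by auto
    then show ?thesis using LIMSEQ_subseq_LIMSEQ[OF _ s(1)] False by (auto simp: comp_def)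
  qed
  then show ?case using strict_mono_o[OF r(1) s(1)] by blast
qed

text \<open>A seminorm that sees only the coordinates in \<open>Y\<close>. Points are functions on a
  whole type, and all estimates concern points that agree outside \<open>Y\<close>.\<close>

definition l1 :: "'k set \<Rightarrow> ('k \<Rightarrow> complex) \<Rightarrow> ('k \<Rightarrow> complex) \<Rightarrow> real" where
  "l1 Y z w = (\<Sum>k\<in>Y. cmod (z k - w k))"

lemma l1_nonneg: "0 \<le> l1 Y z w" by (simp add: l1_def sum_nonneg)

lemma l1_commute: "l1 Y z w = l1 Y w z" by (simp add: l1_def norm_minus_commute)

lemma l1_refl[simp]: "l1 Y z z = 0" by (simp add: l1_def)

lemma l1_triangle: "l1 Y z w \<le> l1 Y z u + l1 Y u w"
proof -
  have "cmod (z k - w k) \<le> cmod (z k - u k) + cmod (u k - w k)" for k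
    using norm_triangle_ineq[of "z k - u k" "u k - w k"] by simp
  then show ?thesis unfolding l1_def by (simp add: sum_mono flip: sum.distrib)
qed

lemma l1_component: "finite Y \<Longrightarrow> k \<in> Y \<Longrightarrow> cmod (z k - w k) \<le> l1 Y z w"
  unfolding l1_def by (rule member_le_sum) auto

lemma l1_tendsto:
  "(\<And>k. k \<in> Y \<Longrightarrow> (\<lambda>n. z n k) \<longlonglongrightarrow> w k) \<Longrightarrow> (\<lambda>n. l1 Y (z n) u) \<longlonglongrightarrow> l1 Y w u"
  unfolding l1_def by (intro tendsto_intros) auto

text \<open>Fixing the coordinates outside \<open>Y\<close> at \<open>z0\<close> describes an affine
  chart without changing the type of points. The equations are polynomial jointly in the point and
  the scalar \<open>t\<close>, which is the variable \<open>None\<close>.\<close>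

locale slice_system =
  fixes Y V :: "'z set" and z0 :: "'z \<Rightarrow> complex" and E :: "'e set"
    and F :: "'e \<Rightarrow> complex \<Rightarrow> ('z \<Rightarrow> complex) \<Rightarrow> complex"
  assumes finV: "finite V" and YV: "Y \<subseteq> V" and finE: "finite E" and card_EY: "card E = card Y"
    and polyF: "\<And>e. e \<in> E \<Longrightarrow> (\<lambda>x. F e (x None) (\<lambda>k. x (Some k))) \<in> polyfun (insert None (Some ` V))"
begin

definition slice :: "('z \<Rightarrow> complex) set" where
  "slice = {z. \<forall>k. k \<notin> Y \<longrightarrow> z k = z0 k}"

definition zeros :: "complex \<Rightarrow> ('z \<Rightarrow> complex) set" where
  "zeros t = {z \<in> slice. \<forall>e\<in>E. F e t z = 0}"

text \<open>Injectivity of the Jacobian in the directions of \<open>Y\<close>. Directional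
  derivatives let it be checked on a line, without computing a matrix.\<close>

definition nondegenerate :: "complex \<Rightarrow> ('z \<Rightarrow> complex) \<Rightarrow> bool" where
  "nondegenerate t z \<longleftrightarrow> (\<forall>v \<in> ambient Y.
     (\<forall>e\<in>E. ((\<lambda>s. F e t (\<lambda>k. z k + s * v k)) has_field_derivative 0) (at 0)) \<longrightarrow> (\<forall>k. v k = 0))"

lemma finY: "finite Y" using finV YV finite_subset by blast

lemma slice_eqI: "z \<in> slice \<Longrightarrow> w \<in> slice \<Longrightarrow> l1 Y z w = 0 \<Longrightarrow> z = w"
proof
  fix k assume *: "z \<in> slice" "w \<in> slice" "l1 Y z w = 0"
  show "z k = w k"
    using * l1_component[OF finY, of k z w] by (cases "k \<in> Y") (auto simp: slice_def)
qed

lemma F_tendsto: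
  assumes "e \<in> E" "(t \<longlongrightarrow> t1) G" "\<And>k. k \<in> V \<Longrightarrow> ((\<lambda>n. z n k) \<longlongrightarrow> z1 k) G"
  shows "((\<lambda>n. F e (t n) (z n)) \<longlongrightarrow> F e t1 z1) G"
proof -
  have "((\<lambda>n. (\<lambda>x. F e (x None) (\<lambda>k. x (Some k))) (case_option (t n) (z n))) \<longlongrightarrow>
      (\<lambda>x. F e (x None) (\<lambda>k. x (Some k))) (case_option t1 z1)) G"
    using assms by (intro polyfun_tendsto[OF polyF]) auto
  then show ?thesis by simp
qed

text \<open>Both points share the scalar \<open>t\<close> and all coordinates outside
  \<open>Y\<close>, so only the divided differences for \<open>Y\<close> survive. This gives an
  exact mean value formula with a continuous matrix \<open>M\<close> that restricts to the Jacobian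
  on the diagonal.\<close>

lemma divided_differences:
  obtains M where
    "\<And>e t z w. e \<in> E \<Longrightarrow> z \<in> slice \<Longrightarrow> w \<in> slice \<Longrightarrow>
      F e t z - F e t w = (\<Sum>k\<in>Y. (z k - w k) * M e k t z w)"
    "\<And>e k t1 z1 c. e \<in> E \<Longrightarrow> k \<in> Y \<Longrightarrow> z1 \<in> slice \<Longrightarrow> c > 0 \<Longrightarrow> \<exists>\<eta>>0. \<forall>t. \<forall>z\<in>slice. \<forall>w\<in>slice.
      cmod (t - t1) < \<eta> \<longrightarrow> l1 Y z z1 < \<eta> \<longrightarrow> l1 Y w z1 < \<eta> \<longrightarrow>
      cmod (M e k t z w - M e k t1 z1 z1) < c"
    "\<And>e t z v. e \<in> E \<Longrightarrow> v \<in> ambient Y \<Longrightarrow>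
      ((\<lambda>s. F e t (\<lambda>k. z k + s * v k)) has_field_derivative (\<Sum>k\<in>Y. v k * M e k t z z)) (at 0)"
proof -
  let ?K = "insert None (Some ` V)"
  let ?q = "\<lambda>e x. F e (x None) (\<lambda>k. x (Some k))"
  let ?H = "\<lambda>e D. (\<forall>k. (\<lambda>z. D k (z \<circ> Inl) (z \<circ> Inr)) \<in> polyfun (Inl ` ?K \<union> Inr ` ?K)) \<and>
    (\<forall>x y. ?q e x - ?q e y = (\<Sum>k\<in>?K. (x k - y k) * D k x y))"
  have finK: "finite ?K" using finV by simp
  define D where "D e = (SOME D. ?H e D)" for e
  have "\<exists>D. ?H e D" if "e \<in> E" for e
    by (rule polyfun_Hadamard[OF polyF[OF that] finK])
  then have "?H e (D e)" if "e \<in> E" for e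
    unfolding D_def using that by (intro someI_ex[of "?H e"])
  then have D: "\<And>e k. e \<in> E \<Longrightarrow> (\<lambda>z. D e k (z \<circ> Inl) (z \<circ> Inr)) \<in> polyfun (Inl ` ?K \<union> Inr ` ?K)"
    "\<And>e x y. e \<in> E \<Longrightarrow> ?q e x - ?q e y = (\<Sum>k\<in>?K. (x k - y k) * D e k x y)" by simp_all
  define M where "M e k t z w = D e (Some k) (case_option t z) (case_option t w)" for e k t z w
  have sumK: "(\<Sum>k\<in>?K. f k) = f None + (\<Sum>k\<in>V. f (Some k))" for f :: "'z option \<Rightarrow> complex"
    using finV by (simp add: sum.reindex)
  have sumY: "(\<Sum>k\<in>V. f k) = (\<Sum>k\<in>Y. f k)" if "\<And>k. k \<notin> Y \<Longrightarrow> f k = 0" for f :: "'z \<Rightarrow> complex"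
    using that finV YV by (intro sum.mono_neutral_right) auto
  show thesis
  proof (rule that[of M])
    fix e t z w assume "e \<in> E" "z \<in> slice" "w \<in> slice"
    then show "F e t z - F e t w = (\<Sum>k\<in>Y. (z k - w k) * M e k t z w)"
      using D(2)[of e "case_option t z" "case_option t w"]
      by (simp add: sumK M_def) (intro sumY, simp add: slice_def)
  next
    fix e k t1 z1 and c :: real assume e: "e \<in> E" "k \<in> Y" "z1 \<in> slice" "c > 0"
    let ?x1 = "case_sum (case_option t1 z1) (case_option t1 z1)"
    from polyfun_near[OF D(1)[OF e(1), of "Some k"] e(4), of ?x1]
    obtain \<eta> where "\<eta> > 0 \<and> (\<forall>y. (\<forall>j\<in>Inl ` ?K \<union> Inr ` ?K. cmod (y j - ?x1 j) < \<eta>) \<longrightarrow>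
        cmod (D e (Some k) (y \<circ> Inl) (y \<circ> Inr) - D e (Some k) (?x1 \<circ> Inl) (?x1 \<circ> Inr)) < c)"
      by (rule exE)
    then have \<eta>: "\<eta> > 0" "\<And>y. (\<forall>j\<in>Inl ` ?K \<union> Inr ` ?K. cmod (y j - ?x1 j) < \<eta>) \<Longrightarrow>
        cmod (D e (Some k) (y \<circ> Inl) (y \<circ> Inr) - D e (Some k) (?x1 \<circ> Inl) (?x1 \<circ> Inr)) < c"
      by simp_all
    have "cmod (M e k t z w - M e k t1 z1 z1) < c" if z: "z \<in> slice" "w \<in> slice"
      and n: "cmod (t - t1) < \<eta>" "l1 Y z z1 < \<eta>" "l1 Y w z1 < \<eta>" for t z w
    proof -
      have near: "cmod (u j - z1 j) < \<eta>" if "u \<in> slice" "l1 Y u z1 < \<eta>" for u j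
        using that e(3) \<eta>(1) l1_component[OF finY, of j u z1]
        by (cases "j \<in> Y") (auto simp: slice_def)
      have "cmod (D e (Some k) (case_sum (case_option t z) (case_option t w) \<circ> Inl)
          (case_sum (case_option t z) (case_option t w) \<circ> Inr) - D e (Some k) (?x1 \<circ> Inl) (?x1 \<circ> Inr)) < c"
        using n(1) near[OF z(1) n(2)] near[OF z(2) n(3)] by (intro \<eta>(2)) auto
      then show ?thesis by (simp add: M_def comp_def)
    qed
    then show "\<exists>\<eta>>0. \<forall>t. \<forall>z\<in>slice. \<forall>w\<in>slice. cmod (t - t1) < \<eta> \<longrightarrow> l1 Y z z1 < \<eta> \<longrightarrow> l1 Y w z1 < \<eta> \<longrightarrow>
      cmod (M e k t z w - M e k t1 z1 z1) < c" using \<eta>(1) by blast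
  next
    fix e t z v assume e: "e \<in> E" "v \<in> ambient Y"
    have "((\<lambda>s. ?q e (\<lambda>k. case_option t z k + s * case_option 0 v k)) has_field_derivative
        (\<Sum>k\<in>?K. case_option 0 v k * D e k (case_option t z) (case_option t z))) (at 0)"
      by (rule polyfun_directional_derivative[OF polyF[OF e(1)] _ D(1)[OF e(1)] D(2)[OF e(1)]])
        (use finV in simp)
    moreover have "(\<Sum>k\<in>?K. case_option 0 v k * D e k (case_option t z) (case_option t z)) =
        (\<Sum>k\<in>Y. v k * M e k t z z)"
      by (simp add: sumK M_def) (intro sumY, use e in \<open>auto simp: ambient_def\<close>)
    ultimately show "((\<lambda>s. F e t (\<lambda>k. z k + s * v k)) has_field_derivative (\<Sum>k\<in>Y. v k * M e k t z z)) (at 0)"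
      by simp
  qed
qed

text \<open>Newton's method with a fixed derivative is a contraction near a nondegenerate zero.\<close>
lemma unique_nearby_zero:
  assumes z1: "z1 \<in> zeros t1" and nd: "nondegenerate t1 z1"
  shows "\<exists>\<eta>>0. \<forall>\<rho>. 0 < \<rho> \<and> \<rho> \<le> \<eta> \<longrightarrow>
    (\<exists>\<epsilon>>0. \<forall>t. cmod (t - t1) < \<epsilon> \<longrightarrow> (\<exists>!z. z \<in> zeros t \<and> l1 Y z z1 \<le> \<rho>))"
proof -
  obtain M where M1: "\<And>e t z w. e \<in> E \<Longrightarrow> z \<in> slice \<Longrightarrow> w \<in> slice \<Longrightarrow>
      F e t z - F e t w = (\<Sum>k\<in>Y. (z k - w k) * M e k t z w)"
    and M2: "\<And>e k t1 z1 c. e \<in> E \<Longrightarrow> k \<in> Y \<Longrightarrow> z1 \<in> slice \<Longrightarrow> c > 0 \<Longrightarrow> \<exists>\<eta>>0. \<forall>t. \<forall>z\<in>slice. \<forall>w\<in>slice.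
      cmod (t - t1) < \<eta> \<longrightarrow> l1 Y z z1 < \<eta> \<longrightarrow> l1 Y w z1 < \<eta> \<longrightarrow>
      cmod (M e k t z w - M e k t1 z1 z1) < c"
    and M3: "\<And>e t z v. e \<in> E \<Longrightarrow> v \<in> ambient Y \<Longrightarrow>
      ((\<lambda>s. F e t (\<lambda>k. z k + s * v k)) has_field_derivative (\<Sum>k\<in>Y. v k * M e k t z z)) (at 0)"
    using divided_differences by blast
  have z1s: "z1 \<in> slice" and F1: "\<And>e. e \<in> E \<Longrightarrow> F e t1 z1 = 0" using z1 by (auto simp: zeros_def)
  let ?a = "\<lambda>e k. M e k t1 z1 z1"
  have "\<forall>k\<in>Y. c k = 0" if c: "\<forall>e\<in>E. (\<Sum>k\<in>Y. ?a e k * c k) = 0" for c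
  proof -
    define v where "v k = (if k \<in> Y then c k else 0)" for k
    have v: "v \<in> ambient Y" by (simp add: v_def ambient_def)
    have "((\<lambda>s. F e t1 (\<lambda>k. z1 k + s * v k)) has_field_derivative 0) (at 0)" if e: "e \<in> E" for e
    proof -
      have "(\<Sum>k\<in>Y. v k * M e k t1 z1 z1) = 0"
        using c e by (simp add: v_def mult.commute cong: sum.cong)
      then show ?thesis using M3[OF e v, of t1 z1] by simp
    qed
    then have "\<forall>k. v k = 0" using nd v unfolding nondegenerate_def by blast
    then show ?thesis by (metis v_def)
  qed
  from left_inverse_matrix[OF finE finY card_EY, of ?a, OF this] obtain b where
    b: "\<forall>j\<in>Y. \<forall>u\<in>Y. (\<Sum>e\<in>E. b j e * ?a e u) = (if j = u then 1 else 0)"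
    "\<And>v. (\<forall>j\<in>Y. (\<Sum>e\<in>E. b j e * v e) = 0) \<Longrightarrow> (\<forall>e\<in>E. v e = 0)" by blast
  \<comment> \<open>A bound for the row sums of \<open>b\<close>. The summand 1, here and in
    \<open>N\<close>, keeps the constants positive when the index sets are empty.\<close>
  define \<beta> where "\<beta> = 1 + (\<Sum>j\<in>Y. \<Sum>e\<in>E. cmod (b j e))"
  have \<beta>: "\<beta> > 0" unfolding \<beta>_def by (intro add_pos_nonneg sum_nonneg) auto
  have \<beta>j: "(\<Sum>e\<in>E. cmod (b j e)) \<le> \<beta>" if "j \<in> Y" for j
  proof -
    have "(\<Sum>e\<in>E. cmod (b j e)) \<le> (\<Sum>j\<in>Y. \<Sum>e\<in>E. cmod (b j e))"
      using finY that by (intro member_le_sum) (auto intro: sum_nonneg)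
    then show ?thesis by (simp add: \<beta>_def)
  qed
  define N where "N = real (card Y) + 1"
  have N: "N > 0" by (simp add: N_def)
  have "\<exists>\<eta>>0. \<forall>p\<in>E \<times> Y. \<forall>t. \<forall>z\<in>slice. \<forall>w\<in>slice.
      cmod (t - t1) < \<eta> \<longrightarrow> l1 Y z z1 < \<eta> \<longrightarrow> l1 Y w z1 < \<eta> \<longrightarrow>
      cmod (M (fst p) (snd p) t z w - M (fst p) (snd p) t1 z1 z1) < 1 / (2 * N * \<beta>)"
  proof (rule finite_common_positive)
    show "finite (E \<times> Y)" using finE finY by simp
    fix p assume "p \<in> E \<times> Y"
    then show "\<exists>\<eta>>0. \<forall>t. \<forall>z\<in>slice. \<forall>w\<in>slice.
      cmod (t - t1) < \<eta> \<longrightarrow> l1 Y z z1 < \<eta> \<longrightarrow> l1 Y w z1 < \<eta> \<longrightarrow>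
      cmod (M (fst p) (snd p) t z w - M (fst p) (snd p) t1 z1 z1) < 1 / (2 * N * \<beta>)"
      using N \<beta> by (intro M2[OF _ _ z1s]) auto
  next
    fix p and \<eta> \<eta>' :: real
    assume "\<forall>t. \<forall>z\<in>slice. \<forall>w\<in>slice. cmod (t - t1) < \<eta> \<longrightarrow> l1 Y z z1 < \<eta> \<longrightarrow> l1 Y w z1 < \<eta> \<longrightarrow>
      cmod (M (fst p) (snd p) t z w - M (fst p) (snd p) t1 z1 z1) < 1 / (2 * N * \<beta>)" "\<eta>' \<le> \<eta>"
    then show "\<forall>t. \<forall>z\<in>slice. \<forall>w\<in>slice. cmod (t - t1) < \<eta>' \<longrightarrow> l1 Y z z1 < \<eta>' \<longrightarrow> l1 Y w z1 < \<eta>' \<longrightarrow>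
      cmod (M (fst p) (snd p) t z w - M (fst p) (snd p) t1 z1 z1) < 1 / (2 * N * \<beta>)"
      by (meson less_le_trans)
  qed
  then obtain \<eta>0 where \<eta>0': "\<eta>0 > 0" "\<forall>p\<in>E \<times> Y. \<forall>t. \<forall>z\<in>slice. \<forall>w\<in>slice.
      cmod (t - t1) < \<eta>0 \<longrightarrow> l1 Y z z1 < \<eta>0 \<longrightarrow> l1 Y w z1 < \<eta>0 \<longrightarrow>
      cmod (M (fst p) (snd p) t z w - M (fst p) (snd p) t1 z1 z1) < 1 / (2 * N * \<beta>)" by (elim exE conjE)
  have \<eta>0: "\<eta>0 > 0" "\<And>e k t z w. e \<in> E \<Longrightarrow> k \<in> Y \<Longrightarrow> z \<in> slice \<Longrightarrow> w \<in> slice \<Longrightarrow>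
      cmod (t - t1) < \<eta>0 \<Longrightarrow> l1 Y z z1 < \<eta>0 \<Longrightarrow> l1 Y w z1 < \<eta>0 \<Longrightarrow>
      cmod (M e k t z w - M e k t1 z1 z1) < 1 / (2 * N * \<beta>)"
    using \<eta>0' by auto
  \<comment> \<open>The Newton map with the derivative frozen at \<open>t1\<close> and
    \<open>z1\<close>. Since \<open>b\<close> inverts that derivative, the difference of two values
    involves only deviations of \<open>M\<close> from it; \<open>1 / (2 * N * \<beta>)\<close> is
    the deviation that yields contraction by one half.\<close>
  define G where "G t z j = (if j \<in> Y then z j - (\<Sum>e\<in>E. b j e * F e t z) else z0 j)" for t z j
  have Gs: "G t z \<in> slice" for t z by (simp add: G_def slice_def)
  have contr: "l1 Y (G t z) (G t w) \<le> l1 Y z w / 2"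
    if z: "z \<in> slice" "w \<in> slice" and n: "cmod (t - t1) < \<eta>0" "l1 Y z z1 < \<eta>0" "l1 Y w z1 < \<eta>0" for t z w
  proof -
    have "cmod (G t z j - G t w j) \<le> l1 Y z w / (2 * N)" if j: "j \<in> Y" for j
    proof -
      have "(\<Sum>e\<in>E. b j e * (F e t z - F e t w)) = (\<Sum>e\<in>E. b j e * (\<Sum>k\<in>Y. (z k - w k) * M e k t z w))"
        by (intro sum.cong refl) (simp add: M1 z)
      also have "\<dots> = (\<Sum>k\<in>Y. (z k - w k) * (\<Sum>e\<in>E. b j e * M e k t z w))"
        unfolding sum_distrib_left by (subst sum.swap) (simp add: mult_ac)
      finally have s1: "(\<Sum>e\<in>E. b j e * (F e t z - F e t w)) = (\<Sum>k\<in>Y. (z k - w k) * (\<Sum>e\<in>E. b j e * M e k t z w))" .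
      have "z j - w j = (\<Sum>k\<in>Y. (z k - w k) * (\<Sum>e\<in>E. b j e * M e k t1 z1 z1))"
      proof -
        have "(\<Sum>k\<in>Y. (z k - w k) * (\<Sum>e\<in>E. b j e * M e k t1 z1 z1)) = (\<Sum>k\<in>Y. if j = k then z k - w k else 0)"
          using b(1) j by (intro sum.cong refl) auto
        then show ?thesis using finY j by simp
      qed
      then have "G t z j - G t w j = (\<Sum>k\<in>Y. (z k - w k) * (\<Sum>e\<in>E. b j e * M e k t1 z1 z1))
          - (\<Sum>e\<in>E. b j e * (F e t z - F e t w))"
        using j by (simp add: G_def right_diff_distrib sum_subtractf)
      also have "\<dots> = (\<Sum>k\<in>Y. (z k - w k) * (\<Sum>e\<in>E. b j e * (M e k t1 z1 z1 - M e k t z w)))"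
        unfolding s1 by (simp add: right_diff_distrib sum_subtractf)
      finally have eq: "G t z j - G t w j = (\<Sum>k\<in>Y. (z k - w k) * (\<Sum>e\<in>E. b j e * (M e k t1 z1 z1 - M e k t z w)))" .
      have bd: "cmod (\<Sum>e\<in>E. b j e * (M e k t1 z1 z1 - M e k t z w)) \<le> 1 / (2 * N)" if k: "k \<in> Y" for k
      proof -
        have "cmod (M e k t1 z1 z1 - M e k t z w) \<le> 1 / (2 * N * \<beta>)" if "e \<in> E" for e
          using \<eta>0(2)[OF that k z n] by (simp add: norm_minus_commute)
        then have "cmod (\<Sum>e\<in>E. b j e * (M e k t1 z1 z1 - M e k t z w)) \<le> (\<Sum>e\<in>E. cmod (b j e) * (1 / (2 * N * \<beta>)))"
          by (intro sum_norm_le) (simp only: norm_mult mult_left_mono norm_ge_zero)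
        also have "\<dots> = (\<Sum>e\<in>E. cmod (b j e)) * (1 / (2 * N * \<beta>))"
          by (rule sum_distrib_right[symmetric])
        also have "\<dots> \<le> \<beta> * (1 / (2 * N * \<beta>))"
          using \<beta>j[OF j] \<beta> N by (intro mult_right_mono) auto
        also have "\<dots> = 1 / (2 * N)" using \<beta> by simp
        finally show ?thesis .
      qed
      have "cmod (G t z j - G t w j) \<le> (\<Sum>k\<in>Y. cmod (z k - w k) * (1 / (2 * N)))"
        unfolding eq using bd by (intro sum_norm_le) (simp only: norm_mult mult_left_mono norm_ge_zero)
      also have "\<dots> = l1 Y z w / (2 * N)" by (simp add: l1_def sum_divide_distrib)
      finally show ?thesis .
    qed
    then have "l1 Y (G t z) (G t w) \<le> (\<Sum>j\<in>Y. l1 Y z w / (2 * N))"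
      unfolding l1_def[of Y "G t z"] by (rule sum_mono)
    also have "\<dots> = l1 Y z w / 2 * (real (card Y) / N)" by simp
    also have "\<dots> \<le> l1 Y z w / 2 * 1"
      using l1_nonneg[of Y z w] by (intro mult_left_mono) (auto simp: N_def)
    finally show ?thesis by simp
  qed
  have fix_iff: "G t z = z \<longleftrightarrow> z \<in> zeros t" if z: "z \<in> slice" for t z
  proof
    assume *: "G t z = z"
    have "(\<Sum>e\<in>E. b j e * F e t z) = 0" if "j \<in> Y" for j
      using fun_cong[OF *, of j] that by (simp add: G_def)
    then show "z \<in> zeros t" using b(2)[of "\<lambda>e. F e t z"] z by (simp add: zeros_def)
  next
    assume "z \<in> zeros t"
    then show "G t z = z" by (auto simp: zeros_def G_def slice_def)
  qed
  show ?thesis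
  proof (rule exI[of _ "\<eta>0 / 2"], rule conjI, goal_cases)
    case 1
    show "\<eta>0 / 2 > 0" using \<eta>0 by simp
  next
    case 2
    show ?case
    proof (intro allI impI)
      fix \<rho> assume "0 < \<rho> \<and> \<rho> \<le> \<eta>0 / 2"
      then have \<rho>: "0 < \<rho>" "\<rho> < \<eta>0" using \<eta>0(1) by auto
      have "\<exists>\<epsilon>>0. \<forall>e\<in>E. \<forall>t. cmod (t - t1) < \<epsilon> \<longrightarrow> cmod (F e t z1) < \<rho> / (2 * \<beta>)"
      proof (rule finite_common_positive[OF finE])
        fix e assume e: "e \<in> E"
        have "((\<lambda>t. F e t z1) \<longlongrightarrow> F e t1 z1) (at t1)" by (intro F_tendsto e) auto
        then have "isCont (\<lambda>t. F e t z1) t1" by (simp add: isCont_def)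
        then have "\<exists>d>0. \<forall>t. dist t t1 < d \<longrightarrow> dist (F e t z1) (F e t1 z1) < \<rho> / (2 * \<beta>)"
          unfolding continuous_at_eps_delta using \<rho> \<beta> by (metis divide_pos_pos mult_pos_pos zero_less_numeral)
        then show "\<exists>\<epsilon>>0. \<forall>t. cmod (t - t1) < \<epsilon> \<longrightarrow> cmod (F e t z1) < \<rho> / (2 * \<beta>)"
          using F1[OF e] by (simp add: dist_norm)
      qed auto
      then obtain \<epsilon>1 where \<epsilon>1: "\<epsilon>1 > 0" "\<And>e t. e \<in> E \<Longrightarrow> cmod (t - t1) < \<epsilon>1 \<Longrightarrow> cmod (F e t z1) < \<rho> / (2 * \<beta>)"
        by blast
      show "\<exists>\<epsilon>>0. \<forall>t. cmod (t - t1) < \<epsilon> \<longrightarrow> (\<exists>!z. z \<in> zeros t \<and> l1 Y z z1 \<le> \<rho>)"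
      proof (intro exI[of _ "min \<epsilon>1 \<eta>0"] conjI allI impI)
        show "min \<epsilon>1 \<eta>0 > 0" using \<epsilon>1 \<eta>0 by simp
        fix t assume t: "cmod (t - t1) < min \<epsilon>1 \<eta>0"
        then have t0: "cmod (t - t1) < \<eta>0" by simp
        have start: "l1 Y (G t z1) z1 \<le> \<rho> / 2"
        proof -
          have "l1 Y (G t z1) z1 = (\<Sum>j\<in>Y. cmod (\<Sum>e\<in>E. b j e * F e t z1))"
            unfolding l1_def by (intro sum.cong refl) (simp add: G_def)
          also have "\<dots> \<le> (\<Sum>j\<in>Y. \<Sum>e\<in>E. cmod (b j e) * (\<rho> / (2 * \<beta>)))"
            using less_imp_le[OF \<epsilon>1(2)] t
            by (intro sum_mono sum_norm_le) (simp only: norm_mult mult_left_mono norm_ge_zero min_less_iff_conj)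
          also have "\<dots> = (\<Sum>j\<in>Y. \<Sum>e\<in>E. cmod (b j e)) * (\<rho> / (2 * \<beta>))" by (simp only: sum_distrib_right)
          also have "\<dots> \<le> \<beta> * (\<rho> / (2 * \<beta>))"
            using \<rho> \<beta> by (intro mult_right_mono) (auto simp: \<beta>_def)
          also have "\<dots> = \<rho> / 2" using \<beta> by simp
          finally show ?thesis .
        qed
        define x where "x n = (G t ^^ n) z1" for n
        have x0: "x 0 = z1" and xS: "x (Suc n) = G t (x n)" for n by (simp_all add: x_def)
        have xs: "x n \<in> slice" for n by (cases n) (simp_all add: x0 xS z1s Gs)
        \<comment> \<open>The first step is at most half the radius and each further step halves, so
          the iterates never use up the radius \<open>\<rho>\<close> and the contraction estimate
          stays applicable.\<close>
        have step: "l1 Y (x (Suc n)) (x n) \<le> \<rho> / 2 ^ Suc n \<and> l1 Y (x n) z1 \<le> \<rho> - \<rho> / 2 ^ n" for n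
        proof (induction n)
          case 0
          then show ?case using start by (simp add: x0 xS)
        next
          case (Suc n)
          have p: "\<rho> / 2 ^ m > 0" for m :: nat using \<rho> by simp
          have "l1 Y (x (Suc n)) z1 \<le> l1 Y (x (Suc n)) (x n) + l1 Y (x n) z1" by (rule l1_triangle)
          also have "\<dots> \<le> \<rho> / 2 ^ Suc n + (\<rho> - \<rho> / 2 ^ n)" using Suc by linarith
          also have "\<dots> = \<rho> - \<rho> / 2 ^ Suc n" by (simp add: field_simps)
          finally have A: "l1 Y (x (Suc n)) z1 \<le> \<rho> - \<rho> / 2 ^ Suc n" .
          have "l1 Y (x (Suc (Suc n))) (x (Suc n)) \<le> l1 Y (x (Suc n)) (x n) / 2"
            unfolding xS[of "Suc n"] using xS[of n, symmetric]
            by (metis contr[OF xs xs t0, of "Suc n" n] A Suc.IH p \<rho>(2) less_trans le_less_trans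
                diff_less_eq less_add_same_cancel1)
          also have "\<dots> \<le> \<rho> / 2 ^ Suc n / 2" using Suc.IH by (intro divide_right_mono) simp_all
          finally show ?case using A by simp
        qed
        have close: "l1 Y (x n) z1 \<le> \<rho>" for n
          using step[of n] \<rho> by (smt (verit) divide_pos_pos zero_less_power)
        have "convergent (\<lambda>n. x n j)" if j: "j \<in> Y" for j
        proof -
          have "summable (\<lambda>n. x (Suc n) j - x n j)"
          proof (rule summable_comparison_test')
            show "summable (\<lambda>n. \<rho> / 2 * (1 / 2) ^ n)" by (intro summable_mult summable_geometric) simp
            fix n :: nat
            have "cmod (x (Suc n) j - x n j) \<le> l1 Y (x (Suc n)) (x n)" by (rule l1_component[OF finY j])
            also have "\<dots> \<le> \<rho> / 2 ^ Suc n" using step by blast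
            finally show "norm (x (Suc n) j - x n j) \<le> \<rho> / 2 * (1 / 2) ^ n" by (simp add: power_one_over)
          qed
          then have "convergent (\<lambda>n. x n j - x 0 j)"
            unfolding summable_iff_convergent sum_lessThan_telescope[of "\<lambda>n. x n j"] .
          then show ?thesis by (simp add: convergent_diff_const_right_iff)
        qed
        then obtain l0 where l0: "\<And>j. j \<in> Y \<Longrightarrow> (\<lambda>n. x n j) \<longlonglongrightarrow> l0 j"
          unfolding convergent_def by metis
        define l where "l j = (if j \<in> Y then l0 j else z0 j)" for j
        have ls: "l \<in> slice" by (simp add: l_def slice_def)
        have lim: "(\<lambda>n. x n j) \<longlonglongrightarrow> l j" for j
        proof (cases "j \<in> Y")
          case False
          then have "(\<lambda>n. x n j) = (\<lambda>n. z0 j)" using xs by (auto simp: slice_def)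
          then show ?thesis using False by (simp add: l_def)
        qed (simp add: l_def l0)
        have "G t l j = l j" for j
        proof (cases "j \<in> Y")
          case True
          have "(\<lambda>n. x n j - (\<Sum>e\<in>E. b j e * F e t (x n))) \<longlonglongrightarrow> l j - (\<Sum>e\<in>E. b j e * F e t l)"
            by (intro tendsto_intros lim F_tendsto)
          then have "(\<lambda>n. x (Suc n) j) \<longlonglongrightarrow> G t l j" using True by (simp add: xS G_def)
          moreover have "(\<lambda>n. x (Suc n) j) \<longlonglongrightarrow> l j" using lim by (rule LIMSEQ_Suc)
          ultimately show ?thesis by (rule LIMSEQ_unique)
        qed (simp add: G_def l_def)
        then have lz: "l \<in> zeros t" using fix_iff[OF ls] by blast
        have "(\<lambda>n. l1 Y (x n) z1) \<longlonglongrightarrow> l1 Y l z1" by (intro l1_tendsto lim)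
        then have lc: "l1 Y l z1 \<le> \<rho>" by (rule LIMSEQ_le_const2) (use close in auto)
        show "\<exists>!z. z \<in> zeros t \<and> l1 Y z z1 \<le> \<rho>"
        proof (rule ex1I[of _ l])
          fix z assume z: "z \<in> zeros t \<and> l1 Y z z1 \<le> \<rho>"
          then have zs: "z \<in> slice" by (auto simp: zeros_def)
          have "l1 Y (G t z) (G t l) \<le> l1 Y z l / 2"
            using z lc \<rho> by (intro contr zs ls t0) auto
          moreover have "G t z = z" "G t l = l" using fix_iff zs ls z lz by auto
          ultimately have "l1 Y z l = 0" using l1_nonneg[of Y z l] by simp
          then show "z = l" using slice_eqI[OF zs ls] by blast
        qed (use lz lc in blast)
      qed
    qed
  qed
qed

text \<open>Every zero continues to exactly one nearby zero, and properness keeps further zeros from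
  arriving out of nowhere; the cardinality is locally constant on a connected set.\<close>

theorem card_zeros_constant:
  assumes U: "open U" "connected U"
    and nd: "\<And>t z. t \<in> U \<Longrightarrow> z \<in> zeros t \<Longrightarrow> nondegenerate t z"
    and proper: "\<And>ts t zs. t \<in> U \<Longrightarrow> ts \<longlonglongrightarrow> t \<Longrightarrow> (\<And>n. ts n \<in> U) \<Longrightarrow> (\<And>n. zs n \<in> zeros (ts n)) \<Longrightarrow>
      \<exists>r z. strict_mono (r :: nat \<Rightarrow> nat) \<and> z \<in> zeros t \<and> (\<forall>k\<in>Y. (\<lambda>n. zs (r n) k) \<longlonglongrightarrow> z k)"
  shows "\<exists>c. \<forall>t\<in>U. finite (zeros t) \<and> card (zeros t) = c"
proof -
  have slice: "z \<in> slice" if "z \<in> zeros t" for z t using that by (simp add: zeros_def)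
  \<comment> \<open>Properness for the constant sequence \<open>t\<close> makes infinitely many
    zeros accumulate at a zero, where local uniqueness allows only one.\<close>
  have fin: "finite (zeros t)" if t: "t \<in> U" for t
  proof (rule ccontr)
    assume "infinite (zeros t)"
    then obtain f :: "nat \<Rightarrow> 'z \<Rightarrow> complex" where f: "inj f" "range f \<subseteq> zeros t"
      using infinite_countable_subset by blast
    then have fz: "f n \<in> zeros t" for n by blast
    from proper[OF t tendsto_const t, of f, OF fz] obtain r z where
      r: "strict_mono (r :: nat \<Rightarrow> nat)" "z \<in> zeros t" "\<forall>k\<in>Y. (\<lambda>n. f (r n) k) \<longlonglongrightarrow> z k" by blast
    obtain \<eta> where \<eta>: "\<eta> > 0" "\<forall>\<rho>. 0 < \<rho> \<and> \<rho> \<le> \<eta> \<longrightarrow>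
      (\<exists>\<epsilon>>0. \<forall>t'. cmod (t' - t) < \<epsilon> \<longrightarrow> (\<exists>!w. w \<in> zeros t' \<and> l1 Y w z \<le> \<rho>))"
      using unique_nearby_zero[OF r(2) nd[OF t r(2)]] by blast
    then obtain \<epsilon> where "\<epsilon> > 0" "\<forall>t'. cmod (t' - t) < \<epsilon> \<longrightarrow> (\<exists>!w. w \<in> zeros t' \<and> l1 Y w z \<le> \<eta>)"
      by blast
    then have ex1: "\<exists>!w. w \<in> zeros t \<and> l1 Y w z \<le> \<eta>" by simp
    have "(\<lambda>n. l1 Y (f (r n)) z) \<longlonglongrightarrow> l1 Y z z" by (rule l1_tendsto) (use r in auto)
    then have "\<forall>\<^sub>F n in sequentially. l1 Y (f (r n)) z < \<eta>"
      using \<eta>(1) by (intro order_tendstoD) auto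
    then obtain m where m: "\<And>n. n \<ge> m \<Longrightarrow> l1 Y (f (r n)) z < \<eta>"
      unfolding eventually_sequentially by blast
    have "f (r m) = f (r (Suc m))" using ex1 m[of m] m[of "Suc m"] f(2)
      by (metis le_SucI less_imp_le order_refl rangeI subsetD)
    then have "r m = r (Suc m)" using f(1) by (simp add: inj_eq)
    then show False using strict_monoD[OF r(1), of m "Suc m"] by simp
  qed
  have loc: "\<exists>T. openin (top_of_set U) T \<and> t1 \<in> T \<and> (\<forall>t\<in>T. card (zeros t) = card (zeros t1))"
    if t1: "t1 \<in> U" for t1
  proof -
    let ?Z = "zeros t1"
    have "\<exists>\<eta>>0. \<forall>z\<in>?Z. \<forall>\<rho>. 0 < \<rho> \<and> \<rho> \<le> \<eta> \<longrightarrow>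
      (\<exists>\<epsilon>>0. \<forall>t. cmod (t - t1) < \<epsilon> \<longrightarrow> (\<exists>!w. w \<in> zeros t \<and> l1 Y w z \<le> \<rho>))"
    proof (rule finite_common_positive[OF fin[OF t1]])
      fix z assume "z \<in> ?Z"
      then show "\<exists>\<eta>>0. \<forall>\<rho>. 0 < \<rho> \<and> \<rho> \<le> \<eta> \<longrightarrow>
        (\<exists>\<epsilon>>0. \<forall>t. cmod (t - t1) < \<epsilon> \<longrightarrow> (\<exists>!w. w \<in> zeros t \<and> l1 Y w z \<le> \<rho>))"
        by (intro unique_nearby_zero nd[OF t1])
    next
      fix z and \<eta> \<eta>' :: real
      assume "\<forall>\<rho>. 0 < \<rho> \<and> \<rho> \<le> \<eta> \<longrightarrow>
        (\<exists>\<epsilon>>0. \<forall>t. cmod (t - t1) < \<epsilon> \<longrightarrow> (\<exists>!w. w \<in> zeros t \<and> l1 Y w z \<le> \<rho>))" "\<eta>' \<le> \<eta>"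
      then show "\<forall>\<rho>. 0 < \<rho> \<and> \<rho> \<le> \<eta>' \<longrightarrow>
        (\<exists>\<epsilon>>0. \<forall>t. cmod (t - t1) < \<epsilon> \<longrightarrow> (\<exists>!w. w \<in> zeros t \<and> l1 Y w z \<le> \<rho>))"
        by (meson order_trans)
    qed
    then obtain \<eta> where "\<eta> > 0 \<and> (\<forall>z\<in>?Z. \<forall>\<rho>. 0 < \<rho> \<and> \<rho> \<le> \<eta> \<longrightarrow>
      (\<exists>\<epsilon>>0. \<forall>t. cmod (t - t1) < \<epsilon> \<longrightarrow> (\<exists>!w. w \<in> zeros t \<and> l1 Y w z \<le> \<rho>)))" by (rule exE)
    then have \<eta>: "\<eta> > 0" "\<And>z \<rho>. z \<in> ?Z \<Longrightarrow> 0 < \<rho> \<Longrightarrow> \<rho> \<le> \<eta> \<Longrightarrow>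
      \<exists>\<epsilon>>0. \<forall>t. cmod (t - t1) < \<epsilon> \<longrightarrow> (\<exists>!w. w \<in> zeros t \<and> l1 Y w z \<le> \<rho>)" by simp_all
    let ?P = "{p \<in> ?Z \<times> ?Z. fst p \<noteq> snd p}"
    \<comment> \<open>Balls of a radius below half of the smallest distance are disjoint, so
      distinct zeros have distinct continuations.\<close>
    have "\<exists>\<sigma>>0. \<forall>p\<in>?P. 2 * \<sigma> < l1 Y (fst p) (snd p)"
    proof (rule finite_common_positive)
      show "finite ?P" using finite_cartesian_product[OF fin[OF t1] fin[OF t1]] by simp
      fix p assume p: "p \<in> ?P"
      then have "fst p \<in> slice" "snd p \<in> slice" "fst p \<noteq> snd p" using slice by auto
      then have "l1 Y (fst p) (snd p) \<noteq> 0" using slice_eqI by blast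
      then have "l1 Y (fst p) (snd p) > 0" using l1_nonneg[of Y "fst p" "snd p"] by linarith
      then show "\<exists>\<sigma>>0. 2 * \<sigma> < l1 Y (fst p) (snd p)"
        by (intro exI[of _ "l1 Y (fst p) (snd p) / 3"]) auto
    qed auto
    then obtain \<sigma> where \<sigma>0: "\<sigma> > 0" "\<forall>p\<in>?P. 2 * \<sigma> < l1 Y (fst p) (snd p)" by blast
    have \<sigma>: "2 * \<sigma> < l1 Y z w" if "z \<in> ?Z" "w \<in> ?Z" "z \<noteq> w" for z w
      using bspec[OF \<sigma>0(2), of "(z, w)"] that by auto
    define \<rho> where "\<rho> = min \<eta> \<sigma>"
    have \<rho>: "0 < \<rho>" "\<rho> \<le> \<eta>" "\<rho> \<le> \<sigma>" using \<eta>(1) \<sigma>0(1) by (auto simp: \<rho>_def)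
    have "\<exists>\<epsilon>>0. \<forall>z\<in>?Z. \<forall>t. cmod (t - t1) < \<epsilon> \<longrightarrow> (\<exists>!w. w \<in> zeros t \<and> l1 Y w z \<le> \<rho>)"
    proof (rule finite_common_positive[OF fin[OF t1]])
      show "\<exists>\<epsilon>>0. \<forall>t. cmod (t - t1) < \<epsilon> \<longrightarrow> (\<exists>!w. w \<in> zeros t \<and> l1 Y w z \<le> \<rho>)" if "z \<in> ?Z" for z
        by (rule \<eta>(2)[OF that \<rho>(1,2)])
    next
      fix z and \<epsilon> \<epsilon>' :: real
      assume "\<forall>t. cmod (t - t1) < \<epsilon> \<longrightarrow> (\<exists>!w. w \<in> zeros t \<and> l1 Y w z \<le> \<rho>)" "\<epsilon>' \<le> \<epsilon>"
      then show "\<forall>t. cmod (t - t1) < \<epsilon>' \<longrightarrow> (\<exists>!w. w \<in> zeros t \<and> l1 Y w z \<le> \<rho>)"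
        by simp
    qed
    then obtain \<epsilon>1 where "\<epsilon>1 > 0 \<and> (\<forall>z\<in>?Z. \<forall>t. cmod (t - t1) < \<epsilon>1 \<longrightarrow>
      (\<exists>!w. w \<in> zeros t \<and> l1 Y w z \<le> \<rho>))" by (rule exE)
    then have \<epsilon>1: "\<epsilon>1 > 0" "\<And>z t. z \<in> ?Z \<Longrightarrow> cmod (t - t1) < \<epsilon>1 \<Longrightarrow>
      \<exists>!w. w \<in> zeros t \<and> l1 Y w z \<le> \<rho>" by simp_all
    \<comment> \<open>Otherwise zeros for parameters tending to \<open>t1\<close> would stay away
      from all zeros at \<open>t1\<close>, whereas a subsequence must converge to one of
      them.\<close>
    have "\<exists>\<epsilon>>0. \<forall>t\<in>U. cmod (t - t1) < \<epsilon> \<longrightarrow> (\<forall>w\<in>zeros t. \<exists>z\<in>?Z. l1 Y w z \<le> \<rho>)"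
    proof (rule ccontr)
      assume neg: "\<not> ?thesis"
      have "\<exists>t w. t \<in> U \<and> cmod (t - t1) < inverse (real (Suc n)) \<and> w \<in> zeros t \<and> (\<forall>z\<in>?Z. \<rho> < l1 Y w z)" for n
      proof -
        have "inverse (real (Suc n)) > 0" by simp
        with neg show ?thesis by (meson not_le)
      qed
      then obtain ts ws where ts: "\<And>n. ts n \<in> U" "\<And>n. cmod (ts n - t1) < inverse (real (Suc n))"
        "\<And>n. ws n \<in> zeros (ts n)" "\<And>n z. z \<in> ?Z \<Longrightarrow> \<rho> < l1 Y (ws n) z" by metis
      have "ts \<longlonglongrightarrow> t1"
      proof (rule Lim_transform_bound[where g = "\<lambda>n. inverse (real (Suc n))", THEN LIM_zero_cancel])
        show "\<forall>\<^sub>F n in sequentially. norm (ts n - t1) \<le> norm (inverse (real (Suc n)))"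
          using ts(2) by (intro always_eventually allI) (simp add: less_imp_le)
      qed (rule LIMSEQ_inverse_real_of_nat)
      from proper[OF t1 this ts(1,3)] obtain r z where
        r: "strict_mono (r :: nat \<Rightarrow> nat)" "z \<in> ?Z" "\<forall>k\<in>Y. (\<lambda>n. ws (r n) k) \<longlonglongrightarrow> z k" by blast
      have "(\<lambda>n. l1 Y (ws (r n)) z) \<longlonglongrightarrow> l1 Y z z" by (rule l1_tendsto) (use r in auto)
      then have "\<forall>\<^sub>F n in sequentially. l1 Y (ws (r n)) z < \<rho>"
        using \<rho>(1) by (intro order_tendstoD) auto
      then obtain n where "l1 Y (ws (r n)) z < \<rho>" unfolding eventually_sequentially by blast
      then show False using ts(4)[OF r(2), of "r n"] by simp
    qed
    then obtain \<epsilon>2 where \<epsilon>2: "\<epsilon>2 > 0" "\<And>t w. t \<in> U \<Longrightarrow> cmod (t - t1) < \<epsilon>2 \<Longrightarrow> w \<in> zeros t \<Longrightarrow>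
      \<exists>z\<in>?Z. l1 Y w z \<le> \<rho>" by blast
    have "card (zeros t) = card ?Z" if t: "t \<in> U" "cmod (t - t1) < min \<epsilon>1 \<epsilon>2" for t
    proof -
      define g where "g z = (THE w. w \<in> zeros t \<and> l1 Y w z \<le> \<rho>)" for z
      have g: "g z \<in> zeros t" "l1 Y (g z) z \<le> \<rho>" if "z \<in> ?Z" for z
      proof -
        have "\<exists>!w. w \<in> zeros t \<and> l1 Y w z \<le> \<rho>" by (rule \<epsilon>1(2)[OF that]) (use t in simp)
        from theI'[OF this] show "g z \<in> zeros t" "l1 Y (g z) z \<le> \<rho>" by (simp_all add: g_def)
      qed
      have "inj_on g ?Z"
      proof (rule inj_onI, rule ccontr)
        fix z w assume zw: "z \<in> ?Z" "w \<in> ?Z" "g z = g w" "z \<noteq> w"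
        have "l1 Y z w \<le> l1 Y z (g z) + l1 Y (g z) w" by (rule l1_triangle)
        also have "\<dots> \<le> 2 * \<rho>" using g(2)[OF zw(1)] g(2)[OF zw(2)] zw(3) l1_commute[of Y z "g z"] by simp
        also have "\<dots> < l1 Y z w" using \<sigma>[OF zw(1,2,4)] \<rho>(3) by simp
        finally show False by simp
      qed
      moreover have "g ` ?Z = zeros t"
      proof (intro equalityI subsetI)
        fix w assume w: "w \<in> zeros t"
        then obtain z where z: "z \<in> ?Z" "l1 Y w z \<le> \<rho>" using \<epsilon>2(2)[OF t(1)] t(2) by auto
        have "\<exists>!w. w \<in> zeros t \<and> l1 Y w z \<le> \<rho>" by (rule \<epsilon>1(2)[OF z(1)]) (use t in simp)
        then have "w = g z" using w z(2) g[OF z(1)] by blast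
        then show "w \<in> g ` ?Z" using z(1) by blast
      qed (use g in auto)
      ultimately show ?thesis using card_image by metis
    qed
    then have "\<forall>t\<in>U \<inter> ball t1 (min \<epsilon>1 \<epsilon>2). card (zeros t) = card ?Z"
      by (auto simp: dist_norm norm_minus_commute)
    moreover have "openin (top_of_set U) (U \<inter> ball t1 (min \<epsilon>1 \<epsilon>2))" by (simp add: openin_open_Int)
    moreover have "t1 \<in> U \<inter> ball t1 (min \<epsilon>1 \<epsilon>2)" using t1 \<epsilon>1(1) \<epsilon>2(1) by simp
    ultimately show ?thesis by (intro exI[of _ "U \<inter> ball t1 (min \<epsilon>1 \<epsilon>2)"] conjI)
  qed
  have "(\<lambda>t. card (zeros t)) constant_on U"
    by (rule locally_constant_imp_constant[OF U(2) loc])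
  then obtain c where "\<forall>t\<in>U. card (zeros t) = c" unfolding constant_on_def by (rule exE)
  then show ?thesis using fin by (intro exI[of _ c]) simp
qed

end

section \<open>Conservation of number for multihomogeneous systems\<close>

lemma ambient_case_sum:
  "case_sum f g \<in> ambient (Inl ` A \<union> Inr ` B) \<longleftrightarrow> f \<in> ambient A \<and> g \<in> ambient B"
proof -
  have "Inl a \<in> Inl ` A \<union> Inr ` B \<longleftrightarrow> a \<in> A" "Inr b \<in> Inl ` A \<union> Inr ` B \<longleftrightarrow> b \<in> B" for a b
    by auto
  then show ?thesis unfolding ambient_def mem_Collect_eq split_sum_all by simp
qed

lemma ambient_case_sum_0: "case_sum f (\<lambda>_. 0) \<in> ambient (Inl ` A) \<longleftrightarrow> f \<in> ambient A"
  using ambient_case_sum[of f "\<lambda>_. 0" A "{}"] by (simp add: ambient_def)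

text \<open>Elimination leaves a closed set in the sum type, with no variables of the second kind;
  this transports it to the type of the remaining variables.\<close>

lemma zariski_closed_Inl:
  fixes S :: "('k + 'l \<Rightarrow> complex) set"
  assumes "zariski_closed (Inl ` K) S"
  shows "zariski_closed K {x. case_sum x (\<lambda>_. 0) \<in> S}"
proof (rule zariski_closedI)
  show "{x. case_sum x (\<lambda>_. 0) \<in> S} \<subseteq> ambient K"
    using zariski_closedD(1)[OF assms] ambient_case_sum_0 by blast
  fix x assume "x \<in> ambient K" "x \<notin> {x. case_sum x (\<lambda>_. 0) \<in> S}"
  then have "case_sum x (\<lambda>_. 0) \<in> ambient (Inl ` K)" "case_sum x (\<lambda>_::'l. 0) \<notin> S"
    by (simp_all add: ambient_case_sum_0)
  then obtain h where h: "h \<in> polyfun (Inl ` K)" "\<forall>z\<in>S. h z = 0" "h (case_sum x (\<lambda>_. 0)) \<noteq> 0"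
    using zariski_closedD(2)[OF assms] by blast
  have "(\<lambda>x. h (case_sum x (\<lambda>_. 0))) \<in> polyfun K"
    by (rule polyfun_subst[OF h(1)]) (auto intro!: polyfun.var)
  then show "\<exists>h\<in>polyfun K. (\<forall>z\<in>{x. case_sum x (\<lambda>_. 0) \<in> S}. h z = 0) \<and> h x \<noteq> 0"
    using h by (intro bexI[of _ "\<lambda>x. h (case_sum x (\<lambda>_. 0))"]) simp_all
qed

text \<open>Each block \<open>blk b\<close> carries homogeneous coordinates of one projective space,
  with \<open>top b\<close> as the coordinate of an affine chart; \<open>card_eq\<close> says that
  there are as many equations as the product has dimensions. Homogeneity is only required as
  multiplication by a factor independent of parameters and point.\<close>

locale multihomogeneous_family =
  fixes PK :: "'p set" and V :: "'z set" and B :: "'b set" and blk :: "'b \<Rightarrow> 'z set" and top :: "'b \<Rightarrow> 'z"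
    and E :: "'e set" and F :: "'e \<Rightarrow> ('p \<Rightarrow> complex) \<Rightarrow> ('z \<Rightarrow> complex) \<Rightarrow> complex"
  assumes finP: "finite PK" and finV: "finite V" and finB: "finite B" and finE: "finite E"
    and V_eq: "V = (\<Union>b\<in>B. blk b)"
    and disj: "\<And>b c. b \<in> B \<Longrightarrow> c \<in> B \<Longrightarrow> b \<noteq> c \<Longrightarrow> blk b \<inter> blk c = {}"
    and top: "\<And>b. b \<in> B \<Longrightarrow> top b \<in> blk b"
    and card_eq: "card E + card B = card V"
    and polyF: "\<And>e. e \<in> E \<Longrightarrow> (\<lambda>x. F e (\<lambda>i. x (Inl i)) (\<lambda>k. x (Inr k))) \<in> polyfun (Inl ` PK \<union> Inr ` V)"
    and hom: "\<And>e b l. e \<in> E \<Longrightarrow> b \<in> B \<Longrightarrow> l \<noteq> 0 \<Longrightarrow> \<exists>c. \<forall>p z. F e p (scale (blk b) l z) = c * F e p z"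
begin

definition tops :: "'z set" where "tops = top ` B"

definition proj_zeros :: "('p \<Rightarrow> complex) \<Rightarrow> ('z \<Rightarrow> complex) set" where
  "proj_zeros p = {z \<in> ambient V. (\<forall>b\<in>B. \<exists>k\<in>blk b. z k \<noteq> 0) \<and> (\<forall>e\<in>E. F e p z = 0)}"

text \<open>Normalised top coordinates select one representative of each point of the chart, so that
  zeros can be counted.\<close>

definition chart_zeros :: "('p \<Rightarrow> complex) \<Rightarrow> ('z \<Rightarrow> complex) set" where
  "chart_zeros p = {z \<in> ambient V. (\<forall>b\<in>B. z (top b) = 1) \<and> (\<forall>e\<in>E. F e p z = 0)}"

definition nonzero_tops :: "('p \<Rightarrow> complex) \<Rightarrow> bool" where
  "nonzero_tops p \<longleftrightarrow> (\<forall>z\<in>proj_zeros p. \<forall>b\<in>B. z (top b) \<noteq> 0)"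

text \<open>Directions fixing all top coordinates represent the tangent space wherever these
  coordinates are nonzero. The condition ranges over all homogeneous representatives, which makes
  its failure invariant under scaling and hence accessible to elimination.\<close>

definition simple_zeros :: "('p \<Rightarrow> complex) \<Rightarrow> bool" where
  "simple_zeros p \<longleftrightarrow> (\<forall>z\<in>proj_zeros p. \<forall>v\<in>ambient (V - tops).
     (\<forall>e\<in>E. ((\<lambda>s. F e p (\<lambda>k. z k + s * v k)) has_field_derivative 0) (at 0)) \<longrightarrow> (\<forall>k. v k = 0))"

lemma blk_V: "b \<in> B \<Longrightarrow> blk b \<subseteq> V" using V_eq by blast

lemma tops_V: "tops \<subseteq> V" using V_eq top by (auto simp: tops_def)

lemma inj_top: "inj_on top B"
  using disj top by (metis disjoint_iff inj_onI)

lemma card_tops: "card tops = card B" by (simp add: tops_def card_image inj_top)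

lemma chart_proj: "chart_zeros p \<subseteq> proj_zeros p"
  using top by (force simp: chart_zeros_def proj_zeros_def)

lemma F_cong:
  assumes "e \<in> E" "\<And>i. i \<in> PK \<Longrightarrow> p i = p' i" "\<And>k. k \<in> V \<Longrightarrow> z k = z' k"
  shows "F e p z = F e p' z'"
proof -
  have "(\<lambda>x. F e (\<lambda>i. x (Inl i)) (\<lambda>k. x (Inr k))) (case_sum p z) =
    (\<lambda>x. F e (\<lambda>i. x (Inl i)) (\<lambda>k. x (Inr k))) (case_sum p' z')"
    by (rule polyfun_cong[OF polyF[OF assms(1)]]) (use assms in auto)
  then show ?thesis by simp
qed

lemma F_tendsto:
  assumes "e \<in> E" "\<And>i. i \<in> PK \<Longrightarrow> ((\<lambda>n. p n i) \<longlongrightarrow> p1 i) G" "\<And>k. k \<in> V \<Longrightarrow> ((\<lambda>n. z n k) \<longlongrightarrow> z1 k) G"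
  shows "((\<lambda>n. F e (p n) (z n)) \<longlongrightarrow> F e p1 z1) G"
proof -
  have "((\<lambda>n. (\<lambda>x. F e (\<lambda>i. x (Inl i)) (\<lambda>k. x (Inr k))) (case_sum (p n) (z n))) \<longlongrightarrow>
      (\<lambda>x. F e (\<lambda>i. x (Inl i)) (\<lambda>k. x (Inr k))) (case_sum p1 z1)) G"
    using assms by (intro polyfun_tendsto[OF polyF]) auto
  then show ?thesis by simp
qed

text \<open>Homogeneity is given one block at a time, so the scalars are applied in succession over
  a growing set of blocks.\<close>

lemma F_multiscale:
  assumes "e \<in> E" "F e p z = 0" "\<And>b. b \<in> B \<Longrightarrow> c b \<noteq> 0"
    "\<And>b k. b \<in> B \<Longrightarrow> k \<in> blk b \<Longrightarrow> w k = c b * z k"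
  shows "F e p w = 0"
proof -
  have "\<exists>w'. F e p w' = 0 \<and> (\<forall>b\<in>B. \<forall>k\<in>blk b. w' k = (if b \<in> C then c b * z k else z k))"
    if "C \<subseteq> B" for C
    using finite_subset[OF that finB] that
  proof (induction C)
    case empty
    then show ?case using assms(2) by (intro exI[of _ z]) auto
  next
    case (insert d C)
    then obtain w' where w': "F e p w' = 0" "\<forall>b\<in>B. \<forall>k\<in>blk b. w' k = (if b \<in> C then c b * z k else z k)"
      by auto
    have d: "d \<in> B" using insert by auto
    have "F e p (scale (blk d) (c d) w') = 0"
      using hom[OF assms(1) d assms(3)[OF d]] w'(1) by fastforce
    moreover have "scale (blk d) (c d) w' k = (if b \<in> insert d C then c b * z k else z k)"
      if "b \<in> B" "k \<in> blk b" for b k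
      using that w'(2) disj[OF that(1) d] insert.hyps by (cases "b = d") (auto simp: scale_def)
    ultimately show ?case by blast
  qed
  from this[OF order_refl] obtain w' where
    "F e p w' = 0" "\<forall>b\<in>B. \<forall>k\<in>blk b. w' k = c b * z k" by auto
  then have "F e p w' = F e p w"
    using assms(4) V_eq by (intro F_cong assms(1)) auto
  then show ?thesis using \<open>F e p w' = 0\<close> by simp
qed

text \<open>The parameters over which \<open>Z\<close> has a projective point form a closed set. As
  \<open>p0\<close> is outside, an equation of that set is nonzero at \<open>p0\<close>, and its
  nonvanishing excludes such points everywhere else.\<close>

lemma eliminate:
  assumes Z: "zariski_closed (Inl ` PK \<union> Inr ` V) Z"
    and con: "\<And>b z l. b \<in> B \<Longrightarrow> z \<in> Z \<Longrightarrow> l \<noteq> 0 \<Longrightarrow> scale (Inr ` blk b) l z \<in> Z"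
    and p0: "p0 \<in> ambient PK"
    and p0Z: "\<And>z. z \<in> ambient V \<Longrightarrow> \<forall>b\<in>B. \<exists>k\<in>blk b. z k \<noteq> 0 \<Longrightarrow> case_sum p0 z \<notin> Z"
  shows "\<exists>Q\<in>polyfun PK. Q p0 \<noteq> 0 \<and> (\<forall>p\<in>ambient PK. Q p \<noteq> 0 \<longrightarrow>
    (\<forall>z\<in>ambient V. (\<forall>b\<in>B. \<exists>k\<in>blk b. z k \<noteq> 0) \<longrightarrow> case_sum p z \<notin> Z))"
proof -
  let ?L = "Inl ` PK \<union> Inr ` V" and ?U = "(\<Union>b\<in>B. Inr ` blk b)"
  let ?T = "{x \<in> ambient (?L - ?U). \<exists>z\<in>Z. (\<forall>k. k \<notin> ?U \<longrightarrow> z k = x k) \<and> (\<forall>b\<in>B. \<exists>k\<in>Inr ` blk b. z k \<noteq> 0)}"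
  have LU: "?L - ?U = Inl ` PK" using V_eq by auto
  have T1: "zariski_closed (?L - ?U) ?T"
  proof (rule zariski_closed_multiproject[OF finB _ _ Z con])
    show "finite (Inr ` blk b) \<and> Inr ` blk b \<subseteq> ?L" if "b \<in> B" for b
      using blk_V[OF that] finV finite_subset by blast
    show "Inr ` blk b \<inter> Inr ` blk c = {}" if "b \<in> B" "c \<in> B" "b \<noteq> c" for b c
      using disj[OF that] by auto
  qed
  have T2: "case_sum p0 (\<lambda>_. 0) \<in> ambient (?L - ?U)"
    unfolding LU using p0 by (auto simp: ambient_def split: sum.splits)
  have T3: "case_sum p0 (\<lambda>_. 0) \<notin> ?T"
  proof
    assume "case_sum p0 (\<lambda>_. 0) \<in> ?T"
    then obtain z where z: "z \<in> Z" "\<forall>k. k \<notin> ?U \<longrightarrow> z k = case_sum p0 (\<lambda>_. 0) k"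
      "\<forall>b\<in>B. \<exists>k\<in>Inr ` blk b. z k \<noteq> 0" by blast
    have "z = case_sum p0 (\<lambda>k. z (Inr k))"
    proof
      fix k show "z k = case_sum p0 (\<lambda>k. z (Inr k)) k" using z(2) by (cases k) auto
    qed
    moreover have "(\<lambda>k. z (Inr k)) \<in> ambient V"
      unfolding ambient_def
    proof (intro CollectI allI impI)
      fix k assume "k \<notin> V"
      then have "Inr k \<notin> ?U" using V_eq by auto
      then show "z (Inr k) = 0" using z(2)[THEN spec, of "Inr k"] by (metis sum.case(2))
    qed
    ultimately show False using p0Z[of "\<lambda>k. z (Inr k)"] z(1,3) by auto
  qed
  obtain h where h: "h \<in> polyfun (?L - ?U)" "\<forall>z\<in>?T. h z = 0" "h (case_sum p0 (\<lambda>_. 0)) \<noteq> 0"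
    using zariski_closedD(2)[OF T1 T2 T3] by (elim bexE conjE)
  let ?Q = "\<lambda>p. h (case_sum p (\<lambda>_. 0))"
  have "?Q \<in> polyfun PK"
    by (rule polyfun_subst[OF h(1)]) (auto simp: LU intro!: polyfun.var)
  moreover have "case_sum p z \<notin> Z" if p: "p \<in> ambient PK" "?Q p \<noteq> 0"
    and z: "z \<in> ambient V" "\<forall>b\<in>B. \<exists>k\<in>blk b. z k \<noteq> 0" for p z
  proof
    assume "case_sum p z \<in> Z"
    moreover have "case_sum p (\<lambda>_. 0) \<in> ambient (?L - ?U)"
      unfolding LU using p by (auto simp: ambient_def split: sum.splits)
    moreover have "\<forall>k. k \<notin> ?U \<longrightarrow> case_sum p z k = case_sum p (\<lambda>_. 0) k"
      using z(1) V_eq by (auto simp: ambient_def split: sum.splits)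
    moreover have "\<forall>b\<in>B. \<exists>k\<in>Inr ` blk b. case_sum p z k \<noteq> 0" using z(2) by auto
    ultimately have "case_sum p (\<lambda>_. 0) \<in> ?T"
      by (intro CollectI conjI bexI[of _ "case_sum p z"])
    then show False using h(2) p(2) by blast
  qed
  ultimately show ?thesis using h(3) by (intro bexI[of _ ?Q]) auto
qed

text \<open>Zeros outside the chart are cut out by one more multihomogeneous equation, the product
  of all top coordinates, so the bad parameters can be eliminated.\<close>

lemma generic_nonzero_tops:
  assumes p0: "p0 \<in> ambient PK" "nonzero_tops p0"
  shows "\<exists>Q\<in>polyfun PK. Q p0 \<noteq> 0 \<and> (\<forall>p\<in>ambient PK. Q p \<noteq> 0 \<longrightarrow> nonzero_tops p)"
proof -
  let ?L = "Inl ` PK \<union> Inr ` V"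
  let ?F = "\<lambda>e x. F e (\<lambda>i. x (Inl i)) (\<lambda>k. x (Inr k))"
  let ?t = "\<lambda>x. \<Prod>b\<in>B. x (Inr (top b))"
  let ?Z = "{x \<in> ambient ?L. \<forall>q\<in>insert ?t (?F ` E). q x = 0}"
  have "?t \<in> polyfun ?L" using top blk_V by (intro polyfun_prod polyfun.var) blast
  then have Z: "zariski_closed ?L ?Z" using polyF by (intro zariski_closed_zeros) auto
  have con: "scale (Inr ` blk b) l x \<in> ?Z" if b: "b \<in> B" and x: "x \<in> ?Z" and l: "l \<noteq> 0" for b x l
  proof -
    have eq: "(\<lambda>i. scale (Inr ` blk b) l x (Inl i)) = (\<lambda>i. x (Inl i))"
      "(\<lambda>k. scale (Inr ` blk b) l x (Inr k)) = scale (blk b) l (\<lambda>k. x (Inr k))"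
      by (auto simp: scale_def)
    have "?F e (scale (Inr ` blk b) l x) = 0" if e: "e \<in> E" for e
      unfolding eq using hom[OF e b l] x e by auto
    moreover have "\<exists>b\<in>B. x (Inr (top b)) = 0" using x finB by auto
    then have "?t (scale (Inr ` blk b) l x) = 0" using finB by (auto simp: scale_def)
    ultimately show ?thesis using x scale_ambient by auto
  qed
  define Z0 where "Z0 = ?Z"
  have mem: "case_sum p z \<in> Z0 \<longleftrightarrow> (\<forall>e\<in>E. F e p z = 0) \<and> (\<exists>b\<in>B. z (top b) = 0)"
    if "p \<in> ambient PK" "z \<in> ambient V" for p z
    unfolding Z0_def using that finB by (auto simp: ambient_def split: sum.splits)
  have iff: "nonzero_tops p \<longleftrightarrow> (\<forall>z\<in>ambient V. (\<forall>b\<in>B. \<exists>k\<in>blk b. z k \<noteq> 0) \<longrightarrow> case_sum p z \<notin> Z0)"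
    if p: "p \<in> ambient PK" for p
    unfolding nonzero_tops_def proj_zeros_def using mem[OF p] by blast
  have "\<exists>Q\<in>polyfun PK. Q p0 \<noteq> 0 \<and> (\<forall>p\<in>ambient PK. Q p \<noteq> 0 \<longrightarrow>
    (\<forall>z\<in>ambient V. (\<forall>b\<in>B. \<exists>k\<in>blk b. z k \<noteq> 0) \<longrightarrow> case_sum p z \<notin> Z0))"
    by (rule eliminate[OF Z[folded Z0_def] con[folded Z0_def] p0(1)]) (use p0(2) iff[OF p0(1)] in auto)
  then show ?thesis using iff by simp
qed

text \<open>The divided differences on the diagonal are partial derivatives that are polynomial in
  parameters and point together, as elimination requires.\<close>

lemma partial_derivatives:
  assumes e: "e \<in> E"
  shows "\<exists>D. (\<forall>k. (\<lambda>x. D k (\<lambda>i. x (Inl i)) (\<lambda>k. x (Inr k))) \<in> polyfun (Inl ` PK \<union> Inr ` V)) \<and>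
    (\<forall>p z v. v \<in> ambient V \<longrightarrow>
      ((\<lambda>s. F e p (\<lambda>k. z k + s * v k)) has_field_derivative (\<Sum>k\<in>V. v k * D k p z)) (at 0))"
proof -
  let ?L = "Inl ` PK \<union> Inr ` V"
  let ?q = "\<lambda>x. F e (\<lambda>i. x (Inl i)) (\<lambda>k. x (Inr k))"
  let ?H = "\<lambda>D. (\<forall>k. (\<lambda>z. D k (z \<circ> Inl) (z \<circ> Inr)) \<in> polyfun (Inl ` ?L \<union> Inr ` ?L)) \<and>
    (\<forall>x y. ?q x - ?q y = (\<Sum>k\<in>?L. (x k - y k) * D k x y))"
  have finL: "finite ?L" using finP finV by simp
  have "\<exists>D. ?H D" by (rule polyfun_Hadamard[OF polyF[OF e] finL])
  then obtain D0 where "?H D0" by (rule exE)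
  then have D0: "\<And>k. (\<lambda>z. D0 k (z \<circ> Inl) (z \<circ> Inr)) \<in> polyfun (Inl ` ?L \<union> Inr ` ?L)"
    "\<And>x y. ?q x - ?q y = (\<Sum>k\<in>?L. (x k - y k) * D0 k x y)" by simp_all
  define D where "D k p z = D0 (Inr k) (case_sum p z) (case_sum p z)" for k p z
  show ?thesis
  proof (intro exI[of _ D] conjI allI impI)
    fix k
    have "(\<lambda>x. (\<lambda>z. D0 (Inr k) (z \<circ> Inl) (z \<circ> Inr)) (case_sum x x)) \<in> polyfun ?L"
      by (rule polyfun_subst[OF D0(1)]) (auto intro!: polyfun.var)
    moreover have "case_sum (\<lambda>i. x (Inl i)) (\<lambda>k. x (Inr k)) = x" for x :: "'p + 'z \<Rightarrow> complex"
      by (auto split: sum.splits)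
    ultimately show "(\<lambda>x. D k (\<lambda>i. x (Inl i)) (\<lambda>k. x (Inr k))) \<in> polyfun ?L"
      by (simp add: D_def comp_def)
  next
    fix p z v assume v: "v \<in> ambient V"
    have "((\<lambda>s. ?q (\<lambda>k. case_sum p z k + s * case_sum (\<lambda>_. 0) v k)) has_field_derivative
        (\<Sum>k\<in>?L. case_sum (\<lambda>_. 0) v k * D0 k (case_sum p z) (case_sum p z))) (at 0)"
      by (rule polyfun_directional_derivative[OF polyF[OF e] finL D0])
    moreover have "(\<Sum>k\<in>?L. case_sum (\<lambda>_. 0) v k * D0 k (case_sum p z) (case_sum p z)) = (\<Sum>k\<in>V. v k * D k p z)"
      using finP finV by (subst sum.union_disjoint) (auto simp: sum.reindex D_def)
    ultimately show "((\<lambda>s. F e p (\<lambda>k. z k + s * v k)) has_field_derivative (\<Sum>k\<in>V. v k * D k p z)) (at 0)"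
      by simp
  qed
qed

text \<open>A degenerate zero comes with a nonzero tangent vector on which the conditions are
  linear. Projecting the tangent vector away first gives a closed set of pairs of a parameter and a
  degenerate zero; the zero is eliminated next.\<close>

lemma generic_simple_zeros:
  assumes p0: "p0 \<in> ambient PK" "simple_zeros p0"
  shows "\<exists>Q\<in>polyfun PK. Q p0 \<noteq> 0 \<and> (\<forall>p\<in>ambient PK. Q p \<noteq> 0 \<longrightarrow> simple_zeros p)"
proof -
  let ?L = "Inl ` PK \<union> Inr ` V"
  let ?M = "Inl ` ?L \<union> Inr ` (V - tops)"
  let ?H = "\<lambda>e D. (\<forall>k. (\<lambda>x. D k (\<lambda>i. x (Inl i)) (\<lambda>k. x (Inr k))) \<in> polyfun ?L) \<and>
    (\<forall>p z v. v \<in> ambient V \<longrightarrow>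
      ((\<lambda>s. F e p (\<lambda>k. z k + s * v k)) has_field_derivative (\<Sum>k\<in>V. v k * D k p z)) (at 0))"
  define D where "D e = (SOME D. ?H e D)" for e
  have D: "?H e (D e)" if "e \<in> E" for e
    unfolding D_def by (rule someI_ex[OF partial_derivatives[OF that]])
  let ?P = "\<lambda>x i. x (Inl (Inl i))" and ?z = "\<lambda>x k. x (Inl (Inr k))" and ?v = "\<lambda>x k. x (Inr k)"
  define d where "d e p z v = (\<Sum>k\<in>V - tops. v k * D e k p z)" for e p z v
  have d: "((\<lambda>s. F e p (\<lambda>k. z k + s * v k)) has_field_derivative d e p z v) (at 0)"
    if "e \<in> E" "v \<in> ambient (V - tops)" for e p z v
  proof -
    have "v \<in> ambient V" using that by (auto simp: ambient_def)
    moreover have "(\<Sum>k\<in>V. v k * D e k p z) = d e p z v"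
      unfolding d_def using that(2) finV by (intro sum.mono_neutral_right) (auto simp: ambient_def)
    ultimately show ?thesis
      using conjunct2[OF D[OF that(1)], THEN spec, THEN spec, THEN spec, of v p z] by simp
  qed
  let ?Z = "{x \<in> ambient ?M. \<forall>q\<in>(\<lambda>e x. F e (?P x) (?z x)) ` E \<union> (\<lambda>e x. d e (?P x) (?z x) (?v x)) ` E. q x = 0}"
  have F_poly: "(\<lambda>x. F e (?P x) (?z x)) \<in> polyfun ?M" if "e \<in> E" for e
  proof -
    have "(\<lambda>x. (\<lambda>x. F e (\<lambda>i. x (Inl i)) (\<lambda>k. x (Inr k))) (\<lambda>i. x (Inl i))) \<in> polyfun ?M"
      by (rule polyfun_subst[OF polyF[OF that]]) (auto intro!: polyfun.var)
    then show ?thesis by simp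
  qed
  have D_poly: "(\<lambda>x. D e k (?P x) (?z x)) \<in> polyfun ?M" if "e \<in> E" for e k
  proof -
    have "(\<lambda>x. (\<lambda>x. D e k (\<lambda>i. x (Inl i)) (\<lambda>k. x (Inr k))) (\<lambda>i. x (Inl i))) \<in> polyfun ?M"
      by (rule polyfun_subst[OF conjunct1[OF D[OF that], THEN spec, of k]]) (auto intro!: polyfun.var)
    then show ?thesis by simp
  qed
  have "(\<lambda>x. d e (?P x) (?z x) (?v x)) \<in> polyfun ?M" if "e \<in> E" for e
    unfolding d_def using D_poly[OF that] by (intro polyfun_intros) auto
  then have Z: "zariski_closed ?M ?Z" using F_poly by (intro zariski_closed_zeros) auto
  let ?J = "Inr ` (V - tops)"
  define Z0 where "Z0 = ?Z"
  have mem: "x \<in> Z0 \<longleftrightarrow> x \<in> ambient ?M \<and> (\<forall>e\<in>E. F e (?P x) (?z x) = 0) \<and> (\<forall>e\<in>E. d e (?P x) (?z x) (?v x) = 0)" for x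
    by (simp add: Z0_def ball_Un)
  have conJ: "scale ?J l x \<in> Z0" if "x \<in> Z0" "l \<noteq> 0" for x l
  proof -
    have "d e (?P (scale ?J l x)) (?z (scale ?J l x)) (?v (scale ?J l x)) = l * d e (?P x) (?z x) (?v x)" for e
    proof -
      have "?P (scale ?J l x) = ?P x" "?z (scale ?J l x) = ?z x" by (auto simp: scale_def)
      moreover have "scale ?J l x (Inr k) = l * x (Inr k)" if "k \<in> V - tops" for k
        using that by (simp add: scale_def)
      ultimately show ?thesis by (simp add: d_def sum_distrib_left mult.assoc)
    qed
    moreover have "F e (?P (scale ?J l x)) (?z (scale ?J l x)) = F e (?P x) (?z x)" for e
      by (intro arg_cong2[of _ _ _ _ "F e"]) (auto simp: scale_def)
    moreover have "scale ?J l x \<in> ambient ?M" using that(1) unfolding mem by (intro scale_ambient) blast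
    ultimately show ?thesis using that(1) unfolding mem by simp
  qed
  have MJ: "?M - ?J = Inl ` ?L" by auto
  define W0 where "W0 = project ?M ?J Z0"
  have "zariski_closed (?M - ?J) W0"
    unfolding W0_def using finV by (intro zariski_closed_project Z[folded Z0_def] conJ) auto
  then have W0: "zariski_closed (Inl ` ?L) W0" unfolding MJ .
  define W where "W = {y. case_sum y (\<lambda>_::'z. 0) \<in> W0}"
  have W_mem: "case_sum p z \<in> W \<longleftrightarrow> (\<forall>e\<in>E. F e p z = 0) \<and>
      (\<exists>v\<in>ambient (V - tops). (\<exists>k. v k \<noteq> 0) \<and> (\<forall>e\<in>E. d e p z v = 0))" (is "?A \<longleftrightarrow> ?B")
    if pz: "p \<in> ambient PK" "z \<in> ambient V" for p z
  proof
    assume ?A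
    then obtain x where x: "x \<in> Z0" "\<forall>k. k \<notin> ?J \<longrightarrow> x k = case_sum (case_sum p z) (\<lambda>_. 0) k" "\<exists>k\<in>?J. x k \<noteq> 0"
      unfolding W_def W0_def project_def by auto
    have "?P x i = p i" for i using x(2)[THEN spec, of "Inl (Inl i)"] by auto
    moreover have "?z x k = z k" for k using x(2)[THEN spec, of "Inl (Inr k)"] by auto
    ultimately have "?P x = p" "?z x = z" by auto
    moreover have "?v x \<in> ambient (V - tops)" using x(2) by (auto simp: ambient_def)
    ultimately show ?B using x(1,3) unfolding mem by fastforce
  next
    assume ?B
    then obtain v where v: "v \<in> ambient (V - tops)" "\<exists>k. v k \<noteq> 0" "\<forall>e\<in>E. d e p z v = 0" by blast
    let ?x = "case_sum (case_sum p z) v"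
    have "?x \<in> Z0" unfolding mem using \<open>?B\<close> v pz by (simp add: ambient_case_sum)
    moreover have "case_sum (case_sum p z) (\<lambda>_. 0) \<in> ambient (?M - ?J)"
      unfolding MJ using pz by (simp add: ambient_case_sum ambient_case_sum_0)
    moreover have "\<forall>k. k \<notin> ?J \<longrightarrow> ?x k = case_sum (case_sum p z) (\<lambda>_. 0) k"
      using v(1) by (auto simp: ambient_def split: sum.splits)
    moreover have "\<exists>k\<in>?J. ?x k \<noteq> 0" using v(1,2) by (auto simp: ambient_def)
    ultimately show ?A unfolding W_def W0_def project_def mem_Collect_eq by blast
  qed
  have W: "zariski_closed ?L W" unfolding W_def by (rule zariski_closed_Inl[OF W0])
  then have W_amb: "y \<in> ambient ?L" if "y \<in> W" for y using zariski_closedD(1) that by blast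
  have split_x: "\<exists>p z. x = case_sum p z \<and> p \<in> ambient PK \<and> z \<in> ambient V" if "x \<in> ambient ?L" for x
    by (rule exI[of _ "\<lambda>i. x (Inl i)"], rule exI[of _ "\<lambda>k. x (Inr k)"])
      (use that in \<open>auto simp: ambient_def split: sum.splits\<close>)
  \<comment> \<open>Scaling \<open>z\<close> alone would not respect the derivative conditions.
    Scaling \<open>z\<close> and \<open>v\<close> in the same block multiplies the equation along
    the line by a constant, and so its derivative.\<close>
  have con: "scale (Inr ` blk b) l x \<in> W" if b: "b \<in> B" and x: "x \<in> W" and l: "l \<noteq> 0" for b x l
  proof -
    obtain p z where pz: "x = case_sum p z" "p \<in> ambient PK" "z \<in> ambient V" using split_x W_amb x by blast
    have eq: "scale (Inr ` blk b) l x = case_sum p (scale (blk b) l z)"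
      by (auto simp: scale_def pz(1) split: sum.splits)
    obtain v where v: "\<forall>e\<in>E. F e p z = 0" "v \<in> ambient (V - tops)" "\<exists>k. v k \<noteq> 0" "\<forall>e\<in>E. d e p z v = 0"
      using x W_mem pz by blast
    have sv: "scale (blk b) l v \<in> ambient (V - tops)" using v(2) by (rule scale_ambient)
    have "F e p (scale (blk b) l z) = 0 \<and> d e p (scale (blk b) l z) (scale (blk b) l v) = 0" if e: "e \<in> E" for e
    proof -
      obtain c where c: "\<And>p z. F e p (scale (blk b) l z) = c * F e p z" using hom[OF e b l] by blast
      have "((\<lambda>s. F e p (\<lambda>k. z k + s * v k)) has_field_derivative 0) (at 0)"
        using d[OF e v(2), of p z] v(4) e by simp
      then have "((\<lambda>s. c * F e p (\<lambda>k. z k + s * v k)) has_field_derivative c * 0) (at 0)"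
        by (rule DERIV_cmult)
      moreover have "(\<lambda>s. c * F e p (\<lambda>k. z k + s * v k)) =
          (\<lambda>s. F e p (\<lambda>k. scale (blk b) l z k + s * scale (blk b) l v k))"
        unfolding c[symmetric] by (intro ext arg_cong[of _ _ "F e p"]) (auto simp: scale_def algebra_simps)
      ultimately have "d e p (scale (blk b) l z) (scale (blk b) l v) = c * 0"
        using DERIV_unique[OF d[OF e sv, of p "scale (blk b) l z"]] by simp
      then show ?thesis using c v(1) e by simp
    qed
    moreover have "\<exists>k. scale (blk b) l v k \<noteq> 0" using v(3) l by (auto simp: scale_def)
    ultimately show ?thesis
      unfolding eq using W_mem[OF pz(2) scale_ambient[OF pz(3)]] sv by blast
  qed
  have W_simple: "simple_zeros p \<longleftrightarrow> (\<forall>z\<in>ambient V. (\<forall>b\<in>B. \<exists>k\<in>blk b. z k \<noteq> 0) \<longrightarrow> case_sum p z \<notin> W)"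
    if p: "p \<in> ambient PK" for p
  proof -
    have "((\<lambda>s. F e p (\<lambda>k. z k + s * v k)) has_field_derivative 0) (at 0) \<longleftrightarrow> d e p z v = 0"
      if "e \<in> E" "v \<in> ambient (V - tops)" for e z v
      using d[OF that] DERIV_unique by metis
    then show ?thesis
      unfolding simple_zeros_def proj_zeros_def using W_mem[OF p] by (simp add: Ball_def) blast
  qed
  have "\<exists>Q\<in>polyfun PK. Q p0 \<noteq> 0 \<and> (\<forall>p\<in>ambient PK. Q p \<noteq> 0 \<longrightarrow>
    (\<forall>z\<in>ambient V. (\<forall>b\<in>B. \<exists>k\<in>blk b. z k \<noteq> 0) \<longrightarrow> case_sum p z \<notin> W))"
    by (rule eliminate[OF W con p0(1)]) (use p0(2) W_simple[OF p0(1)] in auto)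
  then show ?thesis using W_simple by simp
qed

text \<open>Rescaling every block to norm 1 gives bounded representatives and a projective limit
  point. Its top coordinates are nonzero by assumption, so dividing by them recovers convergence of
  the normalised zeros.\<close>

lemma zeros_proper:
  assumes p1: "nonzero_tops p1"
    and ps: "\<And>i. i \<in> PK \<Longrightarrow> (\<lambda>n. ps n i) \<longlonglongrightarrow> p1 i" and zs: "\<And>n. zs n \<in> chart_zeros (ps n)"
  shows "\<exists>r z. strict_mono (r :: nat \<Rightarrow> nat) \<and> z \<in> chart_zeros p1 \<and> (\<forall>k\<in>V. (\<lambda>n. zs (r n) k) \<longlonglongrightarrow> z k)"
proof -
  define \<mu> where "\<mu> n b = (\<Sum>k\<in>blk b. cmod (zs n k))" for n b
  have fb: "finite (blk b)" if "b \<in> B" for b using blk_V[OF that] finV finite_subset by blast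
  have top1: "zs n (top b) = 1" if "b \<in> B" for n b using zs that by (simp add: chart_zeros_def)
  have le\<mu>: "cmod (zs n k) \<le> \<mu> n b" if "b \<in> B" "k \<in> blk b" for n b k
    unfolding \<mu>_def using fb that by (intro member_le_sum) auto
  have \<mu>1: "\<mu> n b \<ge> 1" if "b \<in> B" for n b using le\<mu>[OF that top[OF that], of n] top1[OF that] by simp
  have "\<exists>b\<in>B. k \<in> blk b" if "k \<in> V" for k using V_eq that by blast
  then obtain \<beta> where \<beta>: "\<And>k. k \<in> V \<Longrightarrow> \<beta> k \<in> B" "\<And>k. k \<in> V \<Longrightarrow> k \<in> blk (\<beta> k)" by metis
  have \<beta>b: "\<beta> k = b" if "b \<in> B" "k \<in> blk b" for b k
    using that \<beta>[of k] disj[of b "\<beta> k"] blk_V[OF that(1)] by blast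
  define w where "w n k = zs n k / of_real (\<mu> n (\<beta> k))" for n k
  have "cmod (w n k) \<le> 1" if "k \<in> V" for n k
    using le\<mu>[OF \<beta>(1)[OF that] \<beta>(2)[OF that], of n] \<mu>1[OF \<beta>(1)[OF that], of n]
    by (simp add: w_def norm_divide divide_le_eq)
  from bounded_pointwise_convergent_subseq[of V w 1, OF finV this] obtain r l where
    r: "strict_mono (r :: nat \<Rightarrow> nat)" and l: "\<And>k. k \<in> V \<Longrightarrow> (\<lambda>n. w (r n) k) \<longlonglongrightarrow> l k" by blast
  define u where "u k = (if k \<in> V then l k else 0)" for k
  have lim: "(\<lambda>n. w (r n) k) \<longlonglongrightarrow> u k" if "k \<in> V" for k using l[OF that] that by (simp add: u_def)
  have psr: "(\<lambda>n. ps (r n) i) \<longlonglongrightarrow> p1 i" if "i \<in> PK" for i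
    using LIMSEQ_subseq_LIMSEQ[OF ps[OF that] r] by (simp add: comp_def)
  have "F e p1 u = 0" if e: "e \<in> E" for e
  proof -
    have "F e (ps n) (w n) = 0" for n
    proof (rule F_multiscale[OF e, where z = "zs n" and c = "\<lambda>b. 1 / of_real (\<mu> n b)"])
      show "F e (ps n) (zs n) = 0" using zs e by (simp add: chart_zeros_def)
      show "1 / of_real (\<mu> n b) \<noteq> (0::complex)" if "b \<in> B" for b using \<mu>1[OF that, of n] by simp
      show "w n k = 1 / of_real (\<mu> n b) * zs n k" if "b \<in> B" "k \<in> blk b" for b k
        using \<beta>b[OF that] by (simp add: w_def)
    qed
    moreover have "(\<lambda>n. F e (ps (r n)) (w (r n))) \<longlonglongrightarrow> F e p1 u" by (intro F_tendsto e psr lim)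
    ultimately show ?thesis by (simp add: LIMSEQ_const_iff)
  qed
  moreover have "\<exists>k\<in>blk b. u k \<noteq> 0" if b: "b \<in> B" for b
  proof -
    have "(\<Sum>k\<in>blk b. cmod (w n k)) = 1" for n
    proof -
      have "(\<Sum>k\<in>blk b. cmod (w n k)) = (\<Sum>k\<in>blk b. cmod (zs n k) / \<mu> n b)"
        using \<beta>b[OF b] \<mu>1[OF b, of n] by (intro sum.cong) (auto simp: w_def norm_divide)
      also have "\<dots> = 1" using \<mu>1[OF b, of n] by (simp add: \<mu>_def flip: sum_divide_distrib)
      finally show ?thesis .
    qed
    moreover have "(\<lambda>n. \<Sum>k\<in>blk b. cmod (w (r n) k)) \<longlonglongrightarrow> (\<Sum>k\<in>blk b. cmod (u k))"
      using blk_V[OF b] by (intro tendsto_sum tendsto_norm lim) auto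
    ultimately have "(\<Sum>k\<in>blk b. cmod (u k)) = 1" by (simp add: LIMSEQ_const_iff)
    then show ?thesis by (metis norm_zero sum.neutral zero_neq_one)
  qed
  moreover have "u \<in> ambient V" by (simp add: u_def ambient_def)
  ultimately have "u \<in> proj_zeros p1" by (simp add: proj_zeros_def)
  then have ut: "u (top b) \<noteq> 0" if "b \<in> B" for b using p1 that by (simp add: nonzero_tops_def)
  define z where "z k = (if k \<in> V then u k / u (top (\<beta> k)) else 0)" for k
  have zlim: "(\<lambda>n. zs (r n) k) \<longlonglongrightarrow> z k" if k: "k \<in> V" for k
  proof -
    let ?t = "top (\<beta> k)"
    have b: "\<beta> k \<in> B" and t: "?t \<in> V" and bt: "\<beta> ?t = \<beta> k"
      using \<beta>(1)[OF k] top[OF \<beta>(1)[OF k]] blk_V[OF \<beta>(1)[OF k]] \<beta>b[OF \<beta>(1)[OF k] top[OF \<beta>(1)[OF k]]]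
      by auto
    have "(\<lambda>n. w (r n) k / w (r n) ?t) \<longlonglongrightarrow> u k / u ?t"
      using ut[OF b] by (intro tendsto_divide lim k t)
    moreover have "w n k / w n ?t = zs n k" for n
      using top1[OF b, of n] \<mu>1[OF b, of n] by (simp add: w_def bt)
    ultimately show ?thesis using k by (simp add: z_def)
  qed
  have "F e p1 z = 0" if e: "e \<in> E" for e
  proof -
    have "(\<lambda>n. F e (ps (r n)) (zs (r n))) \<longlonglongrightarrow> F e p1 z" by (intro F_tendsto e psr zlim)
    moreover have "F e (ps n) (zs n) = 0" for n using zs e by (simp add: chart_zeros_def)
    ultimately show ?thesis by (simp add: LIMSEQ_const_iff)
  qed
  moreover have "z (top b) = 1" if "b \<in> B" for b
    using that ut[OF that] \<beta>b[OF that top[OF that]] blk_V[OF that] top[OF that] by (auto simp: z_def)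
  moreover have "z \<in> ambient V" by (simp add: z_def ambient_def)
  ultimately have "z \<in> chart_zeros p1" by (simp add: chart_zeros_def)
  then show ?thesis using r zlim by blast
qed

theorem conservation_of_number:
  assumes p0: "p0 \<in> ambient PK" "nonzero_tops p0" "simple_zeros p0"
  shows "\<exists>Q\<in>polyfun PK. Q p0 \<noteq> 0 \<and> (\<forall>p\<in>ambient PK. Q p \<noteq> 0 \<longrightarrow>
    nonzero_tops p \<and> finite (chart_zeros p) \<and> card (chart_zeros p) = card (chart_zeros p0))"
proof -
  obtain Q1 where Q1: "Q1 \<in> polyfun PK" "Q1 p0 \<noteq> 0" "\<And>p. p \<in> ambient PK \<Longrightarrow> Q1 p \<noteq> 0 \<Longrightarrow> nonzero_tops p"
    using generic_nonzero_tops[OF p0(1,2)] by blast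
  obtain Q2 where Q2: "Q2 \<in> polyfun PK" "Q2 p0 \<noteq> 0" "\<And>p. p \<in> ambient PK \<Longrightarrow> Q2 p \<noteq> 0 \<Longrightarrow> simple_zeros p"
    using generic_simple_zeros[OF p0(1,3)] by blast
  define Q where "Q p = Q1 p * Q2 p" for p
  have Q: "Q \<in> polyfun PK" unfolding Q_def by (intro polyfun_intros Q1 Q2)
  have card: "finite (chart_zeros p1) \<and> card (chart_zeros p1) = card (chart_zeros p0)"
    if p1: "p1 \<in> ambient PK" "Q p1 \<noteq> 0" for p1
  proof -
    \<comment> \<open>\<open>Q\<close> is nonzero at both ends of this line, so only finitely many
      parameters are lost and neither 0 nor 1 is among them.\<close>
    define p where "p t i = p0 i + t * (p1 i - p0 i)" for t i
    have pa: "p t \<in> ambient PK" for t using p0(1) p1(1) by (auto simp: p_def ambient_def)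
    have p01: "p 0 = p0" "p 1 = p1" by (auto simp: p_def)
    obtain q where q: "\<And>t. Q (p t) = poly q t"
      unfolding p_def using polyfun_line[OF Q, of p0 "\<lambda>i. p1 i - p0 i"] by blast
    have "q \<noteq> 0" using q[of 1] p01 p1(2) by auto
    then have fin: "finite {t. poly q t = 0}" by (rule poly_roots_finite)
    define U where "U = UNIV - {t. poly q t = 0}"
    have U: "open U" "connected U"
    proof -
      show "open U" unfolding U_def using fin by (intro open_Diff open_UNIV finite_imp_closed)
      show "connected U" unfolding U_def
        using fin by (intro connected_open_delete_finite) auto
    qed
    have good: "nonzero_tops (p t)" "simple_zeros (p t)" if "t \<in> U" for t
    proof -
      have "Q1 (p t) * Q2 (p t) \<noteq> 0" using that q[of t] by (simp add: U_def Q_def)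
      then show "nonzero_tops (p t)" "simple_zeros (p t)" using Q1(3)[OF pa] Q2(3)[OF pa] by simp_all
    qed
    have "0 \<in> U" "1 \<in> U" using q[of 0] q[of 1] p01 Q1(2) Q2(2) p1(2) by (auto simp: U_def Q_def)
    define z0 where "z0 k = (if k \<in> tops then 1 else 0 :: complex)" for k
    interpret slice_system "V - tops" V z0 E "\<lambda>e t. F e (p t)"
    proof
      show "card E = card (V - tops)"
        using card_eq card_tops tops_V finV by (simp add: card_Diff_subset finite_subset)
      fix e assume e: "e \<in> E"
      have "(\<lambda>x. (\<lambda>x. F e (\<lambda>i. x (Inl i)) (\<lambda>k. x (Inr k))) (case_sum (p (x None)) (\<lambda>k. x (Some k))))
          \<in> polyfun (insert None (Some ` V))"
      proof (rule polyfun_subst[OF polyF[OF e]])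
        fix k assume "k \<in> Inl ` PK \<union> Inr ` V"
        then show "(\<lambda>x. case_sum (p (x None)) (\<lambda>k. x (Some k)) k) \<in> polyfun (insert None (Some ` V))"
          by (auto simp: p_def intro!: polyfun.add polyfun.mult polyfun.const polyfun.var)
      qed
      then show "(\<lambda>x. F e (p (x None)) (\<lambda>k. x (Some k))) \<in> polyfun (insert None (Some ` V))" by simp
    qed (use finV finE in auto)
    have slice_iff: "z \<in> slice \<longleftrightarrow> z \<in> ambient V \<and> (\<forall>b\<in>B. z (top b) = 1)" for z
    proof
      assume z: "z \<in> slice"
      have "z k = 0" if "k \<notin> V" for k using z that tops_V by (auto simp: slice_def z0_def)
      moreover have "z (top b) = 1" if "b \<in> B" for b
      proof -
        have "top b \<in> tops" using that by (simp add: tops_def)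
        then show ?thesis using z by (simp add: slice_def z0_def)
      qed
      ultimately show "z \<in> ambient V \<and> (\<forall>b\<in>B. z (top b) = 1)" by (auto simp: ambient_def)
    next
      assume z: "z \<in> ambient V \<and> (\<forall>b\<in>B. z (top b) = 1)"
      then have "z k = 1" if "k \<in> tops" for k using that by (auto simp: tops_def)
      then show "z \<in> slice" using z by (simp add: slice_def z0_def ambient_def)
    qed
    have zeros: "zeros t = chart_zeros (p t)" for t
      unfolding zeros_def chart_zeros_def using slice_iff by blast
    have "\<exists>c. \<forall>t\<in>U. finite (zeros t) \<and> card (zeros t) = c"
    proof (rule card_zeros_constant[OF U])
      fix t z assume t: "t \<in> U" and z: "z \<in> zeros t"
      then have "z \<in> proj_zeros (p t)" using chart_proj zeros by blast
      then show "nondegenerate t z"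
        using good(2)[OF t] unfolding nondegenerate_def simple_zeros_def by blast
    next
      fix ts t zs assume t: "t \<in> U" and ts: "ts \<longlonglongrightarrow> t" and zs: "\<And>n. zs n \<in> zeros (ts n)"
      have "(\<lambda>n. p (ts n) i) \<longlonglongrightarrow> p t i" for i unfolding p_def by (intro tendsto_intros ts)
      from zeros_proper[OF good(1)[OF t] this, of zs, OF zs[unfolded zeros]]
      obtain r z where "strict_mono (r :: nat \<Rightarrow> nat)" "z \<in> chart_zeros (p t)"
        "\<forall>k\<in>V. (\<lambda>n. zs (r n) k) \<longlonglongrightarrow> z k" by (elim exE conjE)
      then show "\<exists>r z. strict_mono (r :: nat \<Rightarrow> nat) \<and> z \<in> zeros t \<and> (\<forall>k\<in>V - tops. (\<lambda>n. zs (r n) k) \<longlonglongrightarrow> z k)"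
        unfolding zeros by (intro exI[of _ r] exI[of _ z]) simp
    qed
    then obtain c where "\<forall>t\<in>U. finite (zeros t) \<and> card (zeros t) = c" by (rule exE)
    from bspec[OF this \<open>0 \<in> U\<close>] bspec[OF this \<open>1 \<in> U\<close>] show ?thesis by (simp add: zeros p01)
  qed
  show ?thesis
  proof (rule bexI[OF _ Q], intro conjI ballI impI)
    show "Q p0 \<noteq> 0" using Q1(2) Q2(2) by (simp add: Q_def)
    fix p assume p: "p \<in> ambient PK" "Q p \<noteq> 0"
    then show "nonzero_tops p" by (intro Q1(3)) (simp_all add: Q_def)
    show "finite (chart_zeros p)" "card (chart_zeros p) = card (chart_zeros p0)"
      using card[OF p] by simp_all
  qed
qed

end

section \<open>The Nash resultant variety: irreducibility and dimension\<close>

text \<open>Expansion of a product over profiles. The exponent function is free because strategies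
  are read as coefficients in increasing order for the strictness of the chain and in decreasing
  order for the degree.\<close>

lemma prod_sum_monom:
  fixes \<pi> :: "nat \<Rightarrow> nat \<Rightarrow> complex"
  shows "(\<Prod>l<r. \<Sum>j<d l. monom (\<pi> l j) (f l j)) =
    (\<Sum>J\<in>profiles r d. monom (\<Prod>l<r. \<pi> l (J l)) (\<Sum>l<r. f l (J l)))"
proof -
  have m: "(\<Prod>l\<in>S. monom (\<pi> l (J l)) (f l (J l))) = monom (\<Prod>l\<in>S. \<pi> l (J l)) (\<Sum>l\<in>S. f l (J l))"
    if "finite S" for S J
    using that by (induction S) (simp_all add: mult_monom)
  have "(\<Prod>l<r. \<Sum>j<d l. monom (\<pi> l j) (f l j)) =
      (\<Sum>J\<in>PiE {..<r} (\<lambda>l. {..<d l}). \<Prod>l<r. monom (\<pi> l (J l)) (f l (J l)))"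
    by (rule prod_sum_PiE) auto
  then show ?thesis by (simp add: m profiles_def)
qed

text \<open>There are \<open>Suc r\<close> players, and the one with the many strategies has index
  \<open>r\<close>. Profiles \<open>J\<close> of the other players extend to full profiles as
  \<open>J(r := k)\<close>.\<close>

locale nash =
  fixes r :: nat and d :: "nat \<Rightarrow> nat"
  assumes r1: "r \<ge> 1" and d2: "\<And>i. i \<le> r \<Longrightarrow> d i \<ge> 2" and big: "d r - 1 > (\<Sum>i<r. d i - 1)"
begin

definition P :: "(nat \<Rightarrow> nat) set" where "P = profiles r d"

abbreviation K :: "(nat \<times> (nat \<Rightarrow> nat)) set" where "K \<equiv> game_index (Suc r) d"

definition zero_profile :: "nat \<Rightarrow> nat" where "zero_profile = (\<lambda>l. if l < r then 0 else undefined)"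

definition T :: "(nat \<Rightarrow> nat \<Rightarrow> complex) \<Rightarrow> (nat \<Rightarrow> nat) \<Rightarrow> complex" where
  "T \<pi> J = (\<Prod>l<r. \<pi> l (J l))"

definition A :: "(nat \<times> (nat \<Rightarrow> nat) \<Rightarrow> complex) \<Rightarrow> nat \<Rightarrow> (nat \<Rightarrow> nat) \<Rightarrow> complex" where
  "A X k J = X (r, J(r := 0)) - X (r, J(r := k))"

definition form :: "(nat \<times> (nat \<Rightarrow> nat) \<Rightarrow> complex) \<Rightarrow> (nat \<Rightarrow> nat \<Rightarrow> complex) \<Rightarrow> nat \<Rightarrow> complex" where
  "form X \<pi> k = (\<Sum>J\<in>P. A X k J * T \<pi> J)"

section \<open>Profiles and the equations of the last player\<close>

lemma finite_P: "finite P" by (simp add: P_def profiles_def finite_PiE)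

lemma finite_K: "finite K" by (simp add: game_index_def profiles_def finite_PiE)

lemma P_D: "J \<in> P \<Longrightarrow> l < r \<Longrightarrow> J l < d l" by (auto simp: P_def profiles_def)

lemma P_r: "J \<in> P \<Longrightarrow> l \<ge> r \<Longrightarrow> J l = undefined"
  by (auto simp: P_def profiles_def PiE_iff extensional_def)

lemma P_eqI:
  assumes "J \<in> P" "J' \<in> P" "\<And>l. l < r \<Longrightarrow> J l = J' l"
  shows "J = J'"
proof
  fix l show "J l = J' l"
    using assms(3)[of l] P_r[OF assms(1), of l] P_r[OF assms(2), of l] by (cases "l < r") simp_all
qed

lemma P_I: "(\<And>l. l < r \<Longrightarrow> J l < d l) \<Longrightarrow> (\<And>l. l \<ge> r \<Longrightarrow> J l = undefined) \<Longrightarrow> J \<in> P"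
  by (auto simp: P_def profiles_def PiE_iff extensional_def)

lemma zero_profile_P: "zero_profile \<in> P"
proof (rule P_I)
  show "zero_profile l < d l" if "l < r" for l using that d2[of l] by (simp add: zero_profile_def)
qed (simp add: zero_profile_def)

lemma upd_inj: "J \<in> P \<Longrightarrow> J' \<in> P \<Longrightarrow> J(r := k) = J'(r := k') \<longleftrightarrow> J = J' \<and> k = k'"
proof
  assume J: "J \<in> P" "J' \<in> P" and eq: "J(r := k) = J'(r := k')"
  have "J l = J' l" if "l < r" for l using fun_cong[OF eq, of l] that by simp
  then have "J = J'" using J P_eqI by blast
  then show "J = J' \<and> k = k'" using fun_cong[OF eq, of r] by simp
qed simp

lemma profiles_Suc: "profiles (Suc r) d = (\<lambda>(k, J). J(r := k)) ` ({..<d r} \<times> P)"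
  unfolding profiles_def P_def lessThan_Suc PiE_insert_eq by simp

lemma upd_profile: "J \<in> P \<Longrightarrow> k < d r \<Longrightarrow> J(r := k) \<in> profiles (Suc r) d"
  unfolding profiles_Suc by force

lemma upd_K: "J \<in> P \<Longrightarrow> k < d r \<Longrightarrow> (r, J(r := k)) \<in> K"
  using upd_profile by (simp add: game_index_def)

lemma profiles_fibre: "k < d r \<Longrightarrow> {j \<in> profiles (Suc r) d. j r = k} = (\<lambda>J. J(r := k)) ` P"
  unfolding profiles_Suc by force

lemma T_cong: "J \<in> P \<Longrightarrow> (\<And>l j. l < r \<Longrightarrow> j < d l \<Longrightarrow> \<pi> l j = \<rho> l j) \<Longrightarrow> T \<pi> J = T \<rho> J"
  unfolding T_def by (intro prod.cong) (auto dest: P_D)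

lemma form_cong: "(\<And>l j. l < r \<Longrightarrow> j < d l \<Longrightarrow> \<pi> l j = \<rho> l j) \<Longrightarrow> form X \<pi> k = form X \<rho> k"
proof -
  assume "\<And>l j. l < r \<Longrightarrow> j < d l \<Longrightarrow> \<pi> l j = \<rho> l j"
  then have "T \<pi> J = T \<rho> J" if "J \<in> P" for J using that by (intro T_cong)
  then show ?thesis by (simp add: form_def)
qed

lemma T_scale: "J \<in> P \<Longrightarrow> i < r \<Longrightarrow> (\<And>l j. l < r \<Longrightarrow> \<rho> l j = (if l = i then c * \<pi> l j else \<pi> l j)) \<Longrightarrow>
  T \<rho> J = c * T \<pi> J"
proof -
  assume i: "i < r" and \<rho>: "\<And>l j. l < r \<Longrightarrow> \<rho> l j = (if l = i then c * \<pi> l j else \<pi> l j)"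
  have "T \<rho> J = (\<Prod>l<r. (if l = i then c else 1) * \<pi> l (J l))"
    unfolding T_def using \<rho> by (intro prod.cong) auto
  also have "\<dots> = c * T \<pi> J"
    using i by (simp add: prod.distrib T_def)
  finally show ?thesis .
qed

lemma form_scale: "i < r \<Longrightarrow> (\<And>l j. l < r \<Longrightarrow> \<rho> l j = (if l = i then c * \<pi> l j else \<pi> l j)) \<Longrightarrow>
  form X \<rho> k = c * form X \<pi> k"
  unfolding form_def sum_distrib_left
  by (intro sum.cong refl) (simp add: T_scale[of _ i \<rho> c \<pi>] mult_ac)

lemma nash_f_last:
  assumes "k < d r"
  shows "nash_f (Suc r) d X r k \<pi> = (\<Sum>J\<in>P. X (r, J(r := k)) * T \<pi> J)"
proof -
  have "inj_on (\<lambda>J. J(r := k)) P" using upd_inj by (auto intro: inj_onI)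
  moreover have "{..<Suc r} - {r} = {..<r}" by auto
  ultimately show ?thesis
    unfolding nash_f_def profiles_fibre[OF assms] T_def
    by (subst sum.reindex) (auto intro!: sum.cong prod.cong)
qed

lemma nash_f_last_diff:
  "k < d r \<Longrightarrow> nash_f (Suc r) d X r 0 \<pi> - nash_f (Suc r) d X r k \<pi> = form X \<pi> k"
  using d2[of r]
  by (simp add: nash_f_last form_def A_def left_diff_distrib flip: sum_subtractf)

text \<open>Grouping profiles by the choice of the last player shows that the expression is linear
  in \<open>c\<close>, with coefficients depending only on the other strategies.\<close>

lemma nash_f_other:
  assumes "i < r"
  shows "nash_f (Suc r) d X i k (\<pi>(r := c)) = (\<Sum>\<kappa><d r. (\<Sum>j\<in>{j \<in> profiles (Suc r) d. j i = k \<and> j r = \<kappa>}.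
    X (i, j) * (\<Prod>l\<in>{..<r} - {i}. \<pi> l (j l))) * c \<kappa>)"
proof -
  let ?S = "{j \<in> profiles (Suc r) d. j i = k}"
  have fin: "finite ?S" by (simp add: profiles_def finite_PiE)
  have img: "(\<lambda>j. j r) ` ?S \<subseteq> {..<d r}" by (auto simp: profiles_def)
  have eq: "{..<Suc r} - {i} = insert r ({..<r} - {i})" using assms by auto
  have p: "(\<Prod>l\<in>{..<Suc r} - {i}. (\<pi>(r := c)) l (j l)) = c (j r) * (\<Prod>l\<in>{..<r} - {i}. \<pi> l (j l))" for j
  proof -
    have "(\<Prod>l\<in>{..<r} - {i}. (\<pi>(r := c)) l (j l)) = (\<Prod>l\<in>{..<r} - {i}. \<pi> l (j l))"
      by (intro prod.cong) auto
    then show ?thesis unfolding eq by simp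
  qed
  have "nash_f (Suc r) d X i k (\<pi>(r := c)) = (\<Sum>j\<in>?S. X (i, j) * (c (j r) * (\<Prod>l\<in>{..<r} - {i}. \<pi> l (j l))))"
    unfolding nash_f_def p ..
  also have "\<dots> = (\<Sum>\<kappa><d r. \<Sum>j\<in>{j \<in> ?S. j r = \<kappa>}. X (i, j) * (c (j r) * (\<Prod>l\<in>{..<r} - {i}. \<pi> l (j l))))"
    by (rule sum.group[OF fin _ img, symmetric]) simp
  also have "\<dots> = (\<Sum>\<kappa><d r. \<Sum>j\<in>{j \<in> profiles (Suc r) d. j i = k \<and> j r = \<kappa>}.
      X (i, j) * (\<Prod>l\<in>{..<r} - {i}. \<pi> l (j l)) * c \<kappa>)"
    by (intro sum.cong) (auto simp: mult_ac)
  finally show ?thesis by (simp add: sum_distrib_right)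
qed

text \<open>The bounds \<open>a\<close> confine each strategy to a coordinate subspace.
  \<open>W d\<close> will be the cone itself, and a bound \<open>a i = 1\<close> leaves player
  \<open>i\<close> a single point.\<close>

definition W :: "(nat \<Rightarrow> nat) \<Rightarrow> (nat \<times> (nat \<Rightarrow> nat) \<Rightarrow> complex) set" where
  "W a = {X \<in> ambient K. \<exists>\<pi>. (\<forall>i<r. \<exists>j<a i. \<pi> i j \<noteq> 0) \<and> (\<forall>i<r. \<forall>j\<ge>a i. \<pi> i j = 0) \<and>
     (\<forall>k\<in>{1..<d r}. form X \<pi> k = 0)}"

text \<open>The equations of the players \<open>i < r\<close> impose fewer than \<open>d r\<close> linear conditions on the strategy
  of the last player, so they can always be satisfied.\<close>
lemma nash_resultant_cone_eq: "nash_resultant_cone (Suc r) d = W d"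
proof (intro equalityI subsetI)
  fix X assume "X \<in> nash_resultant_cone (Suc r) d"
  then obtain \<pi> where X: "X \<in> ambient K" and \<pi>: "\<And>i. i < Suc r \<Longrightarrow> \<exists>k<d i. \<pi> i k \<noteq> 0"
    "\<And>i k. i < Suc r \<Longrightarrow> k < d i \<Longrightarrow> nash_f (Suc r) d X i 0 \<pi> = nash_f (Suc r) d X i k \<pi>"
    unfolding nash_resultant_cone_def nash_points_def by blast
  define \<rho> where "\<rho> i j = (if j < d i then \<pi> i j else 0)" for i j
  have "form X \<rho> k = 0" if "k \<in> {1..<d r}" for k
  proof -
    have "form X \<rho> k = form X \<pi> k" by (rule form_cong) (simp add: \<rho>_def)
    also have "\<dots> = 0" using nash_f_last_diff[of k X \<pi>] \<pi>(2)[of r k] that by simp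
    finally show ?thesis .
  qed
  moreover have "\<exists>j<d i. \<rho> i j \<noteq> 0" if "i < r" for i using \<pi>(1)[of i] that by (auto simp: \<rho>_def)
  ultimately show "X \<in> W d" unfolding W_def using X
    by (auto intro!: exI[of _ \<rho>] simp: \<rho>_def)
next
  fix X assume "X \<in> W d"
  then obtain \<pi> where X: "X \<in> ambient K" and \<pi>: "\<And>i. i < r \<Longrightarrow> \<exists>j<d i. \<pi> i j \<noteq> 0"
    "\<And>k. k \<in> {1..<d r} \<Longrightarrow> form X \<pi> k = 0" unfolding W_def by blast
  \<comment> \<open>One equation for each player below \<open>r\<close> and each comparison with
    strategy 0; their number is the sum in \<open>big\<close>, less than \<open>d r\<close>.\<close>
  let ?E = "Sigma {..<r} (\<lambda>i. {1..<d i})"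
  define b where "b i k \<kappa> = (\<Sum>j\<in>{j \<in> profiles (Suc r) d. j i = k \<and> j r = \<kappa>}.
    X (i, j) * (\<Prod>l\<in>{..<r} - {i}. \<pi> l (j l)))" for i k \<kappa>
  have "card ?E < card {..<d r}" using big by simp
  from homogeneous_system[OF _ _ this, of "\<lambda>e \<kappa>. b (fst e) 0 \<kappa> - b (fst e) (snd e) \<kappa>"] obtain c where
    c: "\<exists>\<kappa>\<in>{..<d r}. c \<kappa> \<noteq> 0" "\<forall>e\<in>?E. (\<Sum>\<kappa><d r. (b (fst e) 0 \<kappa> - b (fst e) (snd e) \<kappa>) * c \<kappa>) = 0"
    by auto
  let ?\<pi> = "\<pi>(r := c)"
  have "\<exists>k<d i. ?\<pi> i k \<noteq> 0" if "i < Suc r" for i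
    using \<pi>(1)[of i] c(1) that by (cases "i = r") auto
  moreover have "nash_f (Suc r) d X i 0 ?\<pi> = nash_f (Suc r) d X i k ?\<pi>" if i: "i < Suc r" "k < d i" for i k
  proof (cases "k = 0")
    case k: False
    show ?thesis
    proof (cases "i = r")
      case True
      have "form X ?\<pi> k = form X \<pi> k" by (rule form_cong) simp
      then have "form X ?\<pi> k = 0" using \<pi>(2)[of k] i k True by simp
      then show ?thesis using nash_f_last_diff[of k X ?\<pi>] i True by simp
    next
      case False
      then have ir: "i < r" using i by simp
      have "(\<Sum>\<kappa><d r. (b i 0 \<kappa> - b i k \<kappa>) * c \<kappa>) = 0" using c(2)[rule_format, of "(i, k)"] ir i k by simp
      then show ?thesis unfolding nash_f_other[OF ir] b_def[symmetric]
        by (simp add: left_diff_distrib sum_subtractf)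
    qed
  qed simp
  ultimately have "?\<pi> \<in> nash_points (Suc r) d X"
    unfolding nash_points_def mem_Collect_eq by (intro conjI allI impI)
  then show "X \<in> nash_resultant_cone (Suc r) d"
    unfolding nash_resultant_cone_def using X by auto
qed

section \<open>Closedness of the sets \<open>W a\<close>\<close>

lemma T_polyfun:
  assumes "\<And>l j. l < r \<Longrightarrow> j < d l \<Longrightarrow> (\<lambda>y. \<pi> y l j) \<in> polyfun Y" "J \<in> P"
  shows "(\<lambda>y. T (\<pi> y) J) \<in> polyfun Y"
  unfolding T_def using assms P_D by (intro polyfun_prod) auto

lemma A_polyfun:
  assumes "\<And>\<kappa>. \<kappa> \<in> K \<Longrightarrow> (\<lambda>y. X y \<kappa>) \<in> polyfun Y" "J \<in> P" "k < d r"
  shows "(\<lambda>y. A (X y) k J) \<in> polyfun Y"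
  unfolding A_def using assms(2,3) by (intro polyfun_diff assms(1) upd_K) auto

lemma form_polyfun:
  assumes "\<And>\<kappa>. \<kappa> \<in> K \<Longrightarrow> (\<lambda>y. X y \<kappa>) \<in> polyfun Y"
    and "\<And>l j. l < r \<Longrightarrow> j < d l \<Longrightarrow> (\<lambda>y. \<pi> y l j) \<in> polyfun Y" "k < d r"
  shows "(\<lambda>y. form (X y) (\<pi> y) k) \<in> polyfun Y"
  unfolding form_def using assms(3)
  by (intro polyfun_sum polyfun.mult A_polyfun T_polyfun assms(1,2))

text \<open>The incidence set of games and supported strategies is closed and invariant under
  scaling each strategy, since the forms are linear in every single one.\<close>

lemma W_closed:
  assumes a: "\<And>i. i < r \<Longrightarrow> a i \<le> d i"
  shows "zariski_closed K (W a)"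
proof -
  let ?N = "Sigma {..<r} (\<lambda>i. {..<a i})"
  let ?L = "Inl ` K \<union> Inr ` ?N" and ?J = "\<lambda>i. Inr ` ({i} \<times> {..<a i}) :: (nat \<times> (nat \<Rightarrow> nat) + nat \<times> nat) set"
  let ?X = "\<lambda>z \<kappa>. z (Inl \<kappa>)" and ?\<pi> = "\<lambda>z i j. if j < a i then z (Inr (i, j)) else 0"
  define Z where "Z = {z \<in> ambient ?L. \<forall>q\<in>(\<lambda>k z. form (?X z) (?\<pi> z) k) ` {1..<d r}. q z = 0}"
  have mem: "z \<in> Z \<longleftrightarrow> z \<in> ambient ?L \<and> (\<forall>k\<in>{1..<d r}. form (?X z) (?\<pi> z) k = 0)" for z
    by (simp add: Z_def)
  have Z: "zariski_closed ?L Z"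
    unfolding Z_def
  proof (rule zariski_closed_zeros, rule image_subsetI)
    fix k assume "k \<in> {1..<d r}"
    moreover have "(\<lambda>z. ?\<pi> z l j) \<in> polyfun ?L" if "l < r" for l j
      using that by (cases "j < a l") (auto intro!: polyfun.var polyfun.const)
    ultimately show "(\<lambda>z. form (?X z) (?\<pi> z) k) \<in> polyfun ?L"
      by (intro form_polyfun) (auto intro!: polyfun.var)
  qed
  have con: "scale (?J i) l z \<in> Z" if i: "i \<in> {..<r}" and z: "z \<in> Z" and l: "l \<noteq> 0" for i z l
  proof -
    have X: "?X (scale (?J i) l z) = ?X z" by (auto simp: scale_def)
    have "form (?X z) (?\<pi> (scale (?J i) l z)) k = l * form (?X z) (?\<pi> z) k" for k
      by (rule form_scale[of i]) (use i in \<open>auto simp: scale_def\<close>)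
    moreover have "scale (?J i) l z \<in> ambient ?L" using z unfolding mem by (intro scale_ambient) blast
    ultimately show ?thesis using z unfolding mem X by simp
  qed
  let ?U = "\<Union>i\<in>{..<r}. ?J i"
  let ?S = "{x \<in> ambient (?L - ?U). \<exists>z\<in>Z. (\<forall>k. k \<notin> ?U \<longrightarrow> z k = x k) \<and> (\<forall>b\<in>{..<r}. \<exists>k\<in>?J b. z k \<noteq> 0)}"
  have "zariski_closed (?L - ?U) ?S"
    by (rule zariski_closed_multiproject[OF _ _ _ Z con]) auto
  moreover have LU: "?L - ?U = Inl ` K" by auto
  ultimately have "zariski_closed (Inl ` K) ?S" by simp
  then have "zariski_closed K {x. case_sum x (\<lambda>_. 0) \<in> ?S}" by (rule zariski_closed_Inl)
  moreover have "{x. case_sum x (\<lambda>_. 0) \<in> ?S} = W a"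
  proof (intro equalityI subsetI)
    fix X assume "X \<in> {x. case_sum x (\<lambda>_. 0) \<in> ?S}"
    then obtain z where z: "z \<in> Z" "\<forall>k. k \<notin> ?U \<longrightarrow> z k = case_sum X (\<lambda>_. 0) k" "\<forall>b\<in>{..<r}. \<exists>k\<in>?J b. z k \<noteq> 0"
      and X: "case_sum X (\<lambda>_. 0::complex) \<in> ambient (?L - ?U)" by blast
    have "z (Inl \<kappa>) = X \<kappa>" for \<kappa> using z(2)[THEN spec, of "Inl \<kappa>"] by auto
    then have "?X z = X" by auto
    then have "form X (?\<pi> z) k = 0" if "k \<in> {1..<d r}" for k using z(1) that unfolding mem by simp
    moreover have "\<exists>j<a i. ?\<pi> z i j \<noteq> 0" if "i < r" for i using z(3) that by force
    moreover have "X \<in> ambient K" using X unfolding LU by (simp only: ambient_case_sum_0)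
    ultimately show "X \<in> W a" unfolding W_def by (intro CollectI conjI exI[of _ "?\<pi> z"]) auto
  next
    fix X assume "X \<in> W a"
    then obtain \<pi> where X: "X \<in> ambient K" and \<pi>: "\<forall>i<r. \<exists>j<a i. \<pi> i j \<noteq> 0" "\<forall>i<r. \<forall>j\<ge>a i. \<pi> i j = 0"
      "\<forall>k\<in>{1..<d r}. form X \<pi> k = 0" unfolding W_def by blast
    define z where "z = case_sum X (\<lambda>(i, j). if i < r \<and> j < a i then \<pi> i j else 0)"
    have Xz: "?X z = X" by (simp add: z_def)
    have "form X (?\<pi> z) k = form X \<pi> k" for k
      by (rule form_cong) (use \<pi>(2) in \<open>auto simp: z_def\<close>)
    moreover have "z \<in> ambient ?L"
      unfolding z_def ambient_case_sum using X by (auto simp: ambient_def)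
    ultimately have "z \<in> Z" unfolding mem Xz using \<pi>(3) by simp
    moreover have "\<forall>k. k \<notin> ?U \<longrightarrow> z k = case_sum X (\<lambda>_. 0) k"
    proof (intro allI impI)
      fix k assume k: "k \<notin> ?U"
      show "z k = case_sum X (\<lambda>_. 0) k"
      proof (cases k)
        case (Inr p)
        obtain i j where p: "p = (i, j)" by (cases p)
        have "\<not> (i < r \<and> j < a i)"
        proof
          assume "i < r \<and> j < a i"
          then have "i \<in> {..<r}" "k \<in> ?J i" using Inr p by auto
          then show False using k by blast
        qed
        then show ?thesis by (auto simp: Inr p z_def)
      qed (simp add: z_def)
    qed
    moreover have "\<exists>k\<in>?J b. z k \<noteq> 0" if "b \<in> {..<r}" for b using \<pi>(1) that by (force simp: z_def)
    moreover have "case_sum X (\<lambda>_. 0) \<in> ambient (?L - ?U)"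
      unfolding LU using X by (simp only: ambient_case_sum_0)
    ultimately show "X \<in> {x. case_sum x (\<lambda>_. 0) \<in> ?S}"
      by (intro CollectI conjI bexI[of _ z]) blast+
  qed
  ultimately show ?thesis by simp
qed

text \<open>One payoff for each form: in form \<open>k\<close> it occurs with coefficient
  \<open>- T \<pi> zero_profile\<close>, which is -1 once all \<open>\<pi> i 0\<close> are 1. The
  equations can therefore be solved for these payoffs without denominators.\<close>

definition K0 :: "(nat \<times> (nat \<Rightarrow> nat)) set" where "K0 = (\<lambda>k. (r, zero_profile(r := k))) ` {1..<d r}"

lemma K0_K: "K0 \<subseteq> K" using upd_K[OF zero_profile_P] by (auto simp: K0_def)

lemma card_K0: "card K0 = d r - 1"
proof -
  have "inj_on (\<lambda>k. (r, zero_profile(r := k))) {1..<d r}" using upd_inj[OF zero_profile_P zero_profile_P] by (auto intro!: inj_onI)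
  then show ?thesis by (simp add: K0_def card_image)
qed

lemma K0_iff: "J \<in> P \<Longrightarrow> k < d r \<Longrightarrow> (r, J(r := k)) \<in> K0 \<longleftrightarrow> J = zero_profile \<and> k \<ge> 1"
  using upd_inj[OF _ zero_profile_P] by (auto simp: K0_def)

text \<open>The incidence variety is parametrised, where all \<open>\<pi> i 0\<close> are nonzero, by normalising \<open>\<pi> i 0 = 1\<close>
  and solving the equations for the coordinates in \<open>K0\<close>.\<close>
definition chart :: "(nat \<Rightarrow> nat) \<Rightarrow> ((nat \<times> (nat \<Rightarrow> nat)) + nat \<times> nat \<Rightarrow> complex) \<Rightarrow> nat \<Rightarrow> nat \<Rightarrow> complex" where
  "chart a y i j = (if j = 0 then 1 else if i < r \<and> j < a i then y (Inr (i, j)) else 0)"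

definition param :: "(nat \<Rightarrow> nat) \<Rightarrow> ((nat \<times> (nat \<Rightarrow> nat)) + nat \<times> nat \<Rightarrow> complex) \<Rightarrow>
    nat \<times> (nat \<Rightarrow> nat) \<Rightarrow> complex" where
  "param a y \<kappa> = (if \<kappa> \<in> K0 then y (Inl (r, zero_profile(r := 0))) +
      (\<Sum>J\<in>P - {zero_profile}. (y (Inl (r, J(r := 0))) - y (Inl (r, J(r := snd \<kappa> r)))) * T (chart a y) J)
    else y (Inl \<kappa>))"

definition param_vars :: "(nat \<Rightarrow> nat) \<Rightarrow> ((nat \<times> (nat \<Rightarrow> nat)) + nat \<times> nat) set" where
  "param_vars a = Inl ` (K - K0) \<union> Inr ` (Sigma {..<r} (\<lambda>i. {1..<a i}))"

lemma finite_param_vars: "finite (param_vars a)" by (simp add: param_vars_def finite_K)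

lemma card_param_vars: "card (param_vars a) = card (K - K0) + (\<Sum>i<r. a i - 1)"
  unfolding param_vars_def using finite_K
  by (subst card_Un_disjoint) (auto simp: card_image inj_on_def)

lemma chart_polyfun: "(\<lambda>y. chart a y l j) \<in> polyfun (param_vars a)"
  unfolding chart_def param_vars_def
  by (cases "j = 0"; cases "l < r \<and> j < a l") (auto intro!: polyfun.var polyfun.const)

lemma param_polyfun: "\<kappa> \<in> K \<Longrightarrow> (\<lambda>y. param a y \<kappa>) \<in> polyfun (param_vars a)"
proof (cases "\<kappa> \<in> K0")
  case True
  then have k: "snd \<kappa> r < d r" using d2[of r] by (auto simp: K0_def)
  have v: "(\<lambda>y. y (Inl (r, J(r := k)))) \<in> polyfun (param_vars a)"
    if "J \<in> P" "k < d r" "J \<noteq> zero_profile \<or> k = 0" for J k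
    using that upd_K[of J k] K0_iff[of J k] by (intro polyfun.var) (auto simp: param_vars_def)
  have "d r > 0" using d2[of r] by simp
  then show ?thesis
    using True k unfolding param_def
    by (auto intro!: polyfun.add polyfun_sum polyfun.mult polyfun_diff v zero_profile_P T_polyfun chart_polyfun)
next
  assume "\<kappa> \<in> K"
  case False
  with \<open>\<kappa> \<in> K\<close> show ?thesis unfolding param_def by (auto intro!: polyfun.var simp: param_vars_def)
qed

lemma T_o: "(\<And>i. i < r \<Longrightarrow> \<pi> i 0 = 1) \<Longrightarrow> T \<pi> zero_profile = 1" by (simp add: T_def zero_profile_def)

lemma form_split_o:
  "form X \<pi> k = A X k zero_profile * T \<pi> zero_profile + (\<Sum>J\<in>P - {zero_profile}. A X k J * T \<pi> J)"
  unfolding form_def using finite_P zero_profile_P by (rule sum.remove)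

lemma param_W:
  assumes a: "\<And>i. i < r \<Longrightarrow> 1 \<le> a i" and y: "y \<in> ambient (param_vars a)"
  shows "param a y \<in> W a"
proof -
  have "form (param a y) (chart a y) k = 0" if k: "k \<in> {1..<d r}" for k
  proof -
    have "A (param a y) k J = y (Inl (r, J(r := 0))) - y (Inl (r, J(r := k)))" if "J \<in> P - {zero_profile}" for J
      using that k K0_iff[of J k] K0_iff[of J 0] by (simp add: A_def param_def)
    moreover have "A (param a y) k zero_profile = - (\<Sum>J\<in>P - {zero_profile}.
        (y (Inl (r, J(r := 0))) - y (Inl (r, J(r := k)))) * T (chart a y) J)"
      using k K0_iff[OF zero_profile_P, of k] K0_iff[OF zero_profile_P, of 0] by (simp add: A_def param_def)
    moreover have "T (chart a y) zero_profile = 1" by (rule T_o) (simp add: chart_def)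
    ultimately show ?thesis by (simp add: form_split_o)
  qed
  moreover have "param a y \<in> ambient K"
    using y K0_K by (auto simp: ambient_def param_def param_vars_def)
  moreover have "\<exists>j<a i. chart a y i j \<noteq> 0" if "i < r" for i
    using a[OF that] by (intro exI[of _ 0]) (simp add: chart_def)
  moreover have "chart a y i j = 0" if "i < r" "j \<ge> a i" for i j
    using a[OF that(1)] that by (simp add: chart_def)
  ultimately show ?thesis unfolding W_def by blast
qed

text \<open>The parameters are read off the game and the strategies; the equation of form
  \<open>k\<close> says that the omitted payoff is the one computed by \<open>param\<close>.\<close>

lemma param_surj:
  assumes X: "X \<in> ambient K" and f: "\<And>k. k \<in> {1..<d r} \<Longrightarrow> form X \<pi> k = 0"
    and \<pi>: "\<And>i. i < r \<Longrightarrow> \<pi> i 0 = 1" "\<And>i j. i < r \<Longrightarrow> j \<ge> a i \<Longrightarrow> \<pi> i j = 0"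
  shows "\<exists>y\<in>ambient (param_vars a). X = param a y"
proof -
  define y where "y = case_sum (\<lambda>\<kappa>. if \<kappa> \<in> K0 then 0 else X \<kappa>)
    (\<lambda>(i, j). if i < r \<and> 1 \<le> j \<and> j < a i then \<pi> i j else 0)"
  have "y \<in> ambient (param_vars a)"
    unfolding param_vars_def y_def ambient_case_sum using X by (auto simp: ambient_def)
  moreover have "X \<kappa> = param a y \<kappa>" for \<kappa>
  proof (cases "\<kappa> \<in> K0")
    case True
    then obtain k where k: "k \<in> {1..<d r}" "\<kappa> = (r, zero_profile(r := k))" by (auto simp: K0_def)
    have "chart a y i j = \<pi> i j" if "i < r" for i j
      using that \<pi>(1)[OF that] \<pi>(2)[OF that, of j] by (auto simp: chart_def y_def)
    then have Tc: "T (chart a y) J = T \<pi> J" for J by (simp add: T_def)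
    have v: "y (Inl (r, J(r := k'))) = X (r, J(r := k'))" if "J \<in> P" "k' < d r" "J \<noteq> zero_profile \<or> k' = 0" for J k'
      using that K0_iff[of J k'] by (auto simp: y_def)
    have d0: "0 < d r" using d2[of r] by simp
    have "param a y \<kappa> = X (r, zero_profile(r := 0)) + (\<Sum>J\<in>P - {zero_profile}. A X k J * T \<pi> J)"
      using True k v[OF zero_profile_P d0] v d0 unfolding param_def A_def by (auto simp: Tc intro!: sum.cong)
    moreover have "A X k zero_profile + (\<Sum>J\<in>P - {zero_profile}. A X k J * T \<pi> J) = 0"
      using f[OF k(1)] T_o[of \<pi>] \<pi>(1) by (simp add: form_split_o)
    ultimately show ?thesis using k(2) by (simp add: A_def algebra_simps)
  next
    case False
    then show ?thesis by (simp add: param_def y_def)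
  qed
  ultimately show ?thesis by blast
qed

text \<open>A game whose strategies leave the chart is approached by games inside it: the
  coordinates \<open>\<pi> i 0\<close> are shifted by \<open>t\<close>, and payoffs are corrected so
  that the moved strategies still solve the equations. Continuity of \<open>p\<close> finishes the
  argument.\<close>

lemma param_dense:
  assumes a: "\<And>i. i < r \<Longrightarrow> 1 \<le> a i \<and> a i \<le> d i"
    and p: "p \<in> polyfun K" "\<And>y. y \<in> ambient (param_vars a) \<Longrightarrow> p (param a y) = 0" and X: "X \<in> W a"
  shows "p X = 0"
proof -
  obtain \<pi> where XK: "X \<in> ambient K" and \<pi>: "\<forall>i<r. \<exists>j<a i. \<pi> i j \<noteq> 0" "\<forall>i<r. \<forall>j\<ge>a i. \<pi> i j = 0"
    "\<forall>k\<in>{1..<d r}. form X \<pi> k = 0" using X unfolding W_def by blast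
  then obtain J0 where J0: "\<And>i. i < r \<Longrightarrow> J0 i < a i \<and> \<pi> i (J0 i) \<noteq> 0" by metis
  \<comment> \<open>A product of strategy entries that is nonzero at \<open>\<pi>\<close>, hence
    also for small \<open>t\<close>; the correction divides by it.\<close>
  define J where "J i = (if i < r then J0 i else undefined)" for i
  have JP: "J \<in> P" using J0 a by (intro P_I) (force simp: J_def)+
  have TJ: "T \<pi> J \<noteq> 0" using J0 by (simp add: T_def J_def)
  define \<rho> where "\<rho> t i j = \<pi> i j + (if j = 0 then t else 0)" for t i j
  \<comment> \<open>The payoff at \<open>J(r := k)\<close> enters form \<open>k\<close> with
    coefficient \<open>- T (\<rho> t) J\<close>, so the quotient cancels the value of the form. The
    correction tends to 0 because the forms vanish at \<open>\<pi>\<close>.\<close>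
  define Xt where "Xt t \<kappa> = X \<kappa> + (if fst \<kappa> = r \<and> (\<exists>k\<in>{1..<d r}. snd \<kappa> = J(r := k))
    then form X (\<rho> t) (snd \<kappa> r) / T (\<rho> t) J else 0)" for t \<kappa>
  have \<rho>_lim: "((\<lambda>t. \<rho> t i j) \<longlongrightarrow> \<pi> i j) (at 0)" for i j
    unfolding \<rho>_def by (cases "j = 0") (auto intro!: tendsto_eq_intros)
  have T_lim: "((\<lambda>t. T (\<rho> t) J') \<longlongrightarrow> T \<pi> J') (at 0)" for J'
    unfolding T_def by (intro tendsto_prod \<rho>_lim)
  have X_lim: "((\<lambda>t. Xt t \<kappa>) \<longlongrightarrow> X \<kappa>) (at 0)" for \<kappa>
  proof (cases "fst \<kappa> = r \<and> (\<exists>k\<in>{1..<d r}. snd \<kappa> = J(r := k))")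
    case True
    then have k: "snd \<kappa> r \<in> {1..<d r}" by auto
    have "((\<lambda>t. form X (\<rho> t) (snd \<kappa> r)) \<longlongrightarrow> form X \<pi> (snd \<kappa> r)) (at 0)"
      unfolding form_def by (intro tendsto_intros T_lim)
    then have "((\<lambda>t. X \<kappa> + form X (\<rho> t) (snd \<kappa> r) / T (\<rho> t) J) \<longlongrightarrow> X \<kappa> + 0 / T \<pi> J) (at 0)"
      using \<pi>(3) k by (intro tendsto_intros T_lim TJ) auto
    then show ?thesis using True by (simp add: Xt_def)
  next
    case False
    then have "(\<lambda>t. Xt t \<kappa>) = (\<lambda>t. X \<kappa>)" by (auto simp: Xt_def)
    then show ?thesis by simp
  qed
  have "((\<lambda>t. p (Xt t)) \<longlongrightarrow> p X) (at 0)" by (rule polyfun_tendsto[OF p(1) X_lim])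
  moreover have "\<forall>\<^sub>F t in at 0. p (Xt t) = 0"
  proof -
    have "\<forall>\<^sub>F t in at 0. T (\<rho> t) J \<noteq> 0"
      using tendsto_imp_eventually_ne[OF T_lim[of J] TJ] .
    moreover have "\<forall>\<^sub>F t in at 0. \<forall>i\<in>{..<r}. \<rho> t i 0 \<noteq> 0"
    proof (rule eventually_ball_finite[OF finite_lessThan], rule ballI)
      fix i
      show "\<forall>\<^sub>F t in at 0. \<rho> t i 0 \<noteq> 0"
      proof (cases "\<pi> i 0 = 0")
        case True
        then show ?thesis by (simp add: \<rho>_def eventually_at_filter)
      next
        case False
        with \<rho>_lim[of i 0] show ?thesis by (rule tendsto_imp_eventually_ne)
      qed
    qed
    ultimately show ?thesis
    proof eventually_elim
      case (elim t)
      have d0: "0 < d r" using d2[of r] by simp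
      have Xt0: "Xt t (r, J'(r := 0)) = X (r, J'(r := 0))" if "J' \<in> P" for J'
      proof -
        have "\<not> (\<exists>k\<in>{1..<d r}. J'(r := 0) = J(r := k))" unfolding upd_inj[OF that JP] by auto
        then show ?thesis by (simp add: Xt_def)
      qed
      have A_eq: "A (Xt t) k J' = A X k J' - (if J' = J then form X (\<rho> t) k / T (\<rho> t) J else 0)"
        if "J' \<in> P" "k \<in> {1..<d r}" for k J'
      proof -
        have "(\<exists>k'\<in>{1..<d r}. J'(r := k) = J(r := k')) \<longleftrightarrow> J' = J"
          unfolding upd_inj[OF that(1) JP] using that(2) by auto
        then show ?thesis using Xt0[OF that(1)] by (simp add: A_def Xt_def)
      qed
      have fz: "form (Xt t) (\<rho> t) k = 0" if k: "k \<in> {1..<d r}" for k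
      proof -
        have "form (Xt t) (\<rho> t) k = (\<Sum>J'\<in>P. A X k J' * T (\<rho> t) J' -
            (if J' = J then form X (\<rho> t) k / T (\<rho> t) J * T (\<rho> t) J' else 0))"
          unfolding form_def[of "Xt t"]
        proof (intro sum.cong refl)
          fix J' assume "J' \<in> P"
          show "A (Xt t) k J' * T (\<rho> t) J' = A X k J' * T (\<rho> t) J' -
            (if J' = J then form X (\<rho> t) k / T (\<rho> t) J * T (\<rho> t) J' else 0)"
            unfolding A_eq[OF \<open>J' \<in> P\<close> k] by (cases "J' = J") (simp_all add: left_diff_distrib)
        qed
        also have "\<dots> = form X (\<rho> t) k - form X (\<rho> t) k / T (\<rho> t) J * T (\<rho> t) J"
          using finite_P JP by (simp add: sum_subtractf form_def)
        finally show ?thesis using elim(1) by simp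
      qed
      define \<sigma> where "\<sigma> i j = \<rho> t i j / \<rho> t i 0" for i j
      have "T \<sigma> J' = T (\<rho> t) J' / (\<Prod>i<r. \<rho> t i 0)" for J' by (simp add: T_def \<sigma>_def prod_dividef)
      then have "form (Xt t) \<sigma> k = form (Xt t) (\<rho> t) k / (\<Prod>i<r. \<rho> t i 0)" for k
        by (simp add: form_def sum_divide_distrib)
      then have f\<sigma>: "form (Xt t) \<sigma> k = 0" if "k \<in> {1..<d r}" for k using fz[OF that] by simp
      have Xa: "Xt t \<in> ambient K" unfolding ambient_def
      proof (intro CollectI allI impI)
        fix \<kappa> assume \<kappa>: "\<kappa> \<notin> K"
        then have neg: "\<not> (fst \<kappa> = r \<and> (\<exists>k\<in>{1..<d r}. snd \<kappa> = J(r := k)))"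
          using upd_K[OF JP] by (metis atLeastLessThan_iff prod.collapse)
        have "X \<kappa> = 0" using XK \<kappa> unfolding ambient_def by blast
        then show "Xt t \<kappa> = 0" unfolding Xt_def if_not_P[OF neg] by simp
      qed
      have "\<exists>y\<in>ambient (param_vars a). Xt t = param a y"
      proof (rule param_surj[OF Xa f\<sigma>])
        show "\<sigma> i 0 = 1" if "i < r" for i using elim(2) that by (simp add: \<sigma>_def)
        show "\<sigma> i j = 0" if "i < r" "j \<ge> a i" for i j
          using \<pi>(2) that a[OF that(1)] by (simp add: \<sigma>_def \<rho>_def)
      qed
      then show ?case using p(2) by auto
    qed
  qed
  then have "((\<lambda>t. p (Xt t)) \<longlongrightarrow> 0) (at 0)" by (rule tendsto_eventually)
  ultimately show ?thesis using tendsto_unique[of "at (0::complex)"] by simp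
qed

lemma W_irreducible:
  assumes a: "\<And>i. i < r \<Longrightarrow> 1 \<le> a i \<and> a i \<le> d i"
  shows "zariski_irreducible K (W a)"
proof (rule zariski_irreducible_image[where \<phi> = "param a" and Y = "param_vars a"])
  show "zariski_closed K (W a)" using a by (intro W_closed) simp
  show "\<And>k. k \<in> K \<Longrightarrow> (\<lambda>y. param a y k) \<in> polyfun (param_vars a)" by (rule param_polyfun)
  show "\<And>y. y \<in> ambient (param_vars a) \<Longrightarrow> param a y \<in> W a" using a by (intro param_W) simp_all
  show "\<And>p z. p \<in> polyfun K \<Longrightarrow> (\<And>y. y \<in> ambient (param_vars a) \<Longrightarrow> p (param a y) = 0) \<Longrightarrow> z \<in> W a \<Longrightarrow> p z = 0"
    using param_dense[OF a] by blast
qed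

text \<open>Linear subspaces that form the bottom of the chain. The payoffs in \<open>K0\<close>
  follow the one at \<open>zero_profile(r := 0)\<close>, and \<open>S\<close> names the coordinates
  left free.\<close>

definition flag :: "(nat \<times> (nat \<Rightarrow> nat)) set \<Rightarrow> (nat \<times> (nat \<Rightarrow> nat) \<Rightarrow> complex) set" where
  "flag S = {X \<in> ambient K. (\<forall>\<kappa>\<in>K0. X \<kappa> = X (r, zero_profile(r := 0))) \<and> (\<forall>\<kappa>\<in>K - K0 - S. X \<kappa> = 0)}"

lemma zero_profile_0_K: "(r, zero_profile(r := 0)) \<in> K - K0"
  using upd_K[OF zero_profile_P, of 0] K0_iff[OF zero_profile_P, of 0] d2[of r] by simp

lemma flag_irreducible:
  assumes S: "S \<subseteq> K - K0"
  shows "zariski_irreducible K (flag S)"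
proof (rule zariski_irreducible_image)
  let ?\<kappa>0 = "(r, zero_profile(r := 0))"
  let ?P = "(\<lambda>\<kappa> X. X \<kappa> - X ?\<kappa>0) ` K0 \<union> (\<lambda>\<kappa> X. X \<kappa>) ` (K - K0 - S)"
  have "flag S = {X \<in> ambient K. \<forall>p\<in>?P. p X = 0}" by (simp add: flag_def ball_Un)
  moreover have "?P \<subseteq> polyfun K" using K0_K zero_profile_0_K by (auto intro!: polyfun_diff polyfun.var)
  ultimately show "zariski_closed K (flag S)" by (simp only: zariski_closed_zeros)
  let ?\<phi> = "\<lambda>y \<kappa>. if \<kappa> \<in> K0 then (if ?\<kappa>0 \<in> S then y ?\<kappa>0 else 0) else if \<kappa> \<in> S then y \<kappa> else 0"
  show "(\<lambda>y. ?\<phi> y \<kappa>) \<in> polyfun S" if "\<kappa> \<in> K" for \<kappa>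
    by (cases "\<kappa> \<in> K0"; cases "?\<kappa>0 \<in> S"; cases "\<kappa> \<in> S") (simp_all add: polyfun.var polyfun.const)
  show "?\<phi> y \<in> flag S" if "y \<in> ambient S" for y
    using S K0_K zero_profile_0_K by (auto simp: flag_def ambient_def)
  fix p X assume p: "p \<in> polyfun K" "\<And>y. y \<in> ambient S \<Longrightarrow> p (?\<phi> y) = 0" and X: "X \<in> flag S"
  have eq: "?\<phi> (\<lambda>\<kappa>. if \<kappa> \<in> S then X \<kappa> else 0) = X"
  proof
    fix \<kappa>
    have "X \<kappa> = 0" if "\<kappa> \<notin> K" using X that unfolding flag_def ambient_def by blast
    then show "?\<phi> (\<lambda>\<kappa>. if \<kappa> \<in> S then X \<kappa> else 0) \<kappa> = X \<kappa>"
      using X zero_profile_0_K K0_K by (cases "\<kappa> \<in> K") (auto simp: flag_def)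
  qed
  have "(\<lambda>\<kappa>. if \<kappa> \<in> S then X \<kappa> else 0) \<in> ambient S" by (simp add: ambient_def)
  from p(2)[OF this] show "p X = 0" unfolding eq .
qed

lemma flag_chain: "finite S \<Longrightarrow> S \<subseteq> K - K0 \<Longrightarrow> irr_chain K (card S) (flag S)"
proof (induction S rule: finite_induct)
  case empty
  show ?case using irr_chain_0[OF flag_irreducible[of "{}"]] by simp
next
  case (insert \<kappa> S)
  \<comment> \<open>A unit vector at the new coordinate, except that the payoffs in
    \<open>K0\<close> must move along when this is the coordinate they follow.\<close>
  let ?X = "\<lambda>\<kappa>'. if \<kappa>' = \<kappa> \<or> \<kappa> = (r, zero_profile(r := 0)) \<and> \<kappa>' \<in> K0 then 1 else 0"
  have "?X \<in> flag (insert \<kappa> S)" using insert.prems K0_K zero_profile_0_K by (auto simp: flag_def ambient_def)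
  moreover have "?X \<notin> flag S" using insert.prems insert.hyps by (auto simp: flag_def)
  moreover have "flag S \<subseteq> flag (insert \<kappa> S)" by (auto simp: flag_def)
  ultimately have "flag S \<subset> flag (insert \<kappa> S)" by blast
  then have "irr_chain K (Suc (card S)) (flag (insert \<kappa> S))"
    using insert by (intro irr_chain_Suc[where Z = "flag S"] flag_irreducible) auto
  then show ?case using insert.hyps by simp
qed

text \<open>Only \<open>zero_profile\<close> contributes to the forms, so the equations become
  linear conditions on the game alone.\<close>

lemma W_ones:
  assumes a: "\<And>i. i < r \<Longrightarrow> a i = 1"
  shows "W a = flag (K - K0)"
proof (intro equalityI subsetI)
  fix X assume "X \<in> W a"
  then obtain \<pi> where XK: "X \<in> ambient K" and \<pi>: "\<forall>i<r. \<exists>j<a i. \<pi> i j \<noteq> 0" "\<forall>i<r. \<forall>j\<ge>a i. \<pi> i j = 0"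
    "\<forall>k\<in>{1..<d r}. form X \<pi> k = 0" unfolding W_def by blast
  have n0: "\<pi> i 0 \<noteq> 0" if "i < r" for i using \<pi>(1) a that by auto
  have T0: "T \<pi> J = 0" if J: "J \<in> P - {zero_profile}" for J
  proof -
    obtain l where "l < r" "J l \<noteq> zero_profile l" using J P_eqI[OF _ zero_profile_P, of J] by blast
    then have "\<pi> l (J l) = 0" using \<pi>(2) a by (auto simp: zero_profile_def)
    then show ?thesis using \<open>l < r\<close> by (auto simp: T_def)
  qed
  have "A X k zero_profile = 0" if "k \<in> {1..<d r}" for k
  proof -
    have "(\<Sum>J\<in>P - {zero_profile}. A X k J * T \<pi> J) = 0" by (intro sum.neutral ballI) (simp only: T0 mult_zero_right)
    moreover have "form X \<pi> k = 0" using \<pi>(3) that by blast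
    ultimately have "A X k zero_profile * T \<pi> zero_profile = 0" by (simp only: form_split_o add_0_right)
    moreover have "T \<pi> zero_profile \<noteq> 0" using n0 by (simp add: T_def zero_profile_def)
    ultimately show ?thesis by simp
  qed
  then show "X \<in> flag (K - K0)" using XK by (auto simp: flag_def K0_def A_def)
next
  fix X assume X: "X \<in> flag (K - K0)"
  let ?\<pi> = "\<lambda>i j. if j = 0 then 1 else 0 :: complex"
  have T0: "T ?\<pi> J = 0" if J: "J \<in> P - {zero_profile}" for J
  proof -
    obtain l where "l < r" "J l \<noteq> zero_profile l" using J P_eqI[OF _ zero_profile_P, of J] by blast
    then show ?thesis by (auto simp: T_def zero_profile_def)
  qed
  have "form X ?\<pi> k = 0" if k: "k \<in> {1..<d r}" for k
  proof -
    have "(r, zero_profile(r := k)) \<in> K0" using k by (auto simp: K0_def)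
    then have "A X k zero_profile = 0" using X by (auto simp: flag_def A_def)
    then show ?thesis using T0 by (simp add: form_split_o)
  qed
  then show "X \<in> W a" using X a unfolding W_def
    by (intro CollectI conjI exI[of _ ?\<pi>]) (auto simp: flag_def)
qed

text \<open>The forms whose value at \<open>\<pi>\<close> is a coefficient of the product of the polynomials with coefficient
  vectors \<open>\<pi> i\<close>: if all but the top coefficient vanish then so do all but the top entries of \<open>\<pi>\<close>.\<close>
lemma W_strict:
  assumes a: "\<And>i. i < r \<Longrightarrow> 1 \<le> a i \<and> a i \<le> d i" and i0: "i0 < r" "a i0 \<ge> 2"
  shows "W (a(i0 := a i0 - 1)) \<subset> W a"
proof
  let ?a' = "a(i0 := a i0 - 1)"
  define \<sigma> where "\<sigma> = (\<Sum>i<r. a i - 1)"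
  have \<sigma>: "\<sigma> < d r - 1"
  proof -
    have "\<sigma> \<le> (\<Sum>i<r. d i - 1)" unfolding \<sigma>_def using a by (intro sum_mono diff_le_mono) auto
    then show ?thesis using big by simp
  qed
  show "W ?a' \<subseteq> W a"
  proof
    fix X assume "X \<in> W ?a'"
    then obtain \<pi> where XK: "X \<in> ambient K" and \<pi>: "\<forall>i<r. \<exists>j<?a' i. \<pi> i j \<noteq> 0" "\<forall>i<r. \<forall>j\<ge>?a' i. \<pi> i j = 0"
      "\<forall>k\<in>{1..<d r}. form X \<pi> k = 0" unfolding W_def by blast
    have le: "?a' i \<le> a i" for i by simp
    have "\<exists>j<a i. \<pi> i j \<noteq> 0" if "i < r" for i using \<pi>(1) that le less_le_trans by blast
    moreover have "\<pi> i j = 0" if "i < r" "j \<ge> a i" for i j using \<pi>(2) that le order_trans by blast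
    ultimately show "X \<in> W a" using XK \<pi>(3) unfolding W_def by blast
  qed
  \<comment> \<open>The entries are -1 since \<open>A\<close> subtracts them. Form \<open>k\<close>
    reads the coefficient of degree \<open>k - 1\<close>; the values \<open>k \<le> \<sigma>\<close>
    cover all degrees below \<open>\<sigma>\<close> and are available because
    \<open>\<sigma> < d r - 1\<close>.\<close>
  define X where "X = (\<lambda>(i, j). if i = r \<and> j \<in> profiles (Suc r) d \<and> 1 \<le> j r \<and> j r \<le> \<sigma> \<and> (\<Sum>l<r. j l) = j r - 1
    then - 1 else 0 :: complex)"
  have XK: "X \<in> ambient K" by (auto simp: X_def ambient_def game_index_def)
  have A: "A X k J = (if k \<le> \<sigma> \<and> (\<Sum>l<r. J l) = k - 1 then 1 else 0)" if "J \<in> P" "k \<in> {1..<d r}" for k J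
    using that upd_profile[of J k] by (auto simp: A_def X_def)
  show "W ?a' \<noteq> W a"
  proof
    assume eq: "W ?a' = W a"
    \<comment> \<open>With all weight on the last allowed entry the product polynomial is the
      monomial of degree \<open>\<sigma>\<close>, whose lower coefficients vanish.\<close>
    let ?e = "\<lambda>i j. if j = a i - 1 then 1 else 0 :: complex"
    have fe: "form X ?e k = 0" if k: "k \<in> {1..<d r}" for k
      unfolding form_def
    proof (intro sum.neutral ballI)
      fix J assume J: "J \<in> P"
      show "A X k J * T ?e J = 0"
      proof (cases "\<forall>l<r. J l = a l - 1")
        case True
        then have "(\<Sum>l<r. J l) = \<sigma>" by (simp add: \<sigma>_def)
        then show ?thesis using A[OF J k] k by auto
      next
        case False
        then have "T ?e J = 0" by (auto simp: T_def)
        then show ?thesis by simp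
      qed
    qed
    have e: "\<exists>j<a i. ?e i j \<noteq> 0" "\<forall>j\<ge>a i. ?e i j = 0" if "i < r" for i
    proof -
      have "a i - 1 < a i" using a[OF that] by simp
      then show "\<exists>j<a i. ?e i j \<noteq> 0" "\<forall>j\<ge>a i. ?e i j = 0" by auto
    qed
    have "X \<in> W a"
      unfolding W_def by (intro CollectI conjI exI[of _ ?e] XK ballI fe allI impI e(1) e(2)[rule_format])
    then have "X \<in> W ?a'" using eq by simp
    then obtain \<pi> where \<pi>: "\<forall>i<r. \<exists>j<?a' i. \<pi> i j \<noteq> 0" "\<forall>i<r. \<forall>j\<ge>?a' i. \<pi> i j = 0"
      "\<forall>k\<in>{1..<d r}. form X \<pi> k = 0" unfolding W_def by blast
    \<comment> \<open>Factor \<open>i0\<close> has lost its top coefficient, so this nonzero product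
      has degree below \<open>\<sigma>\<close>, while the forms make all its coefficients there
      zero.\<close>
    define f where "f = (\<Prod>l<r. \<Sum>j<d l. monom (\<pi> l j) j)"
    have cf: "coeff (\<Sum>j<d l. monom (\<pi> l j) j) i = (if i < d l then \<pi> l i else 0)" for l i
      by (simp add: coeff_sum)
    have "(\<Sum>j<d l. monom (\<pi> l j) j) \<noteq> 0" if l: "l < r" for l
    proof -
      obtain j where "j < ?a' l" "\<pi> l j \<noteq> 0" using \<pi>(1) l by blast
      moreover have "?a' l \<le> d l" using a[OF l] by auto
      ultimately have "coeff (\<Sum>j<d l. monom (\<pi> l j) j) j \<noteq> 0" by (simp add: cf)
      then show ?thesis by auto
    qed
    then have f0: "f \<noteq> 0" by (simp add: f_def)
    have "degree (\<Sum>j<d l. monom (\<pi> l j) j) \<le> ?a' l - 1" if "l < r" for l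
      using \<pi>(2) that by (intro degree_le) (auto simp: cf)
    then have "(\<Sum>l<r. degree (\<Sum>j<d l. monom (\<pi> l j) j)) \<le> (\<Sum>l<r. ?a' l - 1)"
      by (intro sum_mono) simp
    moreover have "degree f \<le> (\<Sum>l<r. degree (\<Sum>j<d l. monom (\<pi> l j) j))"
      unfolding f_def using degree_prod_sum_le[of "{..<r}" "\<lambda>l. \<Sum>j<d l. monom (\<pi> l j) j"] by (simp add: comp_def)
    moreover have "(\<Sum>l<r. ?a' l - 1) < \<sigma>"
      unfolding \<sigma>_def using i0 by (intro sum_strict_mono_ex1) auto
    ultimately have deg: "degree f < \<sigma>" by simp
    have "coeff f t = 0" if t: "t < \<sigma>" for t
    proof -
      have k: "Suc t \<in> {1..<d r}" "Suc t \<le> \<sigma>" using t \<sigma> by auto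
      have "coeff f t = (\<Sum>J\<in>P. if (\<Sum>l<r. J l) = t then T \<pi> J else 0)"
        unfolding f_def prod_sum_monom by (simp add: coeff_sum flip: P_def T_def)
      also have "\<dots> = form X \<pi> (Suc t)"
        unfolding form_def using k by (intro sum.cong refl) (simp add: A)
      also have "\<dots> = 0" using \<pi>(3) k by blast
      finally show ?thesis .
    qed
    then have "lead_coeff f = 0" using deg by blast
    then show False using f0 by simp
  qed
qed

text \<open>A chain of linear spaces leads up to the case where all bounds are 1, and raising one
  bound by 1 adds one strict inclusion.\<close>

lemma W_chain:
  assumes "\<And>i. i < r \<Longrightarrow> 1 \<le> a i \<and> a i \<le> d i"
  shows "irr_chain K (card (K - K0) + (\<Sum>i<r. a i - 1)) (W a)"
  using assms
proof (induction "\<Sum>i<r. a i - 1" arbitrary: a)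
  case 0
  then have "a i = 1" if "i < r" for i using that by (force simp: sum_eq_0_iff)
  then have "W a = flag (K - K0)" by (rule W_ones)
  then show ?case using flag_chain[of "K - K0"] finite_K 0 by simp
next
  case (Suc m)
  have "\<not> (\<forall>i\<in>{..<r}. a i - 1 = 0)"
  proof
    assume "\<forall>i\<in>{..<r}. a i - 1 = 0"
    then have "(\<Sum>i<r. a i - 1) = 0" by (rule sum.neutral)
    then show False using Suc(2) by simp
  qed
  then obtain i0 where i0: "i0 < r" "a i0 - 1 \<noteq> 0" by auto
  let ?a' = "a(i0 := a i0 - 1)"
  have s: "(\<Sum>i<r. f i) = f i0 + (\<Sum>i\<in>{..<r} - {i0}. f i)" for f :: "nat \<Rightarrow> nat"
    using i0 by (simp add: sum.remove)
  have "(\<Sum>i\<in>{..<r} - {i0}. ?a' i - 1) = (\<Sum>i\<in>{..<r} - {i0}. a i - 1)" by (intro sum.cong) auto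
  then have m: "m = (\<Sum>i<r. ?a' i - 1)" using Suc(2) i0 s[of "\<lambda>i. a i - 1"] s[of "\<lambda>i. ?a' i - 1"] by simp
  have a': "1 \<le> ?a' i \<and> ?a' i \<le> d i" if "i < r" for i using Suc(3)[OF that] i0 by auto
  have "irr_chain K (card (K - K0) + (\<Sum>i<r. ?a' i - 1)) (W ?a')" by (rule Suc(1)[OF m a'])
  then have "irr_chain K (Suc (card (K - K0) + (\<Sum>i<r. ?a' i - 1))) (W a)"
    using Suc(3) i0 by (intro irr_chain_Suc[where Z = "W ?a'"] W_strict W_irreducible) auto
  moreover have "Suc (card (K - K0) + (\<Sum>i<r. ?a' i - 1)) = card (K - K0) + (\<Sum>i<r. a i - 1)"
    by (simp only: m[symmetric] Suc(2)[symmetric] add_Suc_right)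
  ultimately show ?case by (simp only:)
qed

definition c :: nat where "c = d r - 1 - (\<Sum>i<r. d i - 1)"

lemma c_pos: "c > 0" and c_eq: "c + (\<Sum>i<r. d i - 1) = d r - 1"
  using big by (simp_all add: c_def)

lemma krull_dim_cone: "krull_dim K (W d) = card K - c"
proof -
  have d: "1 \<le> d i \<and> d i \<le> d i" if "i < r" for i using d2[of i] that by simp
  have "krull_dim K (W d) = card (param_vars d)"
  proof (rule krull_dim_eq[where \<phi> = "param d"])
    show "irr_chain K (card (param_vars d)) (W d)" unfolding card_param_vars by (rule W_chain[OF d])
    show "\<And>k. k \<in> K \<Longrightarrow> (\<lambda>y. param d y k) \<in> polyfun (param_vars d)" by (rule param_polyfun)
    show "\<And>p z. p \<in> polyfun K \<Longrightarrow> (\<And>y. y \<in> ambient (param_vars d) \<Longrightarrow> p (param d y) = 0) \<Longrightarrow> z \<in> W d \<Longrightarrow> p z = 0"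
      using param_dense[OF d] by blast
  qed (rule finite_param_vars)
  also have "\<dots> = card K - (d r - 1) + (\<Sum>i<r. d i - 1)"
    unfolding card_param_vars using K0_K finite_K
    by (simp add: card_Diff_subset card_K0 finite_subset)
  also have "\<dots> = card K - c"
    using card_mono[OF finite_K K0_K] card_K0 c_eq by simp
  finally show ?thesis .
qed

lemma c_le: "c \<le> card K" using card_mono[OF finite_K K0_K] card_K0 c_eq by simp

end

section \<open>The degree of the Nash resultant variety\<close>

text \<open>Pigeonhole with equality: every point is a root of some factor, factor \<open>b\<close>
  has at most \<open>e b\<close> roots, and these bounds add up to the number of points. Hence no
  degree drops and no point is a root of two factors.\<close>

lemma split_roots:
  fixes Q :: "'b \<Rightarrow> complex poly" and \<tau> :: "'i \<Rightarrow> complex"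
  assumes fin: "finite B" "finite I" and Q: "\<And>b. b \<in> B \<Longrightarrow> Q b \<noteq> 0 \<and> degree (Q b) \<le> e b"
    and sum: "(\<Sum>b\<in>B. e b) = card I" and \<tau>: "inj_on \<tau> I"
    and root: "\<And>k. k \<in> I \<Longrightarrow> (\<Prod>b\<in>B. poly (Q b) (\<tau> k)) = 0"
  shows "\<exists>\<beta>. (\<forall>k\<in>I. \<beta> k \<in> B) \<and> (\<forall>k\<in>I. \<forall>b\<in>B. poly (Q b) (\<tau> k) = 0 \<longleftrightarrow> \<beta> k = b) \<and>
    (\<forall>b\<in>B. card {k \<in> I. \<beta> k = b} = e b \<and> degree (Q b) = e b)"
proof -
  have "\<exists>b\<in>B. poly (Q b) (\<tau> k) = 0" if "k \<in> I" for k using root[OF that] fin by simp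
  then obtain \<beta> where \<beta>: "\<And>k. k \<in> I \<Longrightarrow> \<beta> k \<in> B" "\<And>k. k \<in> I \<Longrightarrow> poly (Q (\<beta> k)) (\<tau> k) = 0" by metis
  define R where "R b = {k \<in> I. poly (Q b) (\<tau> k) = 0}" for b
  have R: "card (R b) \<le> degree (Q b)" if b: "b \<in> B" for b
  proof -
    have "\<tau> ` R b \<subseteq> {x. poly (Q b) x = 0}" by (auto simp: R_def)
    then have "card (\<tau> ` R b) \<le> card {x. poly (Q b) x = 0}"
      using poly_roots_finite Q[OF b] by (intro card_mono) auto
    also have "\<dots> \<le> degree (Q b)" using card_poly_roots_bound Q[OF b] by blast
    finally show ?thesis using \<tau> by (simp add: card_image inj_on_subset R_def)
  qed
  have sub: "{k \<in> I. \<beta> k = b} \<subseteq> R b" for b using \<beta>(2) by (auto simp: R_def)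
  have finR: "finite (R b)" for b using fin by (simp add: R_def)
  have le: "card {k \<in> I. \<beta> k = b} \<le> card (R b)" for b using finR sub by (rule card_mono)
  have "(\<Sum>b\<in>B. card {k \<in> I. \<beta> k = b}) = card I"
  proof -
    have "(\<Sum>b\<in>B. card {k \<in> I. \<beta> k = b}) = (\<Sum>b\<in>B. \<Sum>k\<in>{k \<in> I. \<beta> k = b}. 1)" by simp
    also have "\<dots> = (\<Sum>k\<in>I. 1)" by (rule sum.group) (use fin \<beta> in auto)
    finally show ?thesis by simp
  qed
  then have eq: "(\<Sum>b\<in>B. card {k \<in> I. \<beta> k = b}) = (\<Sum>b\<in>B. e b)" using sum by simp
  have le': "card {k \<in> I. \<beta> k = b} \<le> e b" if "b \<in> B" for b
    using le[of b] R[OF that] Q[OF that] by simp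
  have card: "card {k \<in> I. \<beta> k = b} = e b" if b: "b \<in> B" for b
  proof (rule ccontr)
    assume "card {k \<in> I. \<beta> k = b} \<noteq> e b"
    then have "card {k \<in> I. \<beta> k = b} < e b" using le'[OF b] by simp
    then have "(\<Sum>b\<in>B. card {k \<in> I. \<beta> k = b}) < (\<Sum>b\<in>B. e b)"
      using fin b le' by (intro sum_strict_mono_ex1) auto
    then show False using eq by simp
  qed
  have deg: "degree (Q b) = e b" and RR: "{k \<in> I. \<beta> k = b} = R b" if b: "b \<in> B" for b
  proof -
    have "card (R b) \<le> card {k \<in> I. \<beta> k = b}" using card[OF b] R[OF b] Q[OF b] by simp
    then show "{k \<in> I. \<beta> k = b} = R b" using card_seteq[OF finR sub] by blast
    show "degree (Q b) = e b" using card[OF b] le[of b] R[OF b] Q[OF b] by simp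
  qed
  have "poly (Q b) (\<tau> k) = 0 \<longleftrightarrow> \<beta> k = b" if "k \<in> I" "b \<in> B" for k b
    using RR[OF that(2)] that(1) by (auto simp: R_def)
  then show ?thesis using \<beta>(1) card deg by blast
qed

lemma poly_zero_if_many_roots:
  fixes p :: "complex poly"
  assumes "\<And>i. i \<ge> n \<Longrightarrow> coeff p i = 0" "finite S" "card S = n" "inj_on \<tau> S" "\<And>k. k \<in> S \<Longrightarrow> poly p (\<tau> k) = 0"
  shows "p = 0"
proof (rule ccontr)
  assume p: "p \<noteq> 0"
  then have "degree p < n" using assms(1)[of "degree p"] by (metis leading_coeff_0_iff not_le)
  moreover have "n = card (\<tau> ` S)" using assms by (simp add: card_image)
  moreover have "card (\<tau> ` S) \<le> card {x. poly p x = 0}"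
    using poly_roots_finite[OF p] assms(5) by (intro card_mono) auto
  moreover have "card {x. poly p x = 0} \<le> degree p" using card_poly_roots_bound p by blast
  ultimately show False by simp
qed

context nash
begin

text \<open>The dimension of the cone by \<open>krull_dim_cone\<close>, hence the number of
  affine-linear equations in a section of complementary dimension.\<close>

definition m :: nat where "m = card K - c"

abbreviation PK :: "(nat \<times> (nat \<times> (nat \<Rightarrow> nat)) option) set" where "PK \<equiv> param_index K m"

text \<open>Block \<open>b < r\<close> is the strategy of player \<open>b\<close>. Block
  \<open>r\<close> is the game together with a homogenising coordinate, so games are the chart of a
  projective space of dimension \<open>card K\<close>.\<close>

definition blk :: "nat \<Rightarrow> ((nat \<times> (nat \<Rightarrow> nat)) option + nat \<times> nat) set" where
  "blk b = (if b < r then Inr ` ({b} \<times> {..<d b}) else Inl ` (insert None (Some ` K)))"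

definition lead_var :: "nat \<Rightarrow> (nat \<times> (nat \<Rightarrow> nat)) option + nat \<times> nat" where
  "lead_var b = (if b < r then Inr (b, 0) else Inl None)"

definition V :: "((nat \<times> (nat \<Rightarrow> nat)) option + nat \<times> nat) set" where "V = (\<Union>b\<in>{..r}. blk b)"

definition eqs :: "(nat + nat) set" where "eqs = Inl ` {..<m} \<union> Inr ` {1..<d r}"

definition game_part :: "((nat \<times> (nat \<Rightarrow> nat)) option + nat \<times> nat \<Rightarrow> complex) \<Rightarrow>
    nat \<times> (nat \<Rightarrow> nat) \<Rightarrow> complex" where
  "game_part z \<kappa> = z (Inl (Some \<kappa>))"

definition strat_part :: "((nat \<times> (nat \<Rightarrow> nat)) option + nat \<times> nat \<Rightarrow> complex) \<Rightarrow> nat \<Rightarrow> nat \<Rightarrow> complex" where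
  "strat_part z i j = z (Inr (i, j))"

text \<open>The coordinate \<open>Inl None\<close> homogenises the affine-linear equations.\<close>
definition F :: "nat + nat \<Rightarrow> (nat \<times> (nat \<times> (nat \<Rightarrow> nat)) option \<Rightarrow> complex) \<Rightarrow>
    ((nat \<times> (nat \<Rightarrow> nat)) option + nat \<times> nat \<Rightarrow> complex) \<Rightarrow> complex" where
  "F e p z = (case e of
     Inl q \<Rightarrow> (\<Sum>\<kappa>\<in>K. p (q, Some \<kappa>) * game_part z \<kappa>) - p (q, None) * z (Inl None)
   | Inr k \<Rightarrow> form (game_part z) (strat_part z) k)"

section \<open>The square multihomogeneous system of a linear section\<close>

lemma V_iff: "Inr (i, j) \<in> V \<longleftrightarrow> i < r \<and> j < d i" "Inl (Some \<kappa>) \<in> V \<longleftrightarrow> \<kappa> \<in> K" "Inl None \<in> V"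
  by (force simp: V_def blk_def)+

lemma V_eq: "V = Inl ` (insert None (Some ` K)) \<union> Inr ` (Sigma {..<r} (\<lambda>i. {..<d i}))"
proof (rule Set.set_eqI)
  fix x show "x \<in> V \<longleftrightarrow> x \<in> Inl ` (insert None (Some ` K)) \<union> Inr ` (Sigma {..<r} (\<lambda>i. {..<d i}))"
  proof (cases x)
    case (Inl y) then show ?thesis by (cases y) (auto simp: V_iff)
  next
    case (Inr y) then show ?thesis by (cases y) (auto simp: V_iff)
  qed
qed

lemma finite_V: "finite V" by (simp add: V_eq finite_K)

lemma card_V: "card V = card K + 1 + (\<Sum>i<r. d i)"
proof -
  have "card (insert None (Some ` K)) = card K + 1" by (simp add: finite_K card_image)
  moreover have "card (Sigma {..<r} (\<lambda>i. {..<d i})) = (\<Sum>i<r. d i)" by simp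
  ultimately show ?thesis
    unfolding V_eq using card_Plus[of "insert None (Some ` K)" "Sigma {..<r} (\<lambda>i. {..<d i})"] finite_K
    by (simp add: Plus_def)
qed

lemma PK_iff: "(q, x) \<in> PK \<longleftrightarrow> q < m \<and> (case x of None \<Rightarrow> True | Some \<kappa> \<Rightarrow> \<kappa> \<in> K)"
  by (auto simp: param_index_def split: option.splits)

lemma sum_d: "(\<Sum>i<r. d i) = (\<Sum>i<r. d i - 1) + r"
proof -
  have "(\<Sum>i<r. d i) = (\<Sum>i<r. (d i - 1) + 1)"
    using d2 by (intro sum.cong refl) (metis add.commute le_add_diff_inverse less_imp_le lessThan_iff one_le_numeral order_trans)
  then show ?thesis by (simp only: sum.distrib) simp
qed

sublocale fam: multihomogeneous_family PK V "{..r}" blk lead_var eqs F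
proof
  show "finite PK" by (simp add: param_index_def finite_K)
  show "finite V" by (rule finite_V)
  show "V = (\<Union>b\<in>{..r}. blk b)" by (rule V_def)
  show "finite eqs" by (simp add: eqs_def)
  show "finite {..r}" by simp
  show "blk b \<inter> blk b' = {}" if "b \<in> {..r}" "b' \<in> {..r}" "b \<noteq> b'" for b b'
    using that by (auto simp: blk_def)
  show "lead_var b \<in> blk b" for b using d2[of b] by (auto simp: lead_var_def blk_def)
  \<comment> \<open>The product has dimension \<open>card K\<close> plus the sum of the
    \<open>d i - 1\<close>; that this equals the number of equations is the definition of
    \<open>c\<close>.\<close>
  have "card eqs = m + (d r - 1)"
    unfolding eqs_def by (subst card_Un_disjoint) (auto simp: card_image)
  then show "card eqs + card {..r} = card V"
    using card_V sum_d c_le c_eq by (simp add: m_def)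
  show "(\<lambda>x. F e (\<lambda>i. x (Inl i)) (\<lambda>k. x (Inr k))) \<in> polyfun (Inl ` PK \<union> Inr ` V)" if e: "e \<in> eqs" for e
  proof (cases e)
    case (Inl q)
    then have "q < m" using e by (auto simp: eqs_def)
    then show ?thesis unfolding Inl F_def game_part_def
      by (simp, intro polyfun_diff polyfun_sum polyfun.mult) (auto intro!: polyfun.var simp: PK_iff V_iff)
  next
    case (Inr k)
    then have "k < d r" using e by (auto simp: eqs_def)
    then show ?thesis unfolding Inr F_def game_part_def strat_part_def
      by (simp, intro form_polyfun) (auto intro!: polyfun.var simp: V_iff)
  qed
  fix e b and l :: complex assume e: "e \<in> eqs" and b: "b \<in> {..r}" and l: "l \<noteq> 0"
  have Sx: "scale (blk b) l z (Inr (i, j)) = (if i = b \<and> i < r \<and> j < d i then l * z (Inr (i, j)) else z (Inr (i, j)))"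
    "\<kappa> \<in> K \<Longrightarrow> scale (blk b) l z (Inl (Some \<kappa>)) = (if b = r then l else 1) * z (Inl (Some \<kappa>))"
    "scale (blk b) l z (Inl None) = (if b = r then l else 1) * z (Inl None)" for z i j \<kappa>
    using b by (auto simp: scale_def blk_def)
  show "\<exists>c. \<forall>p z. F e p (scale (blk b) l z) = c * F e p z"
  proof (cases e)
    case (Inl q)
    have "(\<Sum>\<kappa>\<in>K. p (q, Some \<kappa>) * scale (blk b) l z (Inl (Some \<kappa>))) =
       (if b = r then l else 1) * (\<Sum>\<kappa>\<in>K. p (q, Some \<kappa>) * z (Inl (Some \<kappa>)))" for p z
      unfolding sum_distrib_left by (intro sum.cong refl) (simp add: Sx(2))
    then show ?thesis unfolding Inl F_def game_part_def
      by (intro exI[of _ "if b = r then l else 1"] allI) (simp add: Sx(3) right_diff_distrib)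
  next
    case (Inr k)
    then have k: "k < d r" using e by (auto simp: eqs_def)
    show ?thesis
    proof (cases "b = r")
      case True
      have "scale (blk b) l z (Inl (Some \<kappa>)) = l * z (Inl (Some \<kappa>))" if "\<kappa> \<in> K" for z \<kappa>
        using Sx(2)[OF that, of z] unfolding if_P[OF True] .
      then have "A (game_part (scale (blk b) l z)) k J = l * A (game_part z) k J" if "J \<in> P" for J z
        using k upd_K[OF that, of k] upd_K[OF that, of 0]
        by (simp add: A_def game_part_def right_diff_distrib)
      moreover have "strat_part (scale (blk b) l z) i j = strat_part z i j" if "i < r" for i j z
      proof -
        have "\<not> (i = b \<and> i < r \<and> j < d i)" using True that by simp
        then show ?thesis unfolding strat_part_def Sx(1) by (rule if_not_P)
      qed
      then have "T (strat_part (scale (blk b) l z)) J = T (strat_part z) J" for J z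
        by (simp add: T_def)
      ultimately have "form (game_part (scale (blk b) l z)) (strat_part (scale (blk b) l z)) k =
          l * form (game_part z) (strat_part z) k" for z
        by (simp add: form_def sum_distrib_left mult.assoc)
      then show ?thesis unfolding Inr F_def by auto
    next
      case False
      then have br: "b < r" using b by simp
      have "A (game_part (scale (blk b) l z)) k J = A (game_part z) k J" if "J \<in> P" for J z
        using False k upd_K[OF that, of k] upd_K[OF that, of 0]
        by (simp add: A_def game_part_def Sx(2))
      then have "form (game_part (scale (blk b) l z)) \<pi> k = form (game_part z) \<pi> k" for z \<pi>
        by (simp add: form_def)
      moreover have "form X (strat_part (scale (blk b) l z)) k = l * form X (strat_part z) k" for X z
      proof -
        let ?\<rho> = "\<lambda>i j. if i = b then l * strat_part z i j else strat_part z i j"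
        have "form X (strat_part (scale (blk b) l z)) k = form X ?\<rho> k"
          by (rule form_cong) (simp add: strat_part_def Sx(1))
        also have "\<dots> = l * form X (strat_part z) k" by (rule form_scale[OF br]) simp
        finally show ?thesis .
      qed
      ultimately have "form (game_part (scale (blk b) l z)) (strat_part (scale (blk b) l z)) k =
          l * form (game_part z) (strat_part z) k" for z by simp
      then show ?thesis unfolding Inr F_def by auto
    qed
  qed
qed

text \<open>The degree contributed by \<open>J\<close> when entry \<open>j\<close> of strategy
  \<open>l\<close> is the coefficient of degree \<open>d l - 1 - j\<close>. In this reversed order
  entry 0, the chart coordinate, is the leading coefficient.\<close>

definition wt :: "(nat \<Rightarrow> nat) \<Rightarrow> nat" where "wt J = (\<Sum>l<r. d l - Suc (J l))"

text \<open>Payoffs of player 0, who is not the last player because \<open>r \<ge> 1\<close>; they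
  occur in no form and can store coefficients freely.\<close>

definition free_coord :: "nat \<Rightarrow> nat \<times> (nat \<Rightarrow> nat)" where "free_coord j = (0, zero_profile(r := j))"

definition free_coords :: "(nat \<times> (nat \<Rightarrow> nat)) set" where "free_coords = free_coord ` {..<c}"

text \<open>The last player's payoff at \<open>J(r := k)\<close> with \<open>k \<ge> 1\<close> is to
  be \<open>- (k ^ wt J)\<close> times the value at \<open>k\<close> of a polynomial of degree
  \<open>c\<close>. The index \<open>j = c\<close> belongs to its leading coefficient, the
  homogenising coordinate. All other bound payoffs are set to 0.\<close>

definition section_coeff :: "nat \<times> (nat \<Rightarrow> nat) \<Rightarrow> nat \<Rightarrow> complex" where
  "section_coeff \<kappa> j = (if fst \<kappa> = r \<and> 1 \<le> snd \<kappa> r then - (of_nat (snd \<kappa> r) ^ (j + wt (snd \<kappa>))) else 0)"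

definition bound_coord :: "nat \<Rightarrow> nat \<times> (nat \<Rightarrow> nat)" where
  "bound_coord = (SOME e. bij_betw e {..<m} (K - free_coords))"

text \<open>The affine space cut out by \<open>p0\<close> consists of games for which \<open>form X \<pi> k\<close> is the value at \<open>k\<close> of a
  product of polynomials, one with coefficients in the \<open>c\<close> free_coords coordinates and the others with
  coefficients \<open>\<pi> i\<close>.\<close>
definition p0 :: "nat \<times> (nat \<times> (nat \<Rightarrow> nat)) option \<Rightarrow> complex" where
  "p0 = (\<lambda>(q, x). if q < m then (case x of None \<Rightarrow> section_coeff (bound_coord q) c
     | Some \<kappa> \<Rightarrow> if \<kappa> \<in> K then (if \<kappa> = bound_coord q then 1 else 0) - (\<Sum>j<c. if \<kappa> = free_coord j then section_coeff (bound_coord q) j else 0) else 0)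
   else 0)"

section \<open>The special section and its factorisations\<close>

lemma c_less: "c < d r" using c_eq d2[of r] by simp

lemma free_coord_K: "j < c \<Longrightarrow> free_coord j \<in> K"
  using upd_profile[OF zero_profile_P, of j] c_less by (simp add: free_coord_def game_index_def)

lemma free_coord_inj: "free_coord j = free_coord j' \<longleftrightarrow> j = j'" using upd_inj[OF zero_profile_P zero_profile_P] by (simp add: free_coord_def)

lemma free_coords_K: "free_coords \<subseteq> K" using free_coord_K by (auto simp: free_coords_def)

lemma not_free_coords: "(r, J) \<notin> free_coords" using r1 by (auto simp: free_coords_def free_coord_def)

lemma card_free_coords: "card free_coords = c"
  using free_coord_inj by (simp add: free_coords_def card_image inj_on_def)

lemma bound_coord: "bij_betw bound_coord {..<m} (K - free_coords)"
proof -
  have "card (K - free_coords) = m" using free_coords_K finite_K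
    by (simp add: card_Diff_subset finite_subset card_free_coords m_def)
  then have "\<exists>e. bij_betw e {..<m} (K - free_coords)"
    using ex_bij_betw_nat_finite[of "K - free_coords"] finite_K by (simp add: atLeast0LessThan)
  then show ?thesis unfolding bound_coord_def by (rule someI_ex)
qed

lemma bound_coord_K: "q < m \<Longrightarrow> bound_coord q \<in> K - free_coords" using bij_betwE[OF bound_coord] by blast

lemma p0_ambient: "p0 \<in> ambient PK"
proof -
  have "p0 (q, x) = 0" if "(q, x) \<notin> PK" for q x
    using that by (auto simp: p0_def PK_iff split: option.splits)
  then show ?thesis by (auto simp: ambient_def)
qed

lemma F_linear:
  assumes q: "q < m"
  shows "F (Inl q) p0 z = game_part z (bound_coord q) - (\<Sum>j<c. section_coeff (bound_coord q) j * game_part z (free_coord j)) - section_coeff (bound_coord q) c * z (Inl None)"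
proof -
  have "(\<Sum>\<kappa>\<in>K. p0 (q, Some \<kappa>) * game_part z \<kappa>) =
      (\<Sum>\<kappa>\<in>K. (if \<kappa> = bound_coord q then game_part z \<kappa> else 0) - (\<Sum>j<c. if \<kappa> = free_coord j then section_coeff (bound_coord q) j * game_part z \<kappa> else 0))"
    using q by (intro sum.cong refl) (auto simp: p0_def left_diff_distrib sum_distrib_right intro!: sum.cong)
  also have "\<dots> = game_part z (bound_coord q) - (\<Sum>\<kappa>\<in>K. \<Sum>j<c. if \<kappa> = free_coord j then section_coeff (bound_coord q) j * game_part z \<kappa> else 0)"
    using bound_coord_K[OF q] finite_K by (simp add: sum_subtractf)
  also have "(\<Sum>\<kappa>\<in>K. \<Sum>j<c. if \<kappa> = free_coord j then section_coeff (bound_coord q) j * game_part z \<kappa> else 0) = (\<Sum>j<c. section_coeff (bound_coord q) j * game_part z (free_coord j))"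
  proof (subst sum.swap, intro sum.cong refl)
    fix j assume "j \<in> {..<c}"
    then show "(\<Sum>\<kappa>\<in>K. if \<kappa> = free_coord j then section_coeff (bound_coord q) j * game_part z \<kappa> else 0) = section_coeff (bound_coord q) j * game_part z (free_coord j)"
      using free_coord_K[of j] finite_K by simp
  qed
  finally show ?thesis using q by (simp add: F_def p0_def)
qed

definition linear :: "((nat \<times> (nat \<Rightarrow> nat)) option + nat \<times> nat \<Rightarrow> complex) \<Rightarrow> bool" where
  "linear z \<longleftrightarrow> (\<forall>\<kappa>\<in>K - free_coords. game_part z \<kappa> = (\<Sum>j<c. section_coeff \<kappa> j * game_part z (free_coord j)) + section_coeff \<kappa> c * z (Inl None))"

lemma linear_iff: "linear z \<longleftrightarrow> (\<forall>q<m. F (Inl q) p0 z = 0)"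
proof -
  have "linear z \<longleftrightarrow> (\<forall>\<kappa>\<in>bound_coord ` {..<m}. game_part z \<kappa> = (\<Sum>j<c. section_coeff \<kappa> j * game_part z (free_coord j)) + section_coeff \<kappa> c * z (Inl None))"
    using bound_coord by (simp add: linear_def bij_betw_imp_surj_on)
  also have "\<dots> \<longleftrightarrow> (\<forall>q<m. F (Inl q) p0 z = 0)"
    by (auto simp: F_linear algebra_simps)
  finally show ?thesis .
qed

text \<open>The factors whose product is sampled by the forms. In each of them the coefficient of
  degree \<open>fac_degree b\<close> is the coordinate \<open>lead_var b\<close>.\<close>

definition fac_poly :: "nat \<Rightarrow> ((nat \<times> (nat \<Rightarrow> nat)) option + nat \<times> nat \<Rightarrow> complex) \<Rightarrow> complex poly" where
  "fac_poly b z = (if b < r then \<Sum>i<d b. monom (strat_part z b (d b - Suc i)) i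
     else monom (z (Inl None)) c + (\<Sum>j<c. monom (game_part z (free_coord j)) j))"

definition fac_degree :: "nat \<Rightarrow> nat" where "fac_degree b = (if b < r then d b - 1 else c)"

lemma fac_degree_sum: "(\<Sum>b\<le>r. fac_degree b) = d r - 1"
proof -
  have "(\<Sum>b\<le>r. fac_degree b) = (\<Sum>b<r. fac_degree b) + fac_degree r" by (simp add: lessThan_Suc_atMost[symmetric])
  also have "(\<Sum>b<r. fac_degree b) = (\<Sum>b<r. d b - 1)" by (intro sum.cong) (auto simp: fac_degree_def)
  finally show ?thesis using c_eq by (simp add: fac_degree_def)
qed

lemma fac_degree_pos: "b \<le> r \<Longrightarrow> fac_degree b > 0" using d2[of b] c_pos by (auto simp: fac_degree_def)

lemma coeff_fac_poly: "coeff (fac_poly b z) i = (if b < r then if i < d b then strat_part z b (d b - Suc i) else 0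
    else if i < c then game_part z (free_coord i) else if i = c then z (Inl None) else 0)"
  by (auto simp: fac_poly_def coeff_sum)

lemma coeff_fac_poly_top: "b \<le> r \<Longrightarrow> coeff (fac_poly b z) (fac_degree b) = z (lead_var b)"
  using d2[of b] by (auto simp: coeff_fac_poly fac_degree_def lead_var_def strat_part_def)

lemma coeff_fac_poly_gt: "b \<le> r \<Longrightarrow> i > fac_degree b \<Longrightarrow> coeff (fac_poly b z) i = 0"
  using d2[of b] by (auto simp: coeff_fac_poly fac_degree_def)

lemma degree_fac_poly: "b \<le> r \<Longrightarrow> degree (fac_poly b z) \<le> fac_degree b"
  by (rule degree_le) (use coeff_fac_poly_gt in blast)

lemma poly_fac_poly_add: "poly (fac_poly b (\<lambda>k. z k + s * v k)) x = poly (fac_poly b z) x + s * poly (fac_poly b v) x"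
proof -
  have "fac_poly b (\<lambda>k. z k + s * v k) = fac_poly b z + [:s:] * fac_poly b v"
    by (rule poly_eqI) (simp add: coeff_fac_poly strat_part_def game_part_def)
  then show ?thesis by simp
qed

text \<open>The linear equations turn \<open>A\<close> into \<open>k ^ wt J\<close> times the value
  of the last factor, so the sum over \<open>J\<close> is the expansion of the product of the other
  factors at \<open>k\<close>.\<close>

lemma form_factor:
  assumes z: "linear z" and k: "k \<in> {1..<d r}"
  shows "form (game_part z) (strat_part z) k = (\<Prod>b\<le>r. poly (fac_poly b z) (of_nat k))"
proof -
  let ?X = "game_part z" and ?k = "of_nat k :: complex"
  have A: "A ?X k J = ?k ^ wt J * poly (fac_poly r z) ?k" if J: "J \<in> P" for J
  proof -
    have kr: "k < d r" "0 < d r" using k by auto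
    have "wt (J(r := k)) = wt J" by (simp add: wt_def)
    then have "?X (r, J(r := k)) = (\<Sum>j<c. - (?k ^ (j + wt J)) * ?X (free_coord j)) - ?k ^ (c + wt J) * z (Inl None)"
      using z upd_K[OF J kr(1)] not_free_coords k by (simp add: linear_def section_coeff_def)
    also have "\<dots> = - (?k ^ wt J * poly (fac_poly r z) ?k)"
      by (simp add: fac_poly_def poly_sum poly_monom sum_negf sum_distrib_left power_add algebra_simps)
    finally have "?X (r, J(r := k)) = - (?k ^ wt J * poly (fac_poly r z) ?k)" .
    moreover have "?X (r, J(r := 0)) = 0"
      using z upd_K[OF J kr(2)] not_free_coords by (simp add: linear_def section_coeff_def)
    ultimately show ?thesis by (simp add: A_def)
  qed
  have "(\<Prod>b<r. poly (fac_poly b z) ?k) = poly (\<Prod>l<r. \<Sum>j<d l. monom (strat_part z l j) (d l - Suc j)) ?k"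
  proof -
    have "fac_poly b z = (\<Sum>j<d b. monom (strat_part z b j) (d b - Suc j))" if "b < r" for b
    proof -
      have "fac_poly b z = (\<Sum>i<d b. monom (strat_part z b (d b - Suc i)) (d b - Suc (d b - Suc i)))"
        using that by (auto simp: fac_poly_def intro!: sum.cong)
      also have "\<dots> = (\<Sum>j<d b. monom (strat_part z b j) (d b - Suc j))"
        by (rule sum.nat_diff_reindex)
      finally show ?thesis .
    qed
    then show ?thesis by (simp add: poly_prod)
  qed
  also have "\<dots> = (\<Sum>J\<in>P. T (strat_part z) J * ?k ^ wt J)"
    unfolding prod_sum_monom by (simp add: poly_sum poly_monom P_def T_def wt_def)
  finally have prod: "(\<Prod>b<r. poly (fac_poly b z) ?k) = (\<Sum>J\<in>P. T (strat_part z) J * ?k ^ wt J)" .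
  have "form ?X (strat_part z) k = (\<Sum>J\<in>P. poly (fac_poly r z) ?k * (T (strat_part z) J * ?k ^ wt J))"
    unfolding form_def by (intro sum.cong refl) (simp add: A)
  also have "\<dots> = poly (fac_poly r z) ?k * (\<Prod>b<r. poly (fac_poly b z) ?k)" by (simp add: prod sum_distrib_left)
  also have "\<dots> = (\<Prod>b\<le>r. poly (fac_poly b z) ?k)" by (simp add: lessThan_Suc_atMost[symmetric])
  finally show ?thesis .
qed

text \<open>The product of the factors vanishes at the \<open>d r - 1\<close> points
  \<open>1, ..., d r - 1\<close>, and \<open>d r - 1\<close> is also the sum of the degree bounds,
  so \<open>split_roots\<close> applies.\<close>

lemma proj_zero_split:
  assumes "z \<in> fam.proj_zeros p0"
  shows "linear z" and "\<exists>\<beta>. (\<forall>k\<in>{1..<d r}. \<beta> k \<in> {..r}) \<and>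
    (\<forall>k\<in>{1..<d r}. \<forall>b\<in>{..r}. poly (fac_poly b z) (of_nat k) = 0 \<longleftrightarrow> \<beta> k = b) \<and>
    (\<forall>b\<in>{..r}. card {k \<in> {1..<d r}. \<beta> k = b} = fac_degree b \<and> degree (fac_poly b z) = fac_degree b)"
proof -
  have z: "z \<in> ambient V" "\<And>b. b \<le> r \<Longrightarrow> \<exists>k\<in>blk b. z k \<noteq> 0" "\<And>e. e \<in> eqs \<Longrightarrow> F e p0 z = 0"
    using assms by (auto simp: fam.proj_zeros_def)
  show lin: "linear z" unfolding linear_iff using z(3) by (auto simp: eqs_def)
  show "\<exists>\<beta>. (\<forall>k\<in>{1..<d r}. \<beta> k \<in> {..r}) \<and>
    (\<forall>k\<in>{1..<d r}. \<forall>b\<in>{..r}. poly (fac_poly b z) (of_nat k) = 0 \<longleftrightarrow> \<beta> k = b) \<and>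
    (\<forall>b\<in>{..r}. card {k \<in> {1..<d r}. \<beta> k = b} = fac_degree b \<and> degree (fac_poly b z) = fac_degree b)"
  proof (rule split_roots)
    show "fac_poly b z \<noteq> 0 \<and> degree (fac_poly b z) \<le> fac_degree b" if "b \<in> {..r}" for b
    proof
      show "fac_poly b z \<noteq> 0"
      proof
        assume P0: "fac_poly b z = 0"
        obtain k where k: "k \<in> blk b" "z k \<noteq> 0" using z(2) \<open>b \<in> {..r}\<close> by auto
        show False
        proof (cases "b < r")
          case True
          then obtain j where j: "j < d b" "k = Inr (b, j)" using k by (auto simp: blk_def)
          have "coeff (fac_poly b z) (d b - Suc j) = z k" using True j by (simp add: coeff_fac_poly strat_part_def)
          then show False using P0 k by simp
        next
          case False
          \<comment> \<open>The last factor contains only the free payoffs and the homogenising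
            coordinate; if these vanish, the linear equations annihilate the whole block.\<close>
          have h: "z (Inl None) = 0" using P0 False coeff_fac_poly[of b z c] by simp
          have u: "game_part z (free_coord j) = 0" if "j < c" for j using P0 False coeff_fac_poly[of b z j] that by simp
          have "game_part z \<kappa> = 0" if "\<kappa> \<in> K" for \<kappa>
            using that u h lin by (cases "\<kappa> \<in> free_coords") (auto simp: linear_def free_coords_def)
          then show False using k h False by (auto simp: blk_def game_part_def)
        qed
      qed
    qed (use degree_fac_poly that in auto)
    show "(\<Prod>b\<in>{..r}. poly (fac_poly b z) (of_nat k)) = 0" if "k \<in> {1..<d r}" for k
      using form_factor[OF lin that] z(3)[of "Inr k"] that by (auto simp: eqs_def F_def)
  qed (auto simp: fac_degree_sum inj_on_def)
qed

text \<open>Each factor attains its full degree, and its leading coefficient is the top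
  coordinate.\<close>

lemma nonzero_tops_p0: "fam.nonzero_tops p0"
  unfolding fam.nonzero_tops_def
proof (intro ballI)
  fix z b assume z: "z \<in> fam.proj_zeros p0" and b: "b \<in> {..r}"
  have deg: "degree (fac_poly b z) = fac_degree b" using proj_zero_split(2)[OF z] b by blast
  then have "fac_poly b z \<noteq> 0" using fac_degree_pos[of b] b by auto
  then have "coeff (fac_poly b z) (fac_degree b) \<noteq> 0" using deg leading_coeff_0_iff by metis
  then show "z (lead_var b) \<noteq> 0" using coeff_fac_poly_top b by simp
qed

text \<open>Exactly one factor vanishes at \<open>k\<close>, so the derivative condition says that
  the corresponding factor of \<open>v\<close> vanishes there. It then has
  \<open>fac_degree b\<close> roots, but smaller degree because \<open>v\<close> leaves the top
  coordinates fixed; so all factors of \<open>v\<close> are zero.\<close>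

lemma simple_zeros_p0: "fam.simple_zeros p0"
  unfolding fam.simple_zeros_def
proof (intro ballI impI)
  fix z v assume z: "z \<in> fam.proj_zeros p0" and v: "v \<in> ambient (V - fam.tops)"
    and der: "\<forall>e\<in>eqs. ((\<lambda>s. F e p0 (\<lambda>k. z k + s * v k)) has_field_derivative 0) (at 0)"
  have lz: "linear z" using proj_zero_split(1)[OF z] .
  from proj_zero_split(2)[OF z] obtain \<beta> where "\<forall>k\<in>{1..<d r}. \<beta> k \<in> {..r}"
    "\<forall>k\<in>{1..<d r}. \<forall>b\<in>{..r}. poly (fac_poly b z) (of_nat k) = 0 \<longleftrightarrow> \<beta> k = b"
    "\<forall>b\<in>{..r}. card {k \<in> {1..<d r}. \<beta> k = b} = fac_degree b \<and> degree (fac_poly b z) = fac_degree b"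
    by (elim exE conjE)
  then have \<beta>: "\<And>k. k \<in> {1..<d r} \<Longrightarrow> \<beta> k \<le> r"
    "\<And>k b. k \<in> {1..<d r} \<Longrightarrow> b \<le> r \<Longrightarrow> poly (fac_poly b z) (of_nat k) = 0 \<longleftrightarrow> \<beta> k = b"
    "\<And>b. b \<le> r \<Longrightarrow> card {k \<in> {1..<d r}. \<beta> k = b} = fac_degree b"
    unfolding atMost_iff by blast+
  have "F (Inl q) p0 v = 0" if q: "q < m" for q
  proof -
    have "F (Inl q) p0 (\<lambda>k. z k + s * v k) = F (Inl q) p0 z + s * F (Inl q) p0 v" for s
      by (simp add: F_linear[OF q] game_part_def algebra_simps sum.distrib sum_distrib_left)
    moreover have "((\<lambda>s. F (Inl q) p0 z + s * F (Inl q) p0 v) has_field_derivative F (Inl q) p0 v) (at 0)"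
      by (auto intro!: derivative_eq_intros)
    ultimately have "((\<lambda>s. F (Inl q) p0 (\<lambda>k. z k + s * v k)) has_field_derivative F (Inl q) p0 v) (at 0)" by simp
    moreover have "((\<lambda>s. F (Inl q) p0 (\<lambda>k. z k + s * v k)) has_field_derivative 0) (at 0)"
      using der q by (auto simp: eqs_def)
    ultimately show ?thesis by (rule DERIV_unique)
  qed
  then have lv: "linear v" by (simp add: linear_iff)
  have lzv: "linear (\<lambda>k. z k + s * v k)" for s
    using lz lv by (simp add: linear_def game_part_def algebra_simps sum.distrib sum_distrib_left)
  have root: "poly (fac_poly (\<beta> k) v) (of_nat k) = 0" if k: "k \<in> {1..<d r}" for k
  proof -
    let ?a = "\<lambda>b. poly (fac_poly b z) (of_nat k)" and ?c = "\<lambda>b. poly (fac_poly b v) (of_nat k)"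
    \<comment> \<open>What remains of the product after extracting \<open>s\<close> from its
      vanishing factor; its value at 0 is the derivative.\<close>
    let ?h = "\<lambda>s. ?c (\<beta> k) * (\<Prod>b\<in>{..r} - {\<beta> k}. ?a b + s * ?c b)"
    have a0: "?a (\<beta> k) = 0" using \<beta>(2)[OF k \<beta>(1)[OF k]] by simp
    have "F (Inr k) p0 (\<lambda>j. z j + s * v j) = s * ?h s" for s
    proof -
      have "F (Inr k) p0 (\<lambda>j. z j + s * v j) = (\<Prod>b\<le>r. ?a b + s * ?c b)"
        unfolding F_def by (simp add: form_factor[OF lzv k] poly_fac_poly_add)
      also have "\<dots> = (?a (\<beta> k) + s * ?c (\<beta> k)) * (\<Prod>b\<in>{..r} - {\<beta> k}. ?a b + s * ?c b)"
        by (rule prod.remove) (use \<beta>(1)[OF k] in auto)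
      finally show ?thesis by (simp add: a0)
    qed
    moreover have "((\<lambda>s. F (Inr k) p0 (\<lambda>j. z j + s * v j)) has_field_derivative 0) (at 0)"
      using der k by (auto simp: eqs_def)
    ultimately have "((\<lambda>s. s * ?h s) has_field_derivative 0) (at 0)" by simp
    then have "((\<lambda>s. s * ?h s / s) \<longlongrightarrow> 0) (at 0)" by (simp add: has_field_derivative_iff)
    then have h0: "(?h \<longlongrightarrow> 0) (at 0)"
      by (rule Lim_transform_eventually) (simp add: eventually_at_filter)
    have "(?h \<longlongrightarrow> ?c (\<beta> k) * (\<Prod>b\<in>{..r} - {\<beta> k}. ?a b + 0 * ?c b)) (at 0)"
      by (intro tendsto_intros)
    from tendsto_unique[OF at_neq_bot this h0]
    have "?c (\<beta> k) * (\<Prod>b\<in>{..r} - {\<beta> k}. ?a b + 0 * ?c b) = 0" .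
    moreover have "(\<Prod>b\<in>{..r} - {\<beta> k}. ?a b + 0 * ?c b) \<noteq> 0"
      using \<beta>(2)[OF k] by auto
    ultimately show ?thesis by simp
  qed
  have Pv: "fac_poly b v = 0" if b: "b \<le> r" for b
  proof (rule poly_zero_if_many_roots)
    show "card {k \<in> {1..<d r}. \<beta> k = b} = fac_degree b" by (rule \<beta>(3)[OF b])
    have "v (lead_var b) = 0" using v b by (auto simp: ambient_def fam.tops_def)
    then show "coeff (fac_poly b v) i = 0" if "i \<ge> fac_degree b" for i
      using coeff_fac_poly_top[OF b, of v] coeff_fac_poly_gt[OF b, of i v] that by (cases "i = fac_degree b") auto
    show "inj_on (of_nat :: nat \<Rightarrow> complex) {k \<in> {1..<d r}. \<beta> k = b}" by (auto simp: inj_on_def)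
    show "poly (fac_poly b v) (of_nat k) = 0" if "k \<in> {k \<in> {1..<d r}. \<beta> k = b}" for k
      using root that by auto
  qed simp
  have h: "v (Inl None) = 0" using coeff_fac_poly[of r v c] Pv[of r] by simp
  have u: "game_part v (free_coord j) = 0" if "j < c" for j using coeff_fac_poly[of r v j] Pv[of r] that by simp
  have X: "game_part v \<kappa> = 0" if "\<kappa> \<in> K" for \<kappa>
    using that u h lv by (cases "\<kappa> \<in> free_coords") (auto simp: linear_def free_coords_def)
  have \<pi>: "v (Inr (i, j)) = 0" if "i < r" "j < d i" for i j
    using coeff_fac_poly[of i v "d i - Suc j"] Pv[of i] that by (simp add: strat_part_def)
  show "\<forall>k. v k = 0"
  proof
    fix k
    have vV: "v k = 0" if "k \<notin> V" using v that by (auto simp: ambient_def)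
    show "v k = 0"
    proof (cases k)
      case (Inl x)
      then show ?thesis using vV h X V_iff by (cases x) (auto simp: game_part_def)
    next
      case (Inr y)
      then show ?thesis using vV \<pi> V_iff by (cases y) auto
    qed
  qed
qed

text \<open>The list tells which factor owns which root: entry \<open>i\<close> concerns the root
  \<open>i + 1\<close>.\<close>

definition root_poly :: "nat list \<Rightarrow> nat \<Rightarrow> complex poly" where
  "root_poly xs b = (\<Prod>i | i < d r - 1 \<and> xs ! i = b. [:- of_nat (Suc i), 1:])"

text \<open>Factor \<open>b\<close> must own \<open>fac_degree b\<close> roots, so the admissible
  lists are the permutations of this multiset, and their number is a multinomial
  coefficient.\<close>

definition root_counts :: "nat multiset" where
  "root_counts = (\<Sum>b\<in>{..r}. replicate_mset (fac_degree b) b)"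

text \<open>The factors prescribed by the list determine strategies and free payoffs; the linear
  equations dictate the other payoffs.\<close>

definition zero_of :: "nat list \<Rightarrow> (nat \<times> (nat \<Rightarrow> nat)) option + nat \<times> nat \<Rightarrow> complex" where
  "zero_of xs k = (case k of
     Inl None \<Rightarrow> 1
   | Inl (Some \<kappa>) \<Rightarrow> if \<kappa> \<in> free_coords then coeff (root_poly xs r) (snd \<kappa> r)
       else if \<kappa> \<in> K then (\<Sum>j<c. section_coeff \<kappa> j * coeff (root_poly xs r) j) + section_coeff \<kappa> c else 0
   | Inr (b, j) \<Rightarrow> if b < r \<and> j < d b then coeff (root_poly xs b) (d b - Suc j) else 0)"

section \<open>Counting the zeros at the special section\<close>

lemma count_root_counts: "count root_counts b = (if b \<le> r then fac_degree b else 0)"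
  by (simp add: root_counts_def count_sum)

lemma size_root_counts: "size root_counts = d r - 1"
  by (simp add: root_counts_def size_multiset_sum fac_degree_sum)

lemma set_root_counts: "set_mset root_counts = {..r}"
proof (rule Set.set_eqI)
  fix b show "b \<in> set_mset root_counts \<longleftrightarrow> b \<in> {..r}"
    using fac_degree_pos[of b] by (auto simp: count_root_counts simp flip: count_greater_zero_iff)
qed

lemma root_listD:
  assumes "xs \<in> permutations_of_multiset root_counts"
  shows "length xs = d r - 1" and "i < d r - 1 \<Longrightarrow> xs ! i \<le> r"
    and "b \<le> r \<Longrightarrow> card {i. i < d r - 1 \<and> xs ! i = b} = fac_degree b"
proof -
  have xs: "mset xs = root_counts" using assms by (simp add: permutations_of_multiset_def)
  then show len: "length xs = d r - 1" by (metis size_mset size_root_counts)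
  then show "xs ! i \<le> r" if "i < d r - 1"
    using xs set_root_counts that by (metis atMost_iff nth_mem set_mset_mset)
  show "card {i. i < d r - 1 \<and> xs ! i = b} = fac_degree b" if "b \<le> r"
  proof -
    have "count (mset xs) b = length (filter ((=) b) xs)" by (simp add: count_mset count_list_eq_length_filter)
    also have "\<dots> = card {i. i < length xs \<and> b = xs ! i}" by (rule length_filter_conv_card)
    also have "\<dots> = card {i. i < d r - 1 \<and> xs ! i = b}"
      using len by (intro arg_cong[of _ _ card]) auto
    finally show ?thesis using xs that by (simp add: count_root_counts)
  qed
qed

lemma root_poly_degree_lead: "degree (root_poly xs b) = card {i. i < d r - 1 \<and> xs ! i = b}" "lead_coeff (root_poly xs b) = 1"
proof -
  show "lead_coeff (root_poly xs b) = 1" unfolding root_poly_def by (simp add: lead_coeff_prod)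
  show "degree (root_poly xs b) = card {i. i < d r - 1 \<and> xs ! i = b}"
    unfolding root_poly_def by (subst degree_prod_eq_sum_degree) auto
qed

lemma root_poly_root: "poly (root_poly xs b) (of_nat k) = 0 \<longleftrightarrow> (\<exists>i. i < d r - 1 \<and> xs ! i = b \<and> k = Suc i)"
proof -
  have "(of_nat k :: complex) = of_nat (Suc i) \<longleftrightarrow> k = Suc i" for i by (rule of_nat_eq_iff)
  then show ?thesis unfolding root_poly_def by (auto simp: poly_prod algebra_simps)
qed

lemma fac_poly_zero_of:
  assumes xs: "xs \<in> permutations_of_multiset root_counts" and b: "b \<le> r"
  shows "fac_poly b (zero_of xs) = root_poly xs b"
proof (rule poly_eqI)
  fix i
  have deg: "degree (root_poly xs b) = fac_degree b" using root_poly_degree_lead root_listD(3)[OF xs b] by simp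
  have gt: "coeff (root_poly xs b) i = 0" if "i > fac_degree b" using that deg by (intro coeff_eq_0) simp
  have top: "coeff (root_poly xs b) (fac_degree b) = 1" using root_poly_degree_lead(2)[of xs b] deg by simp
  show "coeff (fac_poly b (zero_of xs)) i = coeff (root_poly xs b) i"
  proof (cases "b < r")
    case True
    then show ?thesis using gt d2[of b] by (auto simp: coeff_fac_poly strat_part_def zero_of_def fac_degree_def)
  next
    case False
    then have "b = r" using b by simp
    moreover have "game_part (zero_of xs) (free_coord j) = coeff (root_poly xs r) j" if "j < c" for j
      using that by (auto simp: game_part_def zero_of_def free_coords_def free_coord_def)
    ultimately show ?thesis using gt top by (auto simp: coeff_fac_poly fac_degree_def zero_of_def)
  qed
qed

lemma zero_of_chart:
  assumes xs: "xs \<in> permutations_of_multiset root_counts"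
  shows "zero_of xs \<in> fam.chart_zeros p0"
proof -
  have fr: "game_part (zero_of xs) (free_coord j) = coeff (root_poly xs r) j" if "j < c" for j
    using that by (auto simp: game_part_def zero_of_def free_coords_def free_coord_def)
  have lin: "linear (zero_of xs)"
    unfolding linear_def
  proof
    fix \<kappa> assume \<kappa>: "\<kappa> \<in> K - free_coords"
    then show "game_part (zero_of xs) \<kappa> =
        (\<Sum>j<c. section_coeff \<kappa> j * game_part (zero_of xs) (free_coord j)) + section_coeff \<kappa> c * zero_of xs (Inl None)"
      using fr by (simp add: game_part_def[of _ \<kappa>] zero_of_def[of _ "Inl _"])
  qed
  have "F e p0 (zero_of xs) = 0" if e: "e \<in> eqs" for e
  proof (cases e)
    case (Inl q)
    then show ?thesis using lin e by (auto simp: linear_iff eqs_def)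
  next
    case (Inr k)
    then have k: "k \<in> {1..<d r}" using e by (auto simp: eqs_def)
    have i: "k - 1 < d r - 1" "k = Suc (k - 1)" using k by auto
    have b: "xs ! (k - 1) \<le> r" using root_listD(2)[OF xs i(1)] .
    have "poly (fac_poly (xs ! (k - 1)) (zero_of xs)) (of_nat k) = 0"
      unfolding fac_poly_zero_of[OF xs b] root_poly_root using i by blast
    then have "(\<Prod>b\<le>r. poly (fac_poly b (zero_of xs)) (of_nat k)) = 0" using b by auto
    then show ?thesis using form_factor[OF lin k] Inr by (simp add: F_def)
  qed
  moreover have "zero_of xs (lead_var b) = 1" if b: "b \<in> {..r}" for b
  proof -
    have "zero_of xs (lead_var b) = coeff (root_poly xs b) (fac_degree b)"
      using coeff_fac_poly_top[of b "zero_of xs"] fac_poly_zero_of[OF xs, of b] b by simp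
    also have "\<dots> = 1" using root_poly_degree_lead[of xs b] root_listD(3)[OF xs, of b] b by simp
    finally show ?thesis .
  qed
  moreover have "zero_of xs \<in> ambient V"
    unfolding ambient_def
  proof (intro CollectI allI impI)
    fix k assume k: "k \<notin> V"
    show "zero_of xs k = 0"
    proof (cases k)
      case (Inl x)
      then show ?thesis using k V_iff free_coords_K by (cases x) (auto simp: zero_of_def)
    next
      case (Inr y)
      then show ?thesis using k V_iff by (cases y) (auto simp: zero_of_def)
    qed
  qed
  ultimately show ?thesis by (simp add: fam.chart_zeros_def)
qed

text \<open>The factors record all strategies, the free payoffs and the homogenising coordinate, and
  the linear equations compute the remaining payoffs from these.\<close>

lemma chart_zero_eqI:
  assumes z: "z \<in> fam.chart_zeros p0" and w: "w \<in> fam.chart_zeros p0"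
    and eq: "\<And>b. b \<le> r \<Longrightarrow> fac_poly b z = fac_poly b w"
  shows "z = w"
proof
  have lin: "linear u" if "u \<in> fam.chart_zeros p0" for u
    unfolding linear_iff
  proof (intro allI impI)
    fix q assume "q < m"
    then have "Inl q \<in> eqs" by (simp add: eqs_def)
    then show "F (Inl q) p0 u = 0" using that by (simp add: fam.chart_zeros_def)
  qed
  have h: "z (Inl None) = w (Inl None)" using eq[of r] coeff_fac_poly[of r z c] coeff_fac_poly[of r w c] by simp
  have u: "game_part z (free_coord j) = game_part w (free_coord j)" if "j < c" for j
    using eq[of r] coeff_fac_poly[of r z j] coeff_fac_poly[of r w j] that by simp
  have X: "game_part z \<kappa> = game_part w \<kappa>" if "\<kappa> \<in> K" for \<kappa>
  proof (cases "\<kappa> \<in> free_coords")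
    case True then show ?thesis using u by (auto simp: free_coords_def)
  next
    case False
    then show ?thesis using lin[OF z] lin[OF w] that h u by (simp add: linear_def)
  qed
  have \<pi>: "z (Inr (i, j)) = w (Inr (i, j))" if "i < r" "j < d i" for i j
    using eq[of i] coeff_fac_poly[of i z "d i - Suc j"] coeff_fac_poly[of i w "d i - Suc j"] that
    by (simp add: strat_part_def)
  fix k
  have V0: "z k = 0 \<and> w k = 0" if "k \<notin> V" using z w that by (auto simp: fam.chart_zeros_def ambient_def)
  show "z k = w k"
  proof (cases k)
    case (Inl x)
    show ?thesis
    proof (cases x)
      case None
      then show ?thesis using Inl h by simp
    next
      case (Some \<kappa>)
      show ?thesis
        using X[of \<kappa>] V0 V_iff(2)[of \<kappa>] unfolding Inl Some by (cases "\<kappa> \<in> K") (simp_all add: game_part_def)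
    qed
  next
    case (Inr y)
    obtain i j where y: "y = (i, j)" by (cases y)
    show ?thesis
      using \<pi>[of i j] V0 V_iff(1)[of i j] unfolding Inr y by (cases "i < r \<and> j < d i") simp_all
  qed
qed

text \<open>Entry \<open>i\<close> is recovered from the factors as the only one vanishing at
  \<open>i + 1\<close>.\<close>

lemma zero_of_inj: "inj_on zero_of (permutations_of_multiset root_counts)"
proof (rule inj_onI)
  fix xs ys assume xs: "xs \<in> permutations_of_multiset root_counts"
    and ys: "ys \<in> permutations_of_multiset root_counts" and eq: "zero_of xs = zero_of ys"
  show "xs = ys"
  proof (rule nth_equalityI)
    show "length xs = length ys" using root_listD(1)[OF xs] root_listD(1)[OF ys] by simp
    fix i assume "i < length xs"
    then have i: "i < d r - 1" using root_listD(1)[OF xs] by simp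
    have b: "xs ! i \<le> r" using root_listD(2)[OF xs i] .
    have "poly (root_poly xs (xs ! i)) (of_nat (Suc i)) = 0" unfolding root_poly_root using i by blast
    then have "poly (root_poly ys (xs ! i)) (of_nat (Suc i)) = 0"
      using fac_poly_zero_of[OF xs b] fac_poly_zero_of[OF ys b] eq by simp
    then show "xs ! i = ys ! i" unfolding root_poly_root by auto
  qed
qed

text \<open>The chart makes every factor monic of full degree, so it is determined by the roots that
  \<open>proj_zero_split\<close> assigns to it.\<close>

lemma zero_of_surj: "fam.chart_zeros p0 \<subseteq> zero_of ` permutations_of_multiset root_counts"
proof
  fix z assume z: "z \<in> fam.chart_zeros p0"
  then have pz: "z \<in> fam.proj_zeros p0" using fam.chart_proj by blast
  from proj_zero_split(2)[OF pz] obtain \<beta> where "\<forall>k\<in>{1..<d r}. \<beta> k \<in> {..r}"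
    "\<forall>k\<in>{1..<d r}. \<forall>b\<in>{..r}. poly (fac_poly b z) (of_nat k) = 0 \<longleftrightarrow> \<beta> k = b"
    "\<forall>b\<in>{..r}. card {k \<in> {1..<d r}. \<beta> k = b} = fac_degree b \<and> degree (fac_poly b z) = fac_degree b"
    by (elim exE conjE)
  then have \<beta>: "\<And>k. k \<in> {1..<d r} \<Longrightarrow> \<beta> k \<le> r"
    "\<And>k b. k \<in> {1..<d r} \<Longrightarrow> b \<le> r \<Longrightarrow> poly (fac_poly b z) (of_nat k) = 0 \<longleftrightarrow> \<beta> k = b"
    "\<And>b. b \<le> r \<Longrightarrow> card {k \<in> {1..<d r}. \<beta> k = b} = fac_degree b"
    unfolding atMost_iff by blast+
  define xs where "xs = map (\<lambda>i. \<beta> (Suc i)) [0..<d r - 1]"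
  have xi: "xs ! i = \<beta> (Suc i)" if "i < d r - 1" for i using that by (simp add: xs_def)
  have fibre: "{i. i < d r - 1 \<and> xs ! i = b} = (\<lambda>k. k - 1) ` {k \<in> {1..<d r}. \<beta> k = b}" for b
  proof (intro equalityI subsetI)
    fix i assume "i \<in> {i. i < d r - 1 \<and> xs ! i = b}"
    then have "i = Suc i - 1" "Suc i \<in> {k \<in> {1..<d r}. \<beta> k = b}" using xi by auto
    then show "i \<in> (\<lambda>k. k - 1) ` {k \<in> {1..<d r}. \<beta> k = b}" by blast
  next
    fix i assume "i \<in> (\<lambda>k. k - 1) ` {k \<in> {1..<d r}. \<beta> k = b}"
    then obtain k where k: "k \<in> {1..<d r}" "\<beta> k = b" "i = k - 1" by blast
    then have "Suc i = k" "i < d r - 1" by auto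
    then show "i \<in> {i. i < d r - 1 \<and> xs ! i = b}" using k xi by simp
  qed
  have cardf: "card {i. i < d r - 1 \<and> xs ! i = b} = card {k \<in> {1..<d r}. \<beta> k = b}" for b
    unfolding fibre by (rule card_image) (auto simp: inj_on_def)
  have "count (mset xs) b = count root_counts b" for b
  proof -
    have "count (mset xs) b = length (filter ((=) b) xs)" by (simp add: count_mset count_list_eq_length_filter)
    also have "\<dots> = card {i. i < length xs \<and> b = xs ! i}" by (rule length_filter_conv_card)
    also have "\<dots> = card {i. i < d r - 1 \<and> xs ! i = b}"
      by (intro arg_cong[of _ _ card]) (auto simp: xs_def)
    also have "\<dots> = count root_counts b"
    proof (cases "b \<le> r")
      case True
      then show ?thesis using cardf \<beta>(3) by (simp add: count_root_counts)
    next
      case False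
      then have "{k \<in> {1..<d r}. \<beta> k = b} = {}" using \<beta>(1) by auto
      then show ?thesis using False cardf[of b] by (simp add: count_root_counts)
    qed
    finally show ?thesis .
  qed
  then have xs: "xs \<in> permutations_of_multiset root_counts"
    by (simp add: permutations_of_multiset_def multiset_eq_iff)
  have "fac_poly b z = root_poly xs b" if b: "b \<le> r" for b
  proof -
    have "fac_poly b z - root_poly xs b = 0"
    proof (rule poly_zero_if_many_roots)
      show "card {k \<in> {1..<d r}. \<beta> k = b} = fac_degree b" by (rule \<beta>(3)[OF b])
      have "coeff (fac_poly b z) (fac_degree b) = 1"
        using coeff_fac_poly_top[OF b, of z] z b by (simp add: fam.chart_zeros_def)
      moreover have deg: "degree (root_poly xs b) = fac_degree b" using root_poly_degree_lead root_listD(3)[OF xs b] by simp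
      then have "coeff (root_poly xs b) (fac_degree b) = 1" using root_poly_degree_lead(2)[of xs b] by simp
      ultimately show "coeff (fac_poly b z - root_poly xs b) i = 0" if "i \<ge> fac_degree b" for i
        using that coeff_fac_poly_gt[OF b, of i z] coeff_eq_0[of "root_poly xs b" i] deg by (cases "i = fac_degree b") auto
      show "inj_on (of_nat :: nat \<Rightarrow> complex) {k \<in> {1..<d r}. \<beta> k = b}" by (auto simp: inj_on_def)
      fix k assume k: "k \<in> {k \<in> {1..<d r}. \<beta> k = b}"
      then have "poly (fac_poly b z) (of_nat k) = 0" using \<beta>(2)[of k b] b by simp
      moreover have "k - 1 < d r - 1" "k = Suc (k - 1)" using k by auto
      then have "poly (root_poly xs b) (of_nat k) = 0" unfolding root_poly_root using xi[of "k - 1"] k by auto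
      ultimately show "poly (fac_poly b z - root_poly xs b) (of_nat k) = 0" by simp
    qed simp
    then show ?thesis by simp
  qed
  then have "z = zero_of xs"
    using fac_poly_zero_of[OF xs] by (intro chart_zero_eqI z zero_of_chart xs) simp
  then show "z \<in> zero_of ` permutations_of_multiset root_counts" using xs by blast
qed

lemma card_chart_zeros_p0:
  "card (fam.chart_zeros p0) = fact (d r - 1) div ((\<Prod>i<r. fact (d i - 1)) * fact c)"
proof -
  have "fam.chart_zeros p0 = zero_of ` permutations_of_multiset root_counts"
    using zero_of_surj zero_of_chart by blast
  then have "card (fam.chart_zeros p0) = card (permutations_of_multiset root_counts)"
    using card_image[OF zero_of_inj] by simp
  also have "\<dots> = fact (d r - 1) div (\<Prod>b\<le>r. fact (fac_degree b))"
    by (simp add: card_permutations_of_multiset size_root_counts set_root_counts count_root_counts)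
  also have "(\<Prod>b\<le>r. fact (fac_degree b)) = (\<Prod>i<r. fact (d i - 1)) * (fact c :: nat)"
  proof -
    have "(\<Prod>b\<le>r. fact (fac_degree b)) = (\<Prod>b<r. fact (fac_degree b)) * (fact (fac_degree r) :: nat)"
      by (simp add: lessThan_Suc_atMost[symmetric] mult.commute)
    also have "(\<Prod>b<r. fact (fac_degree b)) = (\<Prod>b<r. fact (d b - 1) :: nat)"
      by (intro prod.cong) (auto simp: fac_degree_def)
    finally show ?thesis by (simp add: fac_degree_def)
  qed
  finally show ?thesis .
qed

text \<open>If one game has two solutions that differ at entry \<open>j0\<close> of strategy
  \<open>i0\<close>, the two sets of equations can be solved for two payoffs per form, up to the
  denominator \<open>w\<close>. Together with the sections through such a game this leaves fewer
  parameters than \<open>PK\<close> has coordinates, so \<open>algebraic_dependence\<close> gives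
  the polynomial.\<close>

lemma generic_unique_strategies:
  assumes i0: "i0 < r" and j0: "1 \<le> j0" "j0 < d i0"
  shows "\<exists>Q\<in>polyfun PK. (\<exists>p\<in>ambient PK. Q p \<noteq> 0) \<and>
    (\<forall>p. \<forall>z\<in>fam.chart_zeros p. \<forall>z'\<in>fam.chart_zeros p. game_part z = game_part z' \<longrightarrow>
      z (Inr (i0, j0)) \<noteq> z' (Inr (i0, j0)) \<longrightarrow> Q p = 0)"
proof -
  \<comment> \<open>In the chart \<open>T \<pi> z1\<close> is just \<open>\<pi> i0 j0\<close>, so
    this profile distinguishes the two solutions linearly.\<close>
  define z1 where "z1 = zero_profile(i0 := j0)"
  have z1_P: "z1 \<in> P" using i0 j0 P_D[OF zero_profile_P] P_r[OF zero_profile_P] by (intro P_I) (auto simp: z1_def)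
  have z1_ne: "z1 \<noteq> zero_profile"
  proof -
    have "z1 i0 = j0" "zero_profile i0 = 0" using i0 by (simp_all add: z1_def zero_profile_def)
    then show ?thesis using j0 by auto
  qed
  define K2 where "K2 = (\<lambda>k. (r, z1(r := k))) ` {1..<d r}"
  have K2_K: "K2 \<subseteq> K" using upd_K[OF z1_P] by (auto simp: K2_def)
  have cardK2: "card K2 = d r - 1"
    using upd_inj[OF z1_P z1_P] by (simp add: K2_def card_image inj_on_def)
  have K2_iff: "(r, J(r := k)) \<in> K2 \<longleftrightarrow> J = z1 \<and> k \<ge> 1" if "J \<in> P" "k < d r" for J k
    using upd_inj[OF that(1) z1_P] that(2) by (auto simp: K2_def)
  have disj: "K0 \<inter> K2 = {}"
  proof -
    have "(r, zero_profile(r := k)) \<noteq> (r, z1(r := k'))" for k k' using upd_inj[OF zero_profile_P z1_P, of k k'] z1_ne by auto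
    then show ?thesis unfolding K0_def K2_def by blast
  qed
  let ?N = "Sigma {..<r} (\<lambda>i. {1..<d i})"
  let ?Y1 = "{..<m} \<times> K" and ?Y2 = "K - K0 - K2"
  \<comment> \<open>The variables are the linear coefficients of the section, the payoffs outside
    \<open>K0\<close> and \<open>K2\<close>, and two sets of normalised strategies.\<close>
  define Y where "Y = (?Y1 <+> ?Y2) <+> (?N <+> ?N)"
  have finY: "finite Y" by (simp add: Y_def finite_K)
  have cardY: "card Y < card PK"
  proof -
    have PKc: "card PK = m * (card K + 1)"
    proof -
      have "Some ` K \<union> {None} = insert None (Some ` K)" by simp
      then show ?thesis by (simp add: param_index_def card_cartesian_product card_image finite_K)
    qed
    have "card (K - K0 - K2) = card (K - (K0 \<union> K2))" by (simp add: Diff_eq Int_assoc)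
    also have "\<dots> = card K - card (K0 \<union> K2)"
      using K0_K K2_K finite_K by (intro card_Diff_subset) (auto intro: finite_subset)
    also have "card (K0 \<union> K2) = (d r - 1) + (d r - 1)"
      using K0_K K2_K finite_K disj card_K0 cardK2 by (subst card_Un_disjoint) (auto intro: finite_subset)
    finally have c2: "card (K - K0 - K2) = card K - ((d r - 1) + (d r - 1))" .
    have le: "(d r - 1) + (d r - 1) \<le> card K"
    proof -
      have "card (K0 \<union> K2) \<le> card K" using K0_K K2_K finite_K by (intro card_mono) auto
      then show ?thesis
        using K0_K K2_K finite_K disj card_K0 cardK2 by (subst (asm) card_Un_disjoint) (auto intro: finite_subset)
    qed
    \<comment> \<open>Each form removes two payoffs and each strategy entry is counted twice, which
      leaves \<open>m * card K + card K - 2 * c\<close>. This is \<open>c\<close> less than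
      \<open>m * card K + m\<close>.\<close>
    have "card Y = (m * card K + card (K - K0 - K2)) + ((\<Sum>i<r. d i - 1) + (\<Sum>i<r. d i - 1))"
      unfolding Y_def by (simp add: card_Plus card_cartesian_product finite_K)
    also have "\<dots> < m * card K + m"
      using c2 le c_eq c_pos by (simp add: m_def)
    finally show ?thesis by (simp add: PKc)
  qed
  let ?yp = "\<lambda>y q \<kappa>. y (Inl (Inl (q, \<kappa>)))" and ?yX = "\<lambda>y \<kappa>. y (Inl (Inr \<kappa>))"
  let ?\<pi> = "\<lambda>y i j. if j = 0 then 1 else y (Inr (Inl (i, j)))"
  let ?\<rho> = "\<lambda>y i j. if j = 0 then 1 else y (Inr (Inr (i, j)))"
  \<comment> \<open>The determinant of the system of two equations for \<open>A\<close> at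
    \<open>zero_profile\<close> and at \<open>z1\<close>; it is nonzero exactly when the two entries
    differ.\<close>
  define w where "w y = ?\<rho> y i0 j0 - ?\<pi> y i0 j0" for y :: "(nat \<times> (nat \<times> (nat \<Rightarrow> nat)) + nat \<times> (nat \<Rightarrow> nat)) + (nat \<times> nat + nat \<times> nat) \<Rightarrow> complex"
  define a where "a y k J = A (?yX y) k J" for y :: "(nat \<times> (nat \<times> (nat \<Rightarrow> nat)) + nat \<times> (nat \<Rightarrow> nat)) + (nat \<times> nat + nat \<times> nat) \<Rightarrow> complex" and k J
  let ?S = "P - {zero_profile} - {z1}"
  \<comment> \<open>Subtracting the two equations of form \<open>k\<close> removes the term at
    \<open>zero_profile\<close> and leaves \<open>b y k\<close> as \<open>w y\<close> times
    \<open>A\<close> at \<open>z1\<close>.\<close>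
  define b where "b y k = (\<Sum>J\<in>?S. a y k J * (T (?\<pi> y) J - T (?\<rho> y) J))" for y k
  define G where "G \<kappa> y = (if \<kappa> \<in> K0 then w y * ?yX y (r, zero_profile(r := 0)) + (\<Sum>J\<in>?S. w y * a y (snd \<kappa> r) J * T (?\<pi> y) J)
      + b y (snd \<kappa> r) * ?\<pi> y i0 j0
    else if \<kappa> \<in> K2 then w y * ?yX y (r, z1(r := 0)) - b y (snd \<kappa> r) else w y * ?yX y \<kappa>)" for \<kappa> y
  \<comment> \<open>The constant terms of a section are forced by the condition that it passes
    through the game.\<close>
  define h where "h i y = (case snd i of Some \<kappa> \<Rightarrow> w y * ?yp y (fst i) \<kappa>
    | None \<Rightarrow> \<Sum>\<kappa>\<in>K. ?yp y (fst i) \<kappa> * G \<kappa> y)" for i y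
  have d0: "0 < d r" using d2[of r] by simp
  have \<pi>_poly: "(\<lambda>y. ?\<pi> y i j) \<in> polyfun Y" "(\<lambda>y. ?\<rho> y i j) \<in> polyfun Y" if "i < r" "j < d i" for i j
    using that by (cases "j = 0"; auto intro!: polyfun.var polyfun.const simp: Y_def)+
  have w_poly: "w \<in> polyfun Y" unfolding w_def by (intro polyfun_diff \<pi>_poly i0 j0(2))
  have X_poly: "(\<lambda>y. ?yX y \<kappa>) \<in> polyfun Y" if "\<kappa> \<in> K - K0 - K2" for \<kappa>
    using that by (auto intro!: polyfun.var simp: Y_def)
  have X0: "(r, J(r := 0)) \<in> K - K0 - K2" if "J \<in> P" for J
    using upd_K[OF that d0] K0_iff[OF that d0] K2_iff[OF that d0] by simp
  have Xk: "(r, J(r := k)) \<in> K - K0 - K2" if "J \<in> ?S" "k < d r" for J k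
    using that upd_K[of J k] K0_iff[of J k] K2_iff[of J k] by simp
  have a_poly: "(\<lambda>y. a y k J) \<in> polyfun Y" if "J \<in> ?S" "k < d r" for J k
    unfolding a_def A_def using that by (intro polyfun_diff X_poly X0 Xk) auto
  have T_poly: "(\<lambda>y. T (?\<pi> y) J) \<in> polyfun Y" "(\<lambda>y. T (?\<rho> y) J) \<in> polyfun Y" if "J \<in> ?S" for J
    using that by (auto intro!: T_polyfun \<pi>_poly)
  have b_poly: "(\<lambda>y. b y k) \<in> polyfun Y" if "k < d r" for k
    unfolding b_def by (intro polyfun_sum polyfun.mult polyfun_diff a_poly T_poly that)
  have snd_r: "snd \<kappa> r < d r" if "\<kappa> \<in> K0 \<or> \<kappa> \<in> K2" for \<kappa> using that by (auto simp: K0_def K2_def)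
  have G_poly: "G \<kappa> \<in> polyfun Y" if \<kappa>: "\<kappa> \<in> K" for \<kappa>
  proof -
    consider "\<kappa> \<in> K0" | "\<kappa> \<notin> K0" "\<kappa> \<in> K2" | "\<kappa> \<notin> K0" "\<kappa> \<notin> K2" by blast
    then show ?thesis
    proof cases
      case 1
      have k: "snd \<kappa> r < d r" using 1 snd_r by blast
      have "(\<lambda>y. w y * ?yX y (r, zero_profile(r := 0)) + (\<Sum>J\<in>?S. w y * a y (snd \<kappa> r) J * T (?\<pi> y) J)
          + b y (snd \<kappa> r) * ?\<pi> y i0 j0) \<in> polyfun Y"
        by (intro polyfun.add polyfun_sum polyfun.mult w_poly X_poly X0 zero_profile_P a_poly T_poly b_poly \<pi>_poly k i0 j0(2))
      then show ?thesis unfolding G_def using 1 by simp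
    next
      case 2
      have k: "snd \<kappa> r < d r" using 2 snd_r by blast
      have "(\<lambda>y. w y * ?yX y (r, z1(r := 0)) - b y (snd \<kappa> r)) \<in> polyfun Y"
        by (intro polyfun_diff polyfun.mult w_poly X_poly X0 z1_P b_poly k)
      then show ?thesis unfolding G_def using 2 by simp
    next
      case 3
      have "(\<lambda>y. w y * ?yX y \<kappa>) \<in> polyfun Y" using 3 \<kappa> by (intro polyfun.mult w_poly X_poly) simp
      then show ?thesis unfolding G_def using 3 by simp
    qed
  qed
  have yp_poly: "(\<lambda>y. ?yp y q \<kappa>) \<in> polyfun Y" if "q < m" "\<kappa> \<in> K" for q \<kappa>
    using that by (auto intro!: polyfun.var simp: Y_def)
  have h_poly: "h i \<in> polyfun Y" if "i \<in> PK" for i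
  proof -
    obtain q x where i: "i = (q, x)" by (cases i)
    then have q: "q < m" using that PK_iff by simp
    show ?thesis
    proof (cases x)
      case None
      have "(\<lambda>y. \<Sum>\<kappa>\<in>K. ?yp y q \<kappa> * G \<kappa> y) \<in> polyfun Y" by (intro polyfun_sum polyfun.mult yp_poly G_poly q)
      then show ?thesis unfolding h_def i None by simp
    next
      case (Some \<kappa>)
      then have "\<kappa> \<in> K" using that i PK_iff by simp
      then have "(\<lambda>y. w y * ?yp y q \<kappa>) \<in> polyfun Y" by (intro polyfun.mult w_poly yp_poly q)
      then show ?thesis unfolding h_def i Some by simp
    qed
  qed
  have finPK: "finite PK" by (simp add: param_index_def finite_K)
  have "\<exists>P\<in>polyfun PK. (\<exists>p\<in>ambient PK. P p \<noteq> 0) \<and>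
      (\<forall>y p. w y \<noteq> 0 \<longrightarrow> (\<forall>i\<in>PK. w y * p i = h i y) \<longrightarrow> P p = 0)"
    by (rule algebraic_dependence[OF finY finPK cardY w_poly]) (rule h_poly)
  then obtain Q where Q0: "Q \<in> polyfun PK" and Q1: "(\<exists>p\<in>ambient PK. Q p \<noteq> 0) \<and>
      (\<forall>y p. w y \<noteq> 0 \<longrightarrow> (\<forall>i\<in>PK. w y * p i = h i y) \<longrightarrow> Q p = 0)" by (rule bexE)
  note Q = Q0 conjunct1[OF Q1] conjunct2[OF Q1]
  have "Q p = 0" if z: "z \<in> fam.chart_zeros p" and z': "z' \<in> fam.chart_zeros p"
    and X: "game_part z = game_part z'" and ne: "z (Inr (i0, j0)) \<noteq> z' (Inr (i0, j0))" for p z z'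
  proof -
    let ?X = "game_part z"
    define y where "y = case_sum (case_sum (\<lambda>(q, \<kappa>). p (q, Some \<kappa>)) ?X)
      (case_sum (\<lambda>(i, j). z (Inr (i, j))) (\<lambda>(i, j). z' (Inr (i, j))))"
    have yX: "?yX y = ?X" and yp: "?yp y = (\<lambda>q \<kappa>. p (q, Some \<kappa>))" by (auto simp: y_def)
    have wy: "w y = z' (Inr (i0, j0)) - z (Inr (i0, j0))" using j0 by (simp add: w_def y_def)
    have top: "u (Inr (i, 0)) = 1" if "u \<in> fam.chart_zeros p" "i < r" for u i
    proof -
      have "u (lead_var i) = 1" using that by (simp add: fam.chart_zeros_def)
      then show ?thesis using that by (simp add: lead_var_def)
    qed
    have \<pi>: "?\<pi> y i j = strat_part z i j" "?\<rho> y i j = strat_part z' i j" if "i < r" for i j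
      using top[OF z that] top[OF z' that] by (simp_all add: y_def strat_part_def)
    have T: "T (?\<pi> y) J = T (strat_part z) J" "T (?\<rho> y) J = T (strat_part z') J" for J
      unfolding T_def using \<pi> by simp_all
    have split: "form ?X \<sigma> k = A ?X k zero_profile + (A ?X k z1 * \<sigma> i0 j0 + (\<Sum>J\<in>?S. A ?X k J * T \<sigma> J))"
      if \<sigma>: "\<And>i. i < r \<Longrightarrow> \<sigma> i 0 = 1" for \<sigma> k
    proof -
      have "T \<sigma> z1 = (\<Prod>l<r. if l = i0 then \<sigma> i0 j0 else 1)"
        unfolding T_def by (intro prod.cong refl) (simp add: z1_def zero_profile_def \<sigma>)
      then have "T \<sigma> z1 = \<sigma> i0 j0" using i0 by simp
      moreover have "(\<Sum>J\<in>P - {zero_profile}. A ?X k J * T \<sigma> J) = A ?X k z1 * T \<sigma> z1 + (\<Sum>J\<in>?S. A ?X k J * T \<sigma> J)"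
        using finite_P z1_P z1_ne by (intro sum.remove) auto
      ultimately show ?thesis using T_o[of \<sigma>] \<sigma> by (simp add: form_split_o)
    qed
    have form0: "form (game_part u) (strat_part u) k = 0" if "u \<in> fam.chart_zeros p" "k \<in> {1..<d r}" for u k
    proof -
      have "Inr k \<in> eqs" using that by (simp add: eqs_def)
      then have "F (Inr k) p u = 0" using that by (simp add: fam.chart_zeros_def)
      then show ?thesis by (simp add: F_def)
    qed
    have e1: "A ?X k zero_profile + (A ?X k z1 * strat_part z i0 j0 + (\<Sum>J\<in>?S. A ?X k J * T (strat_part z) J)) = 0"
      if "k \<in> {1..<d r}" for k
      using form0[OF z that] split[of "strat_part z" k] top[OF z] by (simp add: strat_part_def)
    have e2: "A ?X k zero_profile + (A ?X k z1 * strat_part z' i0 j0 + (\<Sum>J\<in>?S. A ?X k J * T (strat_part z') J)) = 0"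
      if "k \<in> {1..<d r}" for k
      using form0[OF z' that] split[of "strat_part z'" k] top[OF z'] X by (simp add: strat_part_def)
    have b_eq: "b y k = (\<Sum>J\<in>?S. A ?X k J * T (strat_part z) J) - (\<Sum>J\<in>?S. A ?X k J * T (strat_part z') J)" for k
      unfolding b_def a_def yX T by (simp add: right_diff_distrib sum_subtractf)
    have A1: "w y * A ?X k z1 = b y k" if k: "k \<in> {1..<d r}" for k
    proof -
      have "A ?X k z1 * strat_part z' i0 j0 - A ?X k z1 * strat_part z i0 j0 = b y k"
        using e1[OF k] e2[OF k] unfolding b_eq by (simp add: algebra_simps add_eq_0_iff)
      then show ?thesis by (simp add: wy strat_part_def algebra_simps)
    qed
    have A0: "w y * A ?X k zero_profile = - ((\<Sum>J\<in>?S. w y * a y k J * T (?\<pi> y) J) + b y k * ?\<pi> y i0 j0)"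
      if k: "k \<in> {1..<d r}" for k
    proof -
      have e: "A ?X k zero_profile = - (A ?X k z1 * strat_part z i0 j0 + (\<Sum>J\<in>?S. A ?X k J * T (strat_part z) J))"
        using e1[OF k] unfolding eq_neg_iff_add_eq_0 .
      have "w y * A ?X k zero_profile = - (w y * A ?X k z1 * strat_part z i0 j0 +
          w y * (\<Sum>J\<in>?S. A ?X k J * T (strat_part z) J))"
        unfolding e by (simp only: mult_minus_right distrib_left mult.assoc)
      also have "w y * A ?X k z1 = b y k" by (rule A1[OF k])
      also have "w y * (\<Sum>J\<in>?S. A ?X k J * T (strat_part z) J) = (\<Sum>J\<in>?S. w y * a y k J * T (?\<pi> y) J)"
        unfolding a_def yX T by (simp add: sum_distrib_left mult.assoc)
      finally show ?thesis unfolding \<pi>(1)[OF i0] by simp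
    qed
    have G: "w y * ?X \<kappa> = G \<kappa> y" for \<kappa>
    proof -
      consider k where "\<kappa> = (r, zero_profile(r := k))" "k \<in> {1..<d r}" "\<kappa> \<in> K0"
        | k where "\<kappa> = (r, z1(r := k))" "k \<in> {1..<d r}" "\<kappa> \<notin> K0" "\<kappa> \<in> K2" | "\<kappa> \<notin> K0" "\<kappa> \<notin> K2"
        using disj unfolding K0_def K2_def by blast
      then show ?thesis
      proof cases
        case 1
        have "w y * ?X \<kappa> = w y * ?X (r, zero_profile(r := 0)) - w y * A ?X k zero_profile"
          unfolding 1(1) A_def by (simp add: algebra_simps)
        then show ?thesis using 1(3) unfolding A0[OF 1(2)] by (simp add: G_def 1(1) fun_cong[OF yX])
      next
        case 2
        have "w y * ?X \<kappa> = w y * ?X (r, z1(r := 0)) - w y * A ?X k z1"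
          unfolding 2(1) A_def by (simp add: algebra_simps)
        then show ?thesis using 2(3,4) unfolding A1[OF 2(2)] by (simp add: G_def 2(1) fun_cong[OF yX])
      next
        case 3
        then show ?thesis by (simp add: G_def fun_cong[OF yX])
      qed
    qed
    have "w y * p i = h i y" if i: "i \<in> PK" for i
    proof -
      obtain q x where qx: "i = (q, x)" by (cases i)
      then have q: "q < m" using i PK_iff by simp
      show ?thesis
      proof (cases x)
        case None
        have "Inl q \<in> eqs" using q by (simp add: eqs_def)
        then have "F (Inl q) p z = 0" using z by (simp add: fam.chart_zeros_def)
        moreover have "z (lead_var r) = 1" using z by (simp add: fam.chart_zeros_def)
        ultimately have "p (q, None) = (\<Sum>\<kappa>\<in>K. p (q, Some \<kappa>) * ?X \<kappa>)" by (simp add: F_def lead_var_def)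
        then have "w y * p (q, None) = (\<Sum>\<kappa>\<in>K. p (q, Some \<kappa>) * (w y * ?X \<kappa>))"
          by (simp add: sum_distrib_left mult_ac)
        then show ?thesis unfolding G qx None h_def by (simp add: fun_cong[OF fun_cong[OF yp]])
      next
        case (Some \<kappa>)
        then show ?thesis unfolding qx h_def by (simp add: fun_cong[OF fun_cong[OF yp]])
      qed
    qed
    moreover have "w y \<noteq> 0" using wy ne by simp
    ultimately show ?thesis using Q(3)[rule_format, of y p] by blast
  qed
  then show ?thesis using Q(1,2) by blast
qed

text \<open>An affine section sees games with homogenising coordinate 1, and
  \<open>nonzero_tops\<close> permits dividing each witnessing strategy by its entry 0. Every game
  of the section thus comes from a normalised zero.\<close>

lemma cone_section:
  assumes p: "fam.nonzero_tops p"
  shows "W d \<inter> affine_section K m p = game_part ` fam.chart_zeros p"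
proof (intro equalityI subsetI)
  fix X assume "X \<in> W d \<inter> affine_section K m p"
  then obtain \<pi> where X: "X \<in> ambient K" and \<pi>: "\<And>i. i < r \<Longrightarrow> \<exists>j<d i. \<pi> i j \<noteq> 0"
    "\<And>k. k \<in> {1..<d r} \<Longrightarrow> form X \<pi> k = 0"
    and sec: "\<And>q. q < m \<Longrightarrow> (\<Sum>k\<in>K. p (q, Some k) * X k) = p (q, None)"
    unfolding W_def affine_section_def by blast
  define Z where "Z \<sigma> k = (case k of Inl None \<Rightarrow> 1 | Inl (Some \<kappa>) \<Rightarrow> X \<kappa>
    | Inr (i, j) \<Rightarrow> if i < r \<and> j < d i then \<sigma> i j else 0)" for \<sigma> :: "nat \<Rightarrow> nat \<Rightarrow> complex" and k
  have ZX: "game_part (Z \<sigma>) = X" and Z1: "Z \<sigma> (Inl None) = 1" for \<sigma> by (auto simp: game_part_def Z_def)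
  have ZV: "Z \<sigma> \<in> ambient V" for \<sigma>
    unfolding ambient_def
  proof (intro CollectI allI impI)
    fix k assume k: "k \<notin> V"
    show "Z \<sigma> k = 0"
    proof (cases k)
      case (Inl x)
      then show ?thesis using k V_iff X by (cases x) (auto simp: Z_def ambient_def)
    next
      case (Inr y)
      then show ?thesis using k V_iff by (cases y) (auto simp: Z_def)
    qed
  qed
  have ZF: "F e p (Z \<sigma>) = 0" if e: "e \<in> eqs" and \<sigma>: "\<And>k. k \<in> {1..<d r} \<Longrightarrow> form X \<sigma> k = 0" for e \<sigma>
  proof (cases e)
    case (Inl q)
    then show ?thesis using e sec[of q] by (auto simp: F_def ZX Z1 eqs_def)
  next
    case (Inr k)
    have "form X (strat_part (Z \<sigma>)) k = form X \<sigma> k" by (rule form_cong) (simp add: strat_part_def Z_def)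
    then show ?thesis using e \<sigma>[of k] Inr by (auto simp: F_def ZX eqs_def)
  qed
  have "\<exists>k\<in>blk b. Z \<pi> k \<noteq> 0" if "b \<in> {..r}" for b
  proof (cases "b < r")
    case True
    then obtain j where "j < d b" "\<pi> b j \<noteq> 0" using \<pi>(1) by blast
    then show ?thesis using True by (intro bexI[of _ "Inr (b, j)"]) (auto simp: Z_def blk_def)
  next
    case False
    then show ?thesis by (intro bexI[of _ "Inl None"]) (auto simp: Z_def blk_def)
  qed
  then have "Z \<pi> \<in> fam.proj_zeros p" using ZV ZF \<pi>(2) by (simp add: fam.proj_zeros_def)
  then have t: "Z \<pi> (lead_var i) \<noteq> 0" if "i < r" for i using p that by (simp add: fam.nonzero_tops_def)
  have \<pi>0: "\<pi> i 0 \<noteq> 0" if "i < r" for i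
    using t[OF that] that by (simp add: lead_var_def Z_def split: if_splits)
  define \<sigma> where "\<sigma> i j = \<pi> i j / \<pi> i 0" for i j
  have "T \<sigma> J = T \<pi> J / (\<Prod>i<r. \<pi> i 0)" for J by (simp add: T_def \<sigma>_def prod_dividef)
  then have "form X \<sigma> k = form X \<pi> k / (\<Prod>i<r. \<pi> i 0)" for k
    by (simp add: form_def sum_divide_distrib)
  then have \<sigma>: "form X \<sigma> k = 0" if "k \<in> {1..<d r}" for k using \<pi>(2)[OF that] by simp
  have "Z \<sigma> (lead_var b) = 1" if "b \<in> {..r}" for b
    using \<pi>0[of b] d2[of b] that by (auto simp: lead_var_def Z_def \<sigma>_def)
  then have "Z \<sigma> \<in> fam.chart_zeros p" using ZV ZF[OF _ \<sigma>] by (simp add: fam.chart_zeros_def)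
  then show "X \<in> game_part ` fam.chart_zeros p" using ZX by (metis image_eqI)
next
  fix X assume "X \<in> game_part ` fam.chart_zeros p"
  then obtain z where z: "z \<in> fam.chart_zeros p" "X = game_part z" by blast
  have zV: "z \<in> ambient V" and zt: "\<And>b. b \<le> r \<Longrightarrow> z (lead_var b) = 1" and zF: "\<And>e. e \<in> eqs \<Longrightarrow> F e p z = 0"
    using z(1) by (auto simp: fam.chart_zeros_def)
  have X: "X \<in> ambient K"
    unfolding z(2) ambient_def game_part_def using zV V_iff(2) by (auto simp: ambient_def)
  have "form X (strat_part z) k = 0" if "k \<in> {1..<d r}" for k
  proof -
    have "Inr k \<in> eqs" using that by (simp add: eqs_def)
    from zF[OF this] show ?thesis by (simp add: F_def z(2))
  qed
  moreover have "\<exists>j<d i. strat_part z i j \<noteq> 0" if "i < r" for i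
    using zt[of i] d2[of i] that by (intro exI[of _ 0]) (auto simp: lead_var_def strat_part_def)
  moreover have "strat_part z i j = 0" if "i < r" "j \<ge> d i" for i j
    using zV V_iff(1)[of i j] that by (auto simp: ambient_def strat_part_def)
  ultimately have "X \<in> W d" unfolding W_def using X by blast
  moreover have "(\<Sum>k\<in>K. p (q, Some k) * X k) = p (q, None)" if "q < m" for q
  proof -
    have "Inl q \<in> eqs" using that by (simp add: eqs_def)
    from zF[OF this] zt[of r] show ?thesis by (simp add: F_def z(2) lead_var_def)
  qed
  ultimately show "X \<in> W d \<inter> affine_section K m p" using X by (simp add: affine_section_def)
qed

lemma has_degree_cone:
  "has_degree K (W d) (fact (d r - 1) div ((\<Prod>i<r. fact (d i - 1)) * fact c))"
proof -
  obtain Q where Q: "Q \<in> polyfun PK" "Q p0 \<noteq> 0" and good: "\<And>p. p \<in> ambient PK \<Longrightarrow> Q p \<noteq> 0 \<Longrightarrow>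
    fam.nonzero_tops p \<and> finite (fam.chart_zeros p) \<and> card (fam.chart_zeros p) = card (fam.chart_zeros p0)"
    using fam.conservation_of_number[OF p0_ambient nonzero_tops_p0 simple_zeros_p0] by blast
  let ?N = "Sigma {..<r} (\<lambda>i. {1..<d i})"
  let ?U = "\<lambda>n Q. Q \<in> polyfun PK \<and> (\<exists>p\<in>ambient PK. Q p \<noteq> 0) \<and>
    (\<forall>p. \<forall>z\<in>fam.chart_zeros p. \<forall>z'\<in>fam.chart_zeros p. game_part z = game_part z' \<longrightarrow>
      z (Inr n) \<noteq> z' (Inr n) \<longrightarrow> Q p = 0)"
  define R where "R n = (SOME Q. ?U n Q)" for n
  have "\<exists>Q. ?U n Q" if n: "n \<in> ?N" for n
  proof -
    obtain i j where ij: "n = (i, j)" by (cases n)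
    then have "i < r" "1 \<le> j" "j < d i" using n by auto
    from generic_unique_strategies[OF this] show ?thesis unfolding ij Bex_def .
  qed
  then have R: "?U n (R n)" if "n \<in> ?N" for n
    unfolding R_def using that by (intro someI_ex[of "?U n"])
  have "\<exists>p\<in>ambient PK. (\<Prod>n\<in>?N. R n p) \<noteq> 0"
    by (rule polyfun_prod_nonzero[where K = PK]) (use R in auto)
  then obtain p1 where p1: "p1 \<in> ambient PK" "(\<Prod>n\<in>?N. R n p1) \<noteq> 0" by blast
  have Rp: "(\<lambda>p. \<Prod>n\<in>?N. R n p) \<in> polyfun PK" using R by (intro polyfun_prod) blast
  \<comment> \<open>\<open>Q\<close> fixes the number of normalised zeros; the factors
    \<open>R n\<close>, one for each strategy entry outside the chart coordinates, make the passage
    from zeros to games injective.\<close>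
  define S where "S p = Q p * (\<Prod>n\<in>?N. R n p)" for p
  have S: "S \<in> polyfun PK" unfolding S_def by (intro polyfun.mult Q(1) Rp)
  have "\<exists>p\<in>ambient PK. S p \<noteq> 0"
    using polyfun_common_nonzero[OF Q(1) Rp Q(2) p1(2) p0_ambient p1(1)] by (auto simp: S_def)
  moreover have "finite (W d \<inter> affine_section K m p) \<and> card (W d \<inter> affine_section K m p) = card (fam.chart_zeros p0)"
    if p: "p \<in> ambient PK" "S p \<noteq> 0" for p
  proof -
    have Qp: "Q p \<noteq> 0" and Rn: "\<And>n. n \<in> ?N \<Longrightarrow> R n p \<noteq> 0" using p(2) by (auto simp: S_def)
    note gp = good[OF p(1) Qp]
    have "inj_on game_part (fam.chart_zeros p)"
    proof (rule inj_onI)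
      fix z z' assume z: "z \<in> fam.chart_zeros p" "z' \<in> fam.chart_zeros p" and eq: "game_part z = game_part z'"
      have V0: "z k = 0 \<and> z' k = 0" if "k \<notin> V" for k
        using z that by (auto simp: fam.chart_zeros_def ambient_def)
      have t: "z (lead_var b) = 1 \<and> z' (lead_var b) = 1" if "b \<le> r" for b
        using z that by (auto simp: fam.chart_zeros_def)
      show "z = z'"
      proof
        fix k show "z k = z' k"
        proof (cases k)
          case (Inl x)
          then show ?thesis
            using t[of r] fun_cong[OF eq] by (cases x) (simp_all add: lead_var_def game_part_def)
        next
          case (Inr n)
          obtain i j where n: "n = (i, j)" by (cases n)
          consider "i < r \<and> j = 0" | "n \<in> ?N" | "k \<notin> V"
            using V_iff(1)[of i j] unfolding Inr n by fastforce
          then show ?thesis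
          proof cases
            case 1
            then show ?thesis using t[of i] Inr n by (simp add: lead_var_def)
          next
            case 2
            then show ?thesis using R[OF 2] Rn[OF 2] z eq unfolding Inr by blast
          next
            case 3
            then show ?thesis using V0 by simp
          qed
        qed
      qed
    qed
    then show ?thesis using gp cone_section[of p] by (simp add: card_image)
  qed
  ultimately show ?thesis
    unfolding has_degree_def krull_dim_cone m_def[symmetric] Let_def card_chart_zeros_p0[symmetric]
    using S by blast
qed

end

theorem theorem3p31:
  fixes n :: nat and d :: "nat \<Rightarrow> nat"
  assumes "n \<ge> 2"
    and "\<forall>i<n. d i \<ge> 2"
    and "d (n - 1) - 1 > (\<Sum>i<n - 1. d i - 1)"
  shows "zariski_irreducible (game_index n d) (nash_resultant_cone n d)
    \<and> zariski_codim (game_index n d) (nash_resultant_cone n d)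
        = d (n - 1) - 1 - (\<Sum>i<n - 1. d i - 1)
    \<and> has_degree (game_index n d) (nash_resultant_cone n d)
        (fact (d (n - 1) - 1) div
          ((\<Prod>i<n - 1. fact (d i - 1)) * fact (d (n - 1) - 1 - (\<Sum>i<n - 1. d i - 1))))"
proof -
  interpret nash "n - 1" d
    using assms by unfold_locales auto
  have n: "Suc (n - 1) = n" using assms(1) by simp
  have "zariski_irreducible (game_index n d) (W d)"
    using W_irreducible[of d] assms(2) unfolding n by (metis One_nat_def Suc_leD n less_Suc_eq numeral_2_eq_2 order_refl)
  moreover have "zariski_codim (game_index n d) (W d) = c"
    using krull_dim_cone c_le unfolding zariski_codim_def n by simp
  ultimately show ?thesis
    using has_degree_cone nash_resultant_cone_eq unfolding n c_def by simp
qed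

end
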